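(* Let $M$ be a compact Kähler manifold (without boundary) with Kähler metric $\langle\cdot,\cdot\rangle$ and complex structure $\mathcal J$, let $f$ and $U$ be smooth functions on $M$, and let $\rho_t$ be a positive smooth solution, for $t\in(0,T)$, of $$\dot\rho_t=\Delta\rho_t+\langle\nabla\rho_t,\nabla f\rangle+U\rho_t$$ on $M$. Let $W=\Delta f+\frac12|\nabla f|^2-2U$ and let $k\neq0$ be a real constant. Assume that (1) $M$ has non-negative bisectional curvature; (2) $\frac12\left(\nabla^2W+\mathcal J^*\nabla^2W\mathcal J\right)\le k^2I$. Then for every $t\in(0,T)$, at every point of $M$, $$\nabla^2\left(\log\rho_t+\frac12f\right)+\mathcal J^*\nabla^2\left(\log\rho_t+\frac12f\right)\mathcal J\ge-k\coth(kt)\,I.$$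
   Context: A dot denotes the derivative in $t$. $\nabla$ is the Levi-Civita connection of the Kähler metric viewed as a Riemannian metric (and $\nabla h$ the Riemannian gradient of a function $h$), $\Delta=\operatorname{div}\nabla$ is the Laplace-Beltrami operator. The Hessian $\nabla^2h$ of a function $h$ is regarded as the self-adjoint endomorphism $v\mapsto\nabla_v\nabla h$; $\mathcal J^*$ is the adjoint of $\mathcal J$ with respect to the Riemannian metric. $I$ is the identity, and $P\le Q$ for self-adjoint endomorphisms means $\langle Pv,v\rangle\le\langle Qv,v\rangle$ for all real tangent vectors $v$. Non-negative bisectional curvature means $\langle\mathrm{Rm}(v,w)w,v\rangle+\langle\mathrm{Rm}(v,\mathcal Jw)\mathcal Jw,v\rangle\ge0$ for all real tangent vectors $v,w$, where $\mathrm{Rm}(u,v)w=\nabla_u\nabla_vw-\nabla_v\nabla_uw-\nabla_{[u,v]}w$. *)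

theory Defs
  imports "HOL-Analysis.Analysis"
begin

section \<open>Smooth functions on open subsets of Euclidean spaces\<close>

text \<open>
  \<open>C_diff n S f\<close>: on the open set \<open>S\<close>, \<open>f\<close> is \<open>n\<close> times continuously differentiable.
  In finite dimension it suffices to require this of all iterated directional derivatives.
\<close>

primrec C_diff :: "nat \<Rightarrow> 'a::euclidean_space set \<Rightarrow> ('a \<Rightarrow> 'b::real_normed_vector) \<Rightarrow> bool" where
  "C_diff 0 S f \<longleftrightarrow> continuous_on S f"
| "C_diff (Suc n) S f \<longleftrightarrow>
     (\<forall>x\<in>S. f differentiable (at x)) \<and>
     (\<forall>v. C_diff n S (\<lambda>x. frechet_derivative f (at x) v))"

definition smooth_on :: "'a::euclidean_space set \<Rightarrow> ('a \<Rightarrow> 'b::real_normed_vector) \<Rightarrow> bool" where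
  "smooth_on S f \<longleftrightarrow> (\<forall>n. C_diff n S f)"


section \<open>Riemannian geometry in local coordinates\<close>

text \<open>
  A Riemannian metric on an open subset of a Euclidean space \<open>'e\<close> is a function \<open>G\<close> where
  \<open>G x u v\<close> is the inner product at \<open>x\<close> of the tangent vectors with components \<open>u\<close> and \<open>v\<close>.
  Vector fields are functions \<open>'e \<Rightarrow> 'e\<close>; the coordinate vector fields are the constant ones.
  Only the values of \<open>G\<close> and of the fields near \<open>x\<close> matter for the notions below.
\<close>

type_synonym 'e metric_field = "'e \<Rightarrow> 'e \<Rightarrow> 'e \<Rightarrow> real"

definition riemannian_metric_on :: "'e::euclidean_space set \<Rightarrow> 'e metric_field \<Rightarrow> bool" where
  "riemannian_metric_on D G \<longleftrightarrow>
     (\<forall>u v. smooth_on D (\<lambda>x. G x u v)) \<and>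
     (\<forall>x\<in>D. bilinear (G x) \<and> (\<forall>u v. G x u v = G x v u) \<and> (\<forall>v. v \<noteq> 0 \<longrightarrow> G x v v > 0))"

text \<open>The vector representing the linear form \<open>l\<close> with respect to the inner product \<open>G x\<close>.\<close>

definition sharp :: "'e::euclidean_space metric_field \<Rightarrow> 'e \<Rightarrow> ('e \<Rightarrow> real) \<Rightarrow> 'e" where
  "sharp G x l = (THE z. \<forall>w. G x z w = l w)"

text \<open>Koszul's formula for \<open>\<nabla>\<^sub>u v\<close> with coordinate (constant) vector fields \<open>u\<close>, \<open>v\<close>.\<close>

definition christoffel :: "'e::euclidean_space metric_field \<Rightarrow> 'e \<Rightarrow> 'e \<Rightarrow> 'e \<Rightarrow> 'e" where
  "christoffel G x u v = sharp G x (\<lambda>w.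
     (frechet_derivative (\<lambda>y. G y v w) (at x) u
    + frechet_derivative (\<lambda>y. G y u w) (at x) v
    - frechet_derivative (\<lambda>y. G y u v) (at x) w) / 2)"

text \<open>The Levi-Civita connection \<open>\<nabla>\<^sub>X Y\<close>.\<close>

definition nabla ::
  "'e::euclidean_space metric_field \<Rightarrow> ('e \<Rightarrow> 'e) \<Rightarrow> ('e \<Rightarrow> 'e) \<Rightarrow> ('e \<Rightarrow> 'e)" where
  "nabla G X Y = (\<lambda>x. frechet_derivative Y (at x) (X x) + christoffel G x (X x) (Y x))"

definition lie_bracket :: "('e::euclidean_space \<Rightarrow> 'e) \<Rightarrow> ('e \<Rightarrow> 'e) \<Rightarrow> ('e \<Rightarrow> 'e)" where
  "lie_bracket X Y =
     (\<lambda>x. frechet_derivative Y (at x) (X x) - frechet_derivative X (at x) (Y x))"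

definition riemann ::
  "'e::euclidean_space metric_field \<Rightarrow> ('e \<Rightarrow> 'e) \<Rightarrow> ('e \<Rightarrow> 'e) \<Rightarrow> ('e \<Rightarrow> 'e) \<Rightarrow> ('e \<Rightarrow> 'e)" where
  "riemann G X Y Z = (\<lambda>x. nabla G X (nabla G Y Z) x - nabla G Y (nabla G X Z) x
                          - nabla G (lie_bracket X Y) Z x)"

text \<open>
  The curvature is tensorial, so it can be evaluated on tangent vectors by extending them to
  vector fields; here to the constant ones.
\<close>

definition Rm :: "'e::euclidean_space metric_field \<Rightarrow> 'e \<Rightarrow> 'e \<Rightarrow> 'e \<Rightarrow> 'e \<Rightarrow> 'e" where
  "Rm G x u v w = riemann G (\<lambda>_. u) (\<lambda>_. v) (\<lambda>_. w) x"

definition gradient :: "'e::euclidean_space metric_field \<Rightarrow> ('e \<Rightarrow> real) \<Rightarrow> ('e \<Rightarrow> 'e)" where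
  "gradient G h = (\<lambda>x. sharp G x (frechet_derivative h (at x)))"

definition hessian ::
  "'e::euclidean_space metric_field \<Rightarrow> ('e \<Rightarrow> real) \<Rightarrow> 'e \<Rightarrow> 'e \<Rightarrow> 'e" where
  "hessian G h x v = nabla G (\<lambda>_. v) (gradient G h) x"

text \<open>
  The divergence of \<open>X\<close> is the trace of the endomorphism \<open>v \<mapsto> \<nabla>\<^sub>v X\<close>. The trace does not depend
  on an inner product; it is computed in the standard basis of \<open>'e\<close>.
\<close>

definition divergence :: "'e::euclidean_space metric_field \<Rightarrow> ('e \<Rightarrow> 'e) \<Rightarrow> 'e \<Rightarrow> real" where
  "divergence G X x = (\<Sum>b\<in>Basis. nabla G (\<lambda>_. b) X x \<bullet> b)"

definition laplace_beltrami :: "'e::euclidean_space metric_field \<Rightarrow> ('e \<Rightarrow> real) \<Rightarrow> 'e \<Rightarrow> real" where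
  "laplace_beltrami G h = divergence G (gradient G h)"

definition adjoint_at :: "'e::euclidean_space metric_field \<Rightarrow> 'e \<Rightarrow> ('e \<Rightarrow> 'e) \<Rightarrow> ('e \<Rightarrow> 'e)" where
  "adjoint_at G x P = (\<lambda>v. sharp G x (\<lambda>w. G x v (P w)))"

text \<open>The order \<open>P \<le> Q\<close> of self-adjoint endomorphisms of the tangent space at \<open>x\<close>.\<close>

definition endo_le ::
  "'e::euclidean_space metric_field \<Rightarrow> 'e \<Rightarrow> ('e \<Rightarrow> 'e) \<Rightarrow> ('e \<Rightarrow> 'e) \<Rightarrow> bool" where
  "endo_le G x P Q \<longleftrightarrow> (\<forall>v. G x (P v) v \<le> G x (Q v) v)"


section \<open>Complex structure in local coordinates\<close>

text \<open>In holomorphic coordinates the complex structure is multiplication by \<open>\<i>\<close>.\<close>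

definition J :: "complex ^ 'n \<Rightarrow> complex ^ 'n" where
  "J v = \<i> *s v"

text \<open>
  Smooth maps satisfying the Cauchy-Riemann equations. (A complex differentiable map is
  automatically smooth; smoothness is included for convenience.)
\<close>

definition holomorphic_map_on ::
  "(complex ^ 'n::finite) set \<Rightarrow> (complex ^ 'n \<Rightarrow> complex ^ 'n) \<Rightarrow> bool" where
  "holomorphic_map_on D F \<longleftrightarrow>
     smooth_on D F \<and>
     (\<forall>x\<in>D. \<forall>v. frechet_derivative F (at x) (J v) = J (frechet_derivative F (at x) v))"

text \<open>\<open>\<omega>(u,v) = \<langle>J u, v\<rangle>\<close>, and its exterior derivative on coordinate vector fields.\<close>

definition kaehler_form ::
  "(complex ^ 'n::finite) metric_field \<Rightarrow> complex ^ 'n \<Rightarrow> complex ^ 'n \<Rightarrow> complex ^ 'n \<Rightarrow> real" where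
  "kaehler_form G x u v = G x (J u) v"

definition d_form ::
  "('e::euclidean_space \<Rightarrow> 'e \<Rightarrow> 'e \<Rightarrow> real) \<Rightarrow> 'e \<Rightarrow> 'e \<Rightarrow> 'e \<Rightarrow> 'e \<Rightarrow> real" where
  "d_form \<omega> x u v w = frechet_derivative (\<lambda>y. \<omega> y v w) (at x) u
                    - frechet_derivative (\<lambda>y. \<omega> y u w) (at x) v
                    + frechet_derivative (\<lambda>y. \<omega> y u v) (at x) w"

definition kaehler_metric_on ::
  "(complex ^ 'n::finite) set \<Rightarrow> (complex ^ 'n) metric_field \<Rightarrow> bool" where
  "kaehler_metric_on D G \<longleftrightarrow>
     riemannian_metric_on D G \<and>
     (\<forall>x\<in>D. \<forall>u v. G x (J u) (J v) = G x u v) \<and>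
     (\<forall>x\<in>D. \<forall>u v w. d_form (kaehler_form G) x u v w = 0)"


section \<open>Kaehler manifolds\<close>

text \<open>
  The manifold is the whole (Hausdorff, second countable) type \<open>'m\<close>, and its complex dimension is
  \<open>CARD('n)\<close>. A chart is a pair of its domain and its coordinate map; the latter is irrelevant
  outside the domain. A tangent vector at \<open>p\<close> is given by its components in a chart around \<open>p\<close>.
\<close>

type_synonym ('m, 'n) chart = "'m set \<times> ('m \<Rightarrow> complex ^ 'n)"

definition chart_dom :: "('m, 'n) chart \<Rightarrow> 'm set" where
  "chart_dom c = fst c"

definition coords :: "('m, 'n) chart \<Rightarrow> 'm \<Rightarrow> complex ^ 'n" where
  "coords c = snd c"

definition chart_inv :: "('m, 'n) chart \<Rightarrow> complex ^ 'n \<Rightarrow> 'm" where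
  "chart_inv c = inv_into (chart_dom c) (coords c)"

definition transition ::
  "('m, 'n) chart \<Rightarrow> ('m, 'n) chart \<Rightarrow> complex ^ 'n \<Rightarrow> complex ^ 'n" where
  "transition c c' = coords c' \<circ> chart_inv c"

definition holomorphic_atlas ::
  "('m::{t2_space, second_countable_topology}, 'n::finite) chart set \<Rightarrow> bool" where
  "holomorphic_atlas A \<longleftrightarrow>
     (\<Union>c\<in>A. chart_dom c) = UNIV \<and>
     (\<forall>c\<in>A. open (chart_dom c) \<and> open (coords c ` chart_dom c) \<and>
        homeomorphism (chart_dom c) (coords c ` chart_dom c) (coords c) (chart_inv c)) \<and>
     (\<forall>c\<in>A. \<forall>c'\<in>A.
        holomorphic_map_on (coords c ` (chart_dom c \<inter> chart_dom c')) (transition c c'))"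

text \<open>
  \<open>g c x u v\<close> is the inner product, at the point with coordinates \<open>x\<close> in the chart \<open>c\<close>, of the
  tangent vectors with components \<open>u\<close> and \<open>v\<close> in \<open>c\<close>.
\<close>

type_synonym ('m, 'n) metric_tensor = "('m, 'n) chart \<Rightarrow> (complex ^ 'n) metric_field"

definition kaehler_manifold ::
  "('m::{t2_space, second_countable_topology}, 'n::finite) chart set \<Rightarrow>
   ('m, 'n) metric_tensor \<Rightarrow> bool" where
  "kaehler_manifold A g \<longleftrightarrow>
     holomorphic_atlas A \<and>
     (\<forall>c\<in>A. kaehler_metric_on (coords c ` chart_dom c) (g c)) \<and>
     (\<forall>c\<in>A. \<forall>c'\<in>A. \<forall>p \<in> chart_dom c \<inter> chart_dom c'. \<forall>u v.
        g c (coords c p) u v =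
        g c' (coords c' p)
          (frechet_derivative (transition c c') (at (coords c p)) u)
          (frechet_derivative (transition c c') (at (coords c p)) v))"

definition local_rep :: "('m, 'n) chart \<Rightarrow> ('m \<Rightarrow> real) \<Rightarrow> (complex ^ 'n \<Rightarrow> real)" where
  "local_rep c h = h \<circ> chart_inv c"

definition smooth_fun ::
  "('m, 'n::finite) chart set \<Rightarrow> ('m \<Rightarrow> real) \<Rightarrow> bool" where
  "smooth_fun A h \<longleftrightarrow> (\<forall>c\<in>A. smooth_on (coords c ` chart_dom c) (local_rep c h))"

text \<open>Joint smoothness in \<open>(t,p)\<close> of a function on \<open>I \<times> M\<close>, \<open>I\<close> an open interval.\<close>

definition smooth_time_fun ::
  "('m, 'n::finite) chart set \<Rightarrow> real set \<Rightarrow> (real \<Rightarrow> 'm \<Rightarrow> real) \<Rightarrow> bool" where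
  "smooth_time_fun A I \<rho> \<longleftrightarrow>
     (\<forall>c\<in>A. smooth_on (I \<times> coords c ` chart_dom c) (\<lambda>(t, x). local_rep c (\<rho> t) x))"

text \<open>
  Scalars such as \<open>\<Delta>h\<close> and \<open>\<langle>\<nabla>h\<^sub>1, \<nabla>h\<^sub>2\<rangle>\<close> do not depend on coordinates; they are computed in some
  chart around the point.
\<close>

definition chart_at :: "('m, 'n) chart set \<Rightarrow> 'm \<Rightarrow> ('m, 'n) chart" where
  "chart_at A p = (SOME c. c \<in> A \<and> p \<in> chart_dom c)"

definition Laplacian ::
  "('m, 'n::finite) chart set \<Rightarrow> ('m, 'n) metric_tensor \<Rightarrow> ('m \<Rightarrow> real) \<Rightarrow> 'm \<Rightarrow> real" where
  "Laplacian A g h p =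
     (let c = chart_at A p in laplace_beltrami (g c) (local_rep c h) (coords c p))"

definition grad_inner ::
  "('m, 'n::finite) chart set \<Rightarrow> ('m, 'n) metric_tensor \<Rightarrow>
   ('m \<Rightarrow> real) \<Rightarrow> ('m \<Rightarrow> real) \<Rightarrow> 'm \<Rightarrow> real" where
  "grad_inner A g h1 h2 p =
     (let c = chart_at A p; x = coords c p in
      g c x (gradient (g c) (local_rep c h1) x) (gradient (g c) (local_rep c h2) x))"

text \<open>
  Endomorphisms of the tangent space at \<open>p\<close>, expressed in the chart \<open>c\<close>: the Hessian \<open>\<nabla>\<^sup>2h\<close>, the
  conjugate \<open>J\<^sup>* P J\<close>, and the order.
\<close>

definition Hess ::
  "('m, 'n::finite) metric_tensor \<Rightarrow> ('m, 'n) chart \<Rightarrow> 'm \<Rightarrow> ('m \<Rightarrow> real) \<Rightarrow>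
   complex ^ 'n \<Rightarrow> complex ^ 'n" where
  "Hess g c p h = hessian (g c) (local_rep c h) (coords c p)"

definition J_conj ::
  "('m, 'n::finite) metric_tensor \<Rightarrow> ('m, 'n) chart \<Rightarrow> 'm \<Rightarrow>
   (complex ^ 'n \<Rightarrow> complex ^ 'n) \<Rightarrow> (complex ^ 'n \<Rightarrow> complex ^ 'n)" where
  "J_conj g c p P = adjoint_at (g c) (coords c p) J \<circ> P \<circ> J"

definition tangent_endo_le ::
  "('m, 'n::finite) metric_tensor \<Rightarrow> ('m, 'n) chart \<Rightarrow> 'm \<Rightarrow>
   (complex ^ 'n \<Rightarrow> complex ^ 'n) \<Rightarrow> (complex ^ 'n \<Rightarrow> complex ^ 'n) \<Rightarrow> bool" where
  "tangent_endo_le g c p P Q = endo_le (g c) (coords c p) P Q"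

definition nonneg_bisectional_curvature ::
  "('m, 'n::finite) chart set \<Rightarrow> ('m, 'n) metric_tensor \<Rightarrow> bool" where
  "nonneg_bisectional_curvature A g \<longleftrightarrow>
     (\<forall>c\<in>A. \<forall>x \<in> coords c ` chart_dom c. \<forall>v w.
        g c x (Rm (g c) x v w w) v + g c x (Rm (g c) x v (J w) (J w)) v \<ge> 0)"

definition coth :: "real \<Rightarrow> real" where
  "coth x = cosh x / sinh x"

end

theory Submission
  imports Defs
begin

text \<open>
  On a Kaehler manifold the sum \<open>\<nabla>\<^sup>2h + J\<^sup>*\<nabla>\<^sup>2hJ\<close> is, in holomorphic coordinates, the form
  \<open>levi h (u,v) = D\<^sub>uD\<^sub>vh + D\<^sub>J\<^sub>uD\<^sub>J\<^sub>vh\<close> without Christoffel symbols, and \<open>\<Delta>h\<close> is half of its trace.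
  The function \<open>\<phi> = log \<rho> + f/2\<close> satisfies \<open>\<partial>\<phi>/\<partial>t = \<Delta>\<phi> + |\<nabla>\<phi>|\<^sup>2 - W/2\<close>. Hamilton's tensor maximum principle
  is applied to \<open>levi \<phi>\<close>: at a first zero, in the direction of a unit vector \<open>v\<close>, of \<open>levi \<phi> - \<lambda>(t) g\<close>, choose
  holomorphic coordinates in which the first derivatives of \<open>g\<close> vanish and apply \<open>D\<^sub>vD\<^sub>v + D\<^sub>J\<^sub>vD\<^sub>J\<^sub>v\<close> to the
  equation of \<open>\<phi>\<close>. Partial derivatives commute, and the second derivatives of \<open>g\<close> contribute bisectional
  curvatures with a favourable sign, so that what remains is at least \<open>\<lambda>\<^sup>2 - k\<^sup>2\<close>. Comparison with the solutions
  of \<open>\<lambda>' = \<lambda>\<^sup>2 - \<kappa>\<^sup>2\<close> for \<open>\<kappa> > \<bar>k\<bar>\<close> gives the bound, as \<open>\<kappa>\<close> tends to \<open>\<bar>k\<bar>\<close>.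
\<close>

section \<open>Calculus of directional derivatives\<close>

text \<open>Adding f/2 to the logarithm completes a square: the cross term in the squared gradient
  is the drift, and what is left over is -W/2. No covariant derivatives of tensors and no parallel
  extension of \<open>v\<close> are used. The vector \<open>v\<close> is kept constant in well
  chosen holomorphic coordinates, so that only functions are differentiated. This is legitimate
  because the Levi form and the right-hand side of the equation are invariant under holomorphic
  changes of coordinates, and because such a change makes a Kaehler metric flat to first order at a
  point. The square \<lambda>^2 comes from the second derivatives of the squared gradient by
  Cauchy-Schwarz. The trace term is non-negative because the form has a minimum in direction
  \<open>v\<close> and the two derivatives in its definition may be exchanged with the two applied
  to it. Nothing is known about the solution as t tends to 0. The comparison therefore starts at a
  time \<epsilon> > 0, where \<lambda> is minus infinity, and \<epsilon> tends to 0 together with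
  \<kappa> to the absolute value of k. Compactness of the manifold and of the unit sphere ensures
  that a first failing time is attained.\<close>

definition dd :: "'a::real_normed_vector \<Rightarrow> ('a \<Rightarrow> 'b::real_normed_vector) \<Rightarrow> 'a \<Rightarrow> 'b" where
  "dd v f x = frechet_derivative f (at x) v"

lemma dd_eqI: "(f has_derivative f') (at x) \<Longrightarrow> dd v f x = f' v"
  unfolding dd_def using frechet_derivative_at by metis

lemma has_derivative_dd: "f differentiable (at x) \<Longrightarrow> (f has_derivative (\<lambda>v. dd v f x)) (at x)"
  unfolding dd_def using frechet_derivative_works by metis

lemma linear_dd: "f differentiable (at x) \<Longrightarrow> linear (\<lambda>v. dd v f x)"
  using has_derivative_dd has_derivative_linear by blast

lemma
  assumes "open S" "x \<in> S" "\<And>y. y \<in> S \<Longrightarrow> f y = g y"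
  shows dd_cong: "dd v f x = dd v g x"
    and differentiable_cong_open: "f differentiable (at x) \<longleftrightarrow> g differentiable (at x)"
proof -
  have A: "(f has_derivative f') (at x) \<longleftrightarrow> (g has_derivative f') (at x)" for f'
    using assms by (metis has_derivative_transform_within_open)
  then show "dd v f x = dd v g x"
    unfolding dd_def frechet_derivative_def by simp
  show "f differentiable (at x) \<longleftrightarrow> g differentiable (at x)"
    using A unfolding differentiable_def by simp
qed

section \<open>Closure properties of finite differentiability\<close>

lemma C_diff_Suc_dd:
  "C_diff (Suc n) S f \<longleftrightarrow> (\<forall>x\<in>S. f differentiable (at x)) \<and> (\<forall>v. C_diff n S (dd v f))"
proof -
  have "(\<lambda>x. frechet_derivative f (at x) v) = dd v f" for v
    by (auto simp: dd_def)
  then show ?thesis by simp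
qed

declare C_diff.simps(2) [simp del]

text \<open>A formula for a directional derivative holds only on \<open>S\<close>, whereas
  \<open>C_diff\<close> speaks of total functions. On an open set the derivative may be replaced by
  its formula, and this is how the induction steps below close.\<close>

lemma C_diff_cong:
  assumes "open S" "\<And>y. y \<in> S \<Longrightarrow> f y = g y"
  shows "C_diff n S f \<longleftrightarrow> C_diff n S g"
  using assms(2)
proof (induction n arbitrary: f g)
  case 0
  then show ?case by (simp cong: continuous_on_cong)
next
  case (Suc n)
  have "C_diff n S (dd v f) \<longleftrightarrow> C_diff n S (dd v g)" for v
    by (rule Suc.IH) (rule dd_cong[OF assms(1)], auto intro: Suc.prems)
  moreover have "f differentiable (at x) \<longleftrightarrow> g differentiable (at x)" if "x \<in> S" for x
    using differentiable_cong_open[OF assms(1) that] Suc.prems by blast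
  ultimately show ?case by (simp add: C_diff_Suc_dd)
qed

lemma C_diff_continuous: "C_diff n S f \<Longrightarrow> continuous_on S f"
  by (cases n) (auto simp: C_diff_Suc_dd differentiable_imp_continuous_within
      intro!: continuous_at_imp_continuous_on)

lemma C_diff_SucD: "C_diff (Suc n) S f \<Longrightarrow> C_diff n S f"
proof (induction n arbitrary: f)
  case 0
  then show ?case by (simp add: C_diff_continuous)
next
  case (Suc n)
  then show ?case unfolding C_diff_Suc_dd[of "Suc n"] C_diff_Suc_dd[of n] by (simp add: C_diff_Suc_dd)
qed

lemma C_diff_subset: "C_diff n S f \<Longrightarrow> S' \<subseteq> S \<Longrightarrow> C_diff n S' f"
  by (induction n arbitrary: f) (auto simp: C_diff_Suc_dd intro: continuous_on_subset)

lemma C_diff_const: "C_diff n S (\<lambda>x. c)"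
proof (induction n arbitrary: c)
  case (Suc n)
  have "dd v (\<lambda>x::'a. c) = (\<lambda>x. 0)" for v by (rule ext) (simp add: dd_def)
  then show ?case using Suc by (simp add: C_diff_Suc_dd)
qed simp

lemma C_diff_linear_compose:
  assumes S: "open S" and L: "bounded_linear L" and f: "C_diff n S f"
  shows "C_diff n S (\<lambda>x. L (f x))"
  using f
proof (induction n arbitrary: f)
  case 0
  then show ?case by (simp add: linear_continuous_on_compose bounded_linear.continuous_on[OF L])
next
  case (Suc n)
  have D: "((\<lambda>x. L (f x)) has_derivative (\<lambda>v. L (dd v f x))) (at x)" if "x \<in> S" for x
    using bounded_linear.has_derivative[OF L has_derivative_dd] Suc.prems that
    by (auto simp: C_diff_Suc_dd)
  have "C_diff n S (dd v (\<lambda>x. L (f x)))" for v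
    using Suc.IH[of "dd v f"] Suc.prems C_diff_cong[OF S, of "dd v (\<lambda>x. L (f x))" "\<lambda>x. L (dd v f x)"] dd_eqI[OF D]
    by (auto simp: C_diff_Suc_dd)
  then show ?case using D by (auto simp: C_diff_Suc_dd differentiable_def)
qed

lemma C_diff_add:
  assumes S: "open S" and f: "C_diff n S f" and g: "C_diff n S g"
  shows "C_diff n S (\<lambda>x. f x + g x)"
  using f g
proof (induction n arbitrary: f g)
  case 0
  then show ?case by (simp add: continuous_on_add)
next
  case (Suc n)
  have D: "((\<lambda>x. f x + g x) has_derivative (\<lambda>v. dd v f x + dd v g x)) (at x)" if "x \<in> S" for x
    using Suc.prems that by (auto simp: C_diff_Suc_dd intro!: has_derivative_add has_derivative_dd)
  have "C_diff n S (dd v (\<lambda>x. f x + g x))" for v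
    using Suc.IH[of "dd v f" "dd v g"] Suc.prems C_diff_cong[OF S, of "dd v (\<lambda>x. f x + g x)" "\<lambda>x. dd v f x + dd v g x"] dd_eqI[OF D]
    by (auto simp: C_diff_Suc_dd)
  then show ?case using D by (auto simp: C_diff_Suc_dd differentiable_def)
qed

lemma C_diff_sum:
  assumes S: "open S" and "\<And>i. i \<in> I \<Longrightarrow> C_diff n S (f i)"
  shows "C_diff n S (\<lambda>x. \<Sum>i\<in>I. f i x)"
  using assms(2) by (induction I rule: infinite_finite_induct) (auto simp: C_diff_const C_diff_add S)

lemma C_diff_bilinear:
  assumes S: "open S" and p: "bounded_bilinear p" and f: "C_diff n S f" and g: "C_diff n S g"
  shows "C_diff n S (\<lambda>x. p (f x) (g x))"
  using f g
proof (induction n arbitrary: f g)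
  case 0
  then show ?case by (simp add: bounded_bilinear.continuous_on[OF p])
next
  case (Suc n)
  have D: "((\<lambda>x. p (f x) (g x)) has_derivative (\<lambda>v. p (f x) (dd v g x) + p (dd v f x) (g x))) (at x)"
    if "x \<in> S" for x
    using Suc.prems that
    by (auto simp: C_diff_Suc_dd intro!: bounded_bilinear.FDERIV[OF p] has_derivative_dd)
  have "C_diff n S (\<lambda>x. p (f x) (dd v g x) + p (dd v f x) (g x))" for v
    using Suc.IH[of f "dd v g"] Suc.IH[of "dd v f" g] Suc.prems C_diff_SucD[of n S f] C_diff_SucD[of n S g]
    by (auto simp: C_diff_Suc_dd intro!: C_diff_add[OF S])
  then have "C_diff n S (dd v (\<lambda>x. p (f x) (g x)))" for v
    using C_diff_cong[OF S, of "dd v (\<lambda>x. p (f x) (g x))"] dd_eqI[OF D] by auto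
  then show ?case using D by (auto simp: C_diff_Suc_dd differentiable_def)
qed

lemma C_diff_ident:
  assumes "open S"
  shows "C_diff n S (\<lambda>x. x)"
proof (cases n)
  case (Suc m)
  have "dd v (\<lambda>x::'a. x) = (\<lambda>x. v)" for v by (rule ext) (simp add: dd_def)
  then show ?thesis using Suc by (simp add: C_diff_Suc_dd C_diff_const)
qed simp

lemma C_diff_compose:
  fixes F :: "'a::euclidean_space \<Rightarrow> 'b::euclidean_space"
  assumes S: "open S" and S': "open S'" and sub: "F ` S' \<subseteq> S"
    and F: "C_diff n S' F" and f: "C_diff n S f"
  shows "C_diff n S' (\<lambda>x. f (F x))"
  using F f
proof (induction n arbitrary: f)
  case 0
  then show ?case using sub by (auto intro: continuous_on_compose2)
next
  case (Suc n)
  have D: "((\<lambda>x. f (F x)) has_derivative (\<lambda>v. dd (dd v F x) f (F x))) (at x)" if "x \<in> S'" for x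
    using Suc.prems that sub
    by (auto simp: C_diff_Suc_dd intro!: has_derivative_compose[OF has_derivative_dd has_derivative_dd])
  \<comment> \<open>The direction \<open>dd v F x\<close> varies with \<open>x\<close>, but
    \<open>C_diff\<close> controls \<open>f\<close> only in fixed directions. Expanding in
    \<open>Basis\<close> gives products to which the induction hypothesis applies.\<close>
  have E: "dd (dd v F x) f (F x) = (\<Sum>b\<in>Basis. (dd v F x \<bullet> b) *\<^sub>R dd b f (F x))" if "x \<in> S'" for x v
  proof -
    have "linear (\<lambda>w. dd w f (F x))"
      using Suc.prems that sub by (intro linear_dd) (auto simp: C_diff_Suc_dd)
    then have "dd (\<Sum>b\<in>Basis. (dd v F x \<bullet> b) *\<^sub>R b) f (F x) = (\<Sum>b\<in>Basis. (dd v F x \<bullet> b) *\<^sub>R dd b f (F x))"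
      by (subst linear_sum[of "\<lambda>w. dd w f (F x)"]) (auto simp: linear_scale[of "\<lambda>w. dd w f (F x)"])
    then show ?thesis by (simp add: euclidean_representation)
  qed
  have "C_diff n S' (\<lambda>x. \<Sum>b\<in>Basis. (dd v F x \<bullet> b) *\<^sub>R dd b f (F x))" for v
    using Suc.prems C_diff_SucD[OF Suc.prems(1)]
    by (intro C_diff_sum C_diff_bilinear[OF S' bounded_bilinear_scaleR] S' Suc.IH
        C_diff_linear_compose[OF S' bounded_linear_inner_left]) (auto simp: C_diff_Suc_dd)
  then have "C_diff n S' (dd v (\<lambda>x. f (F x)))" for v
    using C_diff_cong[OF S', of "dd v (\<lambda>x. f (F x))"] dd_eqI[OF D] E by auto
  then show ?case using D by (auto simp: C_diff_Suc_dd differentiable_def)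
qed

lemma C_diff_inverse:
  assumes S: "open S" and f: "C_diff n S f" and nz: "\<And>x. x \<in> S \<Longrightarrow> f x \<noteq> (0::real)"
  shows "C_diff n S (\<lambda>x. inverse (f x))"
  using f
proof (induction n)
  case 0
  then show ?case using nz by (auto intro: continuous_on_inverse)
next
  case (Suc n)
  have D: "((\<lambda>x. inverse (f x)) has_derivative (\<lambda>v. - (inverse (f x) * dd v f x * inverse (f x)))) (at x)"
    if "x \<in> S" for x
    using Suc.prems that nz by (intro Deriv.has_derivative_inverse has_derivative_dd) (auto simp: C_diff_Suc_dd)
  have "C_diff n S (\<lambda>x. - (inverse (f x) * dd v f x * inverse (f x)))" for v
    using Suc.IH[OF C_diff_SucD[OF Suc.prems]] Suc.prems
    by (intro C_diff_linear_compose[OF S bounded_linear_minus[OF bounded_linear_ident]]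
         C_diff_bilinear[OF S bounded_bilinear_mult]) (auto simp: C_diff_Suc_dd)
  then have "C_diff n S (dd v (\<lambda>x. inverse (f x)))" for v
    using C_diff_cong[OF S, of "dd v (\<lambda>x. inverse (f x))"] dd_eqI[OF D] by auto
  then show ?case using D by (auto simp: C_diff_Suc_dd differentiable_def)
qed

section \<open>The same closure properties for smooth functions\<close>

lemma smooth_onD_differentiable: "smooth_on S f \<Longrightarrow> x \<in> S \<Longrightarrow> f differentiable (at x)"
  unfolding smooth_on_def using C_diff_Suc_dd[of 0] by blast

lemma smooth_on_has_derivative:
  "smooth_on S f \<Longrightarrow> x \<in> S \<Longrightarrow> (f has_derivative (\<lambda>v. dd v f x)) (at x)"
  by (rule has_derivative_dd) (rule smooth_onD_differentiable)

lemma smooth_on_dd: "smooth_on S f \<Longrightarrow> smooth_on S (dd v f)"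
  unfolding smooth_on_def using C_diff_Suc_dd by blast

lemma smooth_on_continuous: "smooth_on S f \<Longrightarrow> continuous_on S f"
  unfolding smooth_on_def using C_diff_continuous by blast

lemma smooth_on_cong:
  "open S \<Longrightarrow> (\<And>y. y \<in> S \<Longrightarrow> f y = g y) \<Longrightarrow> smooth_on S f \<longleftrightarrow> smooth_on S g"
  unfolding smooth_on_def using C_diff_cong by blast

lemma smooth_on_subset: "smooth_on S f \<Longrightarrow> S' \<subseteq> S \<Longrightarrow> smooth_on S' f"
  unfolding smooth_on_def using C_diff_subset by blast

lemma smooth_on_linear_compose:
  "open S \<Longrightarrow> bounded_linear L \<Longrightarrow> smooth_on S f \<Longrightarrow> smooth_on S (\<lambda>x. L (f x))"
  unfolding smooth_on_def using C_diff_linear_compose by blast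

lemma smooth_on_bilinear:
  "open S \<Longrightarrow> bounded_bilinear p \<Longrightarrow> smooth_on S f \<Longrightarrow> smooth_on S g \<Longrightarrow> smooth_on S (\<lambda>x. p (f x) (g x))"
  unfolding smooth_on_def using C_diff_bilinear by blast

lemma smooth_on_const: "smooth_on S (\<lambda>x. c)"
  unfolding smooth_on_def using C_diff_const by blast

lemma smooth_on_ident: "open S \<Longrightarrow> smooth_on S (\<lambda>x. x)"
  unfolding smooth_on_def using C_diff_ident by blast

lemma smooth_on_add: "open S \<Longrightarrow> smooth_on S f \<Longrightarrow> smooth_on S g \<Longrightarrow> smooth_on S (\<lambda>x. f x + g x)"
  unfolding smooth_on_def using C_diff_add by blast

lemma smooth_on_minus: "open S \<Longrightarrow> smooth_on S f \<Longrightarrow> smooth_on S (\<lambda>x. - f x)"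
  by (rule smooth_on_linear_compose[OF _ bounded_linear_minus[OF bounded_linear_ident]])

lemma smooth_on_diff: "open S \<Longrightarrow> smooth_on S f \<Longrightarrow> smooth_on S g \<Longrightarrow> smooth_on S (\<lambda>x. f x - g x)"
  using smooth_on_add[of S f "\<lambda>x. - g x"] smooth_on_minus[of S g] by simp

lemma smooth_on_sum:
  "open S \<Longrightarrow> (\<And>i. i \<in> I \<Longrightarrow> smooth_on S (f i)) \<Longrightarrow> smooth_on S (\<lambda>x. \<Sum>i\<in>I. f i x)"
  unfolding smooth_on_def by (auto intro: C_diff_sum)

lemma smooth_on_mult:
  fixes f g :: "_ \<Rightarrow> real"
  shows "open S \<Longrightarrow> smooth_on S f \<Longrightarrow> smooth_on S g \<Longrightarrow> smooth_on S (\<lambda>x. f x * g x)"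
  by (rule smooth_on_bilinear[OF _ bounded_bilinear_mult])

lemma smooth_on_compose:
  fixes F :: "'a::euclidean_space \<Rightarrow> 'b::euclidean_space"
  shows "open S \<Longrightarrow> open S' \<Longrightarrow> F ` S' \<subseteq> S \<Longrightarrow> smooth_on S' F \<Longrightarrow> smooth_on S f \<Longrightarrow>
    smooth_on S' (\<lambda>x. f (F x))"
  unfolding smooth_on_def using C_diff_compose by blast

lemma smooth_on_ln:
  assumes S: "open S" and f: "smooth_on S f" and pos: "\<And>x. x \<in> S \<Longrightarrow> f x > (0::real)"
  shows "smooth_on S (\<lambda>x. ln (f x))"
  unfolding smooth_on_def
proof
  fix n
  show "C_diff n S (\<lambda>x. ln (f x))"
  proof (cases n)
    case 0
    then show ?thesis using pos smooth_on_continuous[OF f] by (fastforce intro: continuous_on_ln)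
  next
    case (Suc m)
    have D: "((\<lambda>x. ln (f x)) has_derivative (\<lambda>v. dd v f x * inverse (f x))) (at x)" if "x \<in> S" for x
      using pos that f by (auto intro!: has_derivative_ln smooth_on_has_derivative)
    have "C_diff m S (\<lambda>x. dd v f x * inverse (f x))" for v
      using pos f smooth_on_dd[OF f]
      by (intro C_diff_bilinear[OF S bounded_bilinear_mult] C_diff_inverse S) (force simp: smooth_on_def)+
    then have "C_diff m S (dd v (\<lambda>x. ln (f x)))" for v
      using C_diff_cong[OF S, of "dd v (\<lambda>x. ln (f x))"] dd_eqI[OF D] by auto
    then show ?thesis unfolding Suc using D by (auto simp: C_diff_Suc_dd differentiable_def)
  qed
qed

section \<open>Symmetry of second derivatives\<close>

lemma has_real_derivative_line:
  fixes f :: "'a::euclidean_space \<Rightarrow> real"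
  assumes "smooth_on S f" "x + r *\<^sub>R w \<in> S"
  shows "((\<lambda>r. f (x + r *\<^sub>R w)) has_real_derivative dd w f (x + r *\<^sub>R w)) (at r)"
proof -
  have "((\<lambda>r. x + r *\<^sub>R w) has_derivative (\<lambda>h. h *\<^sub>R w)) (at r)"
    by (auto intro!: derivative_eq_intros)
  from has_derivative_compose[OF this smooth_on_has_derivative[OF assms]]
  have "((\<lambda>r. f (x + r *\<^sub>R w)) has_derivative (\<lambda>h. dd (h *\<^sub>R w) f (x + r *\<^sub>R w))) (at r)" .
  moreover have "dd (h *\<^sub>R w) f (x + r *\<^sub>R w) = h * dd w f (x + r *\<^sub>R w)" for h
    using linear_scale[OF linear_dd[OF smooth_onD_differentiable[OF assms]]] by auto
  then have "(\<lambda>h. dd (h *\<^sub>R w) f (x + r *\<^sub>R w)) = (*) (dd w f (x + r *\<^sub>R w))"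
    by (auto simp: mult.commute)
  ultimately show ?thesis by (simp add: has_field_derivative_def)
qed

text \<open>Two mean values: one in direction \<open>u\<close> for the difference of
  \<open>f\<close> and its translate by \<open>s *\<^sub>R v\<close>, one in direction
  \<open>v\<close> for \<open>dd u f\<close>. The bound on \<open>s\<close> keeps the parallelogram
  inside the ball.\<close>

lemma second_difference_quotient:
  fixes f :: "'a::euclidean_space \<Rightarrow> real"
  assumes f: "smooth_on (ball x d) f" and s: "s > 0" "s * (norm u + norm v) < d"
  obtains \<xi> where "\<xi> \<in> ball x d"
    "f (x + s *\<^sub>R u + s *\<^sub>R v) - f (x + s *\<^sub>R u) - f (x + s *\<^sub>R v) + f x = s * s * dd v (dd u f) \<xi>"
proof -
  have mem: "x + a *\<^sub>R u + b *\<^sub>R v \<in> ball x d" if "0 \<le> a" "a \<le> s" "0 \<le> b" "b \<le> s" for a b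
  proof -
    have "norm (a *\<^sub>R u + b *\<^sub>R v) \<le> a * norm u + b * norm v"
      using that norm_triangle_ineq[of "a *\<^sub>R u" "b *\<^sub>R v"] by simp
    also have "\<dots> \<le> s * norm u + s * norm v"
      using that by (intro add_mono mult_right_mono) auto
    also have "\<dots> < d" using s by (simp add: algebra_simps)
    finally show ?thesis
      unfolding mem_ball dist_norm by (metis add.assoc add_diff_cancel_left' norm_minus_commute)
  qed
  have "((\<lambda>r. f (x + s *\<^sub>R v + r *\<^sub>R u) - f (x + r *\<^sub>R u)) has_real_derivative
      dd u f (x + s *\<^sub>R v + r *\<^sub>R u) - dd u f (x + r *\<^sub>R u)) (at r)" if "0 \<le> r" "r \<le> s" for r
    using mem[of r s] mem[of r 0] that s
    by (intro DERIV_diff has_real_derivative_line[OF f]) (auto simp: algebra_simps)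
  from MVT2[OF s(1) this] obtain \<theta> where \<theta>: "\<theta> > 0" "\<theta> < s"
    and 1: "f (x + s *\<^sub>R v + s *\<^sub>R u) - f (x + s *\<^sub>R u) - (f (x + s *\<^sub>R v + 0 *\<^sub>R u) - f (x + 0 *\<^sub>R u))
       = (s - 0) * (dd u f (x + s *\<^sub>R v + \<theta> *\<^sub>R u) - dd u f (x + \<theta> *\<^sub>R u))"
    by blast
  have "((\<lambda>r. dd u f (x + \<theta> *\<^sub>R u + r *\<^sub>R v)) has_real_derivative
      dd v (dd u f) (x + \<theta> *\<^sub>R u + r *\<^sub>R v)) (at r)" if "0 \<le> r" "r \<le> s" for r
    using mem[of \<theta> r] that \<theta> by (intro has_real_derivative_line[OF smooth_on_dd[OF f]]) auto
  from MVT2[OF s(1) this] obtain \<theta>' where \<theta>': "\<theta>' > 0" "\<theta>' < s"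
    and 2: "dd u f (x + \<theta> *\<^sub>R u + s *\<^sub>R v) - dd u f (x + \<theta> *\<^sub>R u + 0 *\<^sub>R v)
       = (s - 0) * dd v (dd u f) (x + \<theta> *\<^sub>R u + \<theta>' *\<^sub>R v)"
    by blast
  show thesis
  proof (rule that)
    show "x + \<theta> *\<^sub>R u + \<theta>' *\<^sub>R v \<in> ball x d" using mem[of \<theta> \<theta>'] \<theta> \<theta>' by simp
    have "f (x + s *\<^sub>R u + s *\<^sub>R v) - f (x + s *\<^sub>R u) - f (x + s *\<^sub>R v) + f x
       = s * (dd u f (x + \<theta> *\<^sub>R u + s *\<^sub>R v) - dd u f (x + \<theta> *\<^sub>R u))"
      using 1 by (simp add: add_ac)
    also have "\<dots> = s * (s * dd v (dd u f) (x + \<theta> *\<^sub>R u + \<theta>' *\<^sub>R v))"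
      using 2 by simp
    finally show "f (x + s *\<^sub>R u + s *\<^sub>R v) - f (x + s *\<^sub>R u) - f (x + s *\<^sub>R v) + f x
       = s * s * dd v (dd u f) (x + \<theta> *\<^sub>R u + \<theta>' *\<^sub>R v)" by simp
  qed
qed

text \<open>The second difference is symmetric in \<open>u\<close> and \<open>v\<close>, so both
  mixed derivatives take a common value at points arbitrarily close to \<open>x\<close>. Continuity
  then forces them to agree at \<open>x\<close>.\<close>

lemma dd_commute_real:
  fixes f :: "'a::euclidean_space \<Rightarrow> real"
  assumes S: "open S" "x \<in> S" and f: "smooth_on S f"
  shows "dd u (dd v f) x = dd v (dd u f) x"
proof (rule ccontr)
  let ?p = "dd u (dd v f)" and ?q = "dd v (dd u f)"
  assume "?p x \<noteq> ?q x"
  then have e: "\<bar>?p x - ?q x\<bar> / 2 > 0" (is "?e > 0") by simp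
  have "continuous_on S ?p" "continuous_on S ?q"
    using f by (auto intro!: smooth_on_continuous smooth_on_dd)
  then have "isCont ?p x" "isCont ?q x" using S by (auto simp: continuous_on_eq_continuous_at)
  then obtain d1 d2 where d1: "d1 > 0" "\<And>y. dist y x < d1 \<Longrightarrow> \<bar>?p y - ?p x\<bar> < ?e"
    and d2: "d2 > 0" "\<And>y. dist y x < d2 \<Longrightarrow> \<bar>?q y - ?q x\<bar> < ?e"
    using e unfolding continuous_at_eps_delta dist_real_def by (metis (mono_tags, lifting))
  obtain d0 where d0: "d0 > 0" "ball x d0 \<subseteq> S" using S openE by blast
  define d where "d = min d0 (min d1 d2)"
  \<comment> \<open>The summand 1 keeps the denominator positive when \<open>u\<close> and
    \<open>v\<close> both vanish.\<close>
  define s where "s = d / (2 * (norm u + norm v + 1))"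
  have n: "norm u + norm v + 1 > 0" by (simp add: add_nonneg_pos)
  have d: "d > 0" using d0 d1 d2 by (simp add: d_def)
  then have s: "s > 0" using n by (simp add: s_def)
  have "s * (norm u + norm v) \<le> s * (norm u + norm v + 1)" using s by simp
  also have "\<dots> = d / 2" using n by (simp add: s_def divide_simps)
  finally have s2: "s * (norm u + norm v) < d" "s * (norm v + norm u) < d"
    using d by (auto simp: add.commute)
  have f': "smooth_on (ball x d) f" by (rule smooth_on_subset[OF f]) (use d0 in \<open>auto simp: d_def\<close>)
  obtain \<xi> where \<xi>: "\<xi> \<in> ball x d"
    "f (x + s *\<^sub>R u + s *\<^sub>R v) - f (x + s *\<^sub>R u) - f (x + s *\<^sub>R v) + f x = s * s * ?q \<xi>"
    using second_difference_quotient[OF f' s s2(1)] by blast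
  obtain \<eta> where \<eta>: "\<eta> \<in> ball x d"
    "f (x + s *\<^sub>R v + s *\<^sub>R u) - f (x + s *\<^sub>R v) - f (x + s *\<^sub>R u) + f x = s * s * ?p \<eta>"
    using second_difference_quotient[OF f' s s2(2)] by blast
  have "x + s *\<^sub>R v + s *\<^sub>R u = x + s *\<^sub>R u + s *\<^sub>R v" by simp
  with \<xi>(2) \<eta>(2) have "s * s * ?q \<xi> = s * s * ?p \<eta>" by (simp only:)
  then have "?q \<xi> = ?p \<eta>" using s by simp
  moreover have "\<bar>?q \<xi> - ?q x\<bar> < ?e" "\<bar>?p \<eta> - ?p x\<bar> < ?e"
    using \<xi>(1) \<eta>(1) d1(2)[of \<eta>] d2(2)[of \<xi>] by (auto simp: d_def dist_commute)
  ultimately show False by (simp add: abs_if split: if_splits)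
qed

lemma dd_linear_compose:
  assumes "bounded_linear L" "f differentiable (at x)"
  shows "dd v (\<lambda>x. L (f x)) x = L (dd v f x)"
  by (rule dd_eqI[OF bounded_linear.has_derivative[OF assms(1) has_derivative_dd[OF assms(2)]]])

lemma dd_commute:
  fixes f :: "'a::euclidean_space \<Rightarrow> 'b::euclidean_space"
  assumes S: "open S" "x \<in> S" and f: "smooth_on S f"
  shows "dd u (dd v f) x = dd v (dd u f) x"
proof (rule euclidean_eqI)
  fix b :: 'b
  have 1: "dd w (\<lambda>x. h x \<bullet> b) y = dd w h y \<bullet> b" if "smooth_on S h" "y \<in> S" for w y h
    using dd_linear_compose[OF bounded_linear_inner_left smooth_onD_differentiable[OF that]] .
  have 2: "dd w (dd z f) x \<bullet> b = dd w (dd z (\<lambda>x. f x \<bullet> b)) x" for w z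
  proof -
    have "dd w (dd z (\<lambda>x. f x \<bullet> b)) x = dd w (\<lambda>x. dd z f x \<bullet> b) x"
      by (rule dd_cong[OF S]) (use 1[OF f] in auto)
    then show ?thesis using 1[OF smooth_on_dd[OF f] S(2)] by simp
  qed
  show "dd u (dd v f) x \<bullet> b = dd v (dd u f) x \<bullet> b"
    unfolding 2 by (rule dd_commute_real[OF S smooth_on_linear_compose[OF S(1) bounded_linear_inner_left f]])
qed

section \<open>Rules of calculus for directional derivatives\<close>

lemma dd_add:
  assumes "f differentiable (at x)" "g differentiable (at x)"
  shows "dd v (\<lambda>x. f x + g x) x = dd v f x + dd v g x"
  using assms by (auto intro!: dd_eqI has_derivative_add has_derivative_dd)

lemma dd_minus: "f differentiable (at x) \<Longrightarrow> dd v (\<lambda>x. - f x) x = - dd v f x"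
  by (intro dd_eqI has_derivative_minus has_derivative_dd)

lemma dd_const: "dd v (\<lambda>x. c) x = 0"
  by (simp add: dd_def)

lemma dd_ident: "dd v (\<lambda>x. x) x = v"
  by (simp add: dd_def)

lemma dd_bilinear:
  assumes "bounded_bilinear p" "f differentiable (at x)" "g differentiable (at x)"
  shows "dd v (\<lambda>x. p (f x) (g x)) x = p (f x) (dd v g x) + p (dd v f x) (g x)"
  by (intro dd_eqI bounded_bilinear.FDERIV assms has_derivative_dd)

lemmas dd_mult = dd_bilinear[OF bounded_bilinear_mult]
lemmas dd_cmult = dd_linear_compose[OF bounded_linear_mult_right]

lemma dd_sum:
  assumes "\<And>i. i \<in> I \<Longrightarrow> f i differentiable (at x)"
  shows "dd v (\<lambda>x. \<Sum>i\<in>I. f i x) x = (\<Sum>i\<in>I. dd v (f i) x)"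
  using assms by (intro dd_eqI has_derivative_sum has_derivative_dd) auto

lemma dd_compose:
  assumes "F differentiable (at x)" "f differentiable (at (F x))"
  shows "dd v (\<lambda>x. f (F x)) x = dd (dd v F x) f (F x)"
  by (rule dd_eqI[OF has_derivative_compose[OF has_derivative_dd[OF assms(1)] has_derivative_dd[OF assms(2)]]])

lemma dd_Basis_expansion:
  assumes "f differentiable (at x)"
  shows "dd v f x = (\<Sum>b\<in>Basis. (v \<bullet> b) *\<^sub>R dd b f x)"
proof -
  note lin = linear_dd[OF assms]
  have "dd (\<Sum>b\<in>Basis. (v \<bullet> b) *\<^sub>R b) f x = (\<Sum>b\<in>Basis. (v \<bullet> b) *\<^sub>R dd b f x)"
    by (subst linear_sum[OF lin]) (simp add: linear_scale[OF lin])
  then show ?thesis by (simp add: euclidean_representation)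
qed

section \<open>Inner products and traces of bilinear forms\<close>

definition psd_form :: "('e::euclidean_space \<Rightarrow> 'e \<Rightarrow> real) \<Rightarrow> bool" where
  "psd_form M \<longleftrightarrow> bilinear M \<and> (\<forall>u v. M u v = M v u) \<and> (\<forall>v. M v v \<ge> 0)"

definition inner_form :: "('e::euclidean_space \<Rightarrow> 'e \<Rightarrow> real) \<Rightarrow> bool" where
  "inner_form B \<longleftrightarrow> bilinear B \<and> (\<forall>u v. B u v = B v u) \<and> (\<forall>v. v \<noteq> 0 \<longrightarrow> B v v > 0)"

text \<open>The same description as \<open>sharp\<close>, but for a single form without a base
  point, so that the linear algebra is separated from the geometry.\<close>

definition riesz :: "('e::euclidean_space \<Rightarrow> 'e \<Rightarrow> real) \<Rightarrow> ('e \<Rightarrow> real) \<Rightarrow> 'e" where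
  "riesz B l = (THE z. \<forall>w. B z w = l w)"

text \<open>The trace of the endomorphism B^-1 M. It is evaluated in the standard basis, so that no
  orthonormal frame for \<open>B\<close> has to be chosen smoothly when \<open>B\<close>
  varies.\<close>

definition trace_form :: "('e::euclidean_space \<Rightarrow> 'e \<Rightarrow> real) \<Rightarrow> ('e \<Rightarrow> 'e \<Rightarrow> real) \<Rightarrow> real" where
  "trace_form B M = (\<Sum>b\<in>Basis. riesz B (M b) \<bullet> b)"

lemma bilinear_linear: "bilinear M \<Longrightarrow> linear (M u)" "bilinear M \<Longrightarrow> linear (\<lambda>u. M u w)"
  by (simp_all add: bilinear_def)

lemma inner_form_psd: "inner_form B \<Longrightarrow> psd_form B"
  unfolding inner_form_def psd_form_def by (metis bilinear_lzero less_eq_real_def)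

lemma psd_form_cauchy_schwarz:
  assumes M: "psd_form M"
  shows "(M u w)\<^sup>2 \<le> M u u * M w w"
proof -
  have bl: "bilinear M" and sym: "\<And>u v. M u v = M v u" and nn: "\<And>v. M v v \<ge> 0"
    using M by (auto simp: psd_form_def)
  have exp: "M (u + t *\<^sub>R w) (u + t *\<^sub>R w) = M u u + 2 * t * M u w + t\<^sup>2 * M w w" for t
    using sym[of w u]
    by (simp add: bilinear_ladd[OF bl] bilinear_radd[OF bl] bilinear_lmul[OF bl] bilinear_rmul[OF bl]
        power2_eq_square algebra_simps)
  show ?thesis
  proof (cases "M w w = 0")
    case False
    then have pos: "M w w > 0" using nn[of w] by simp
    have "0 \<le> M u u + 2 * (- M u w / M w w) * M u w + (- M u w / M w w)\<^sup>2 * M w w"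
      using nn exp by metis
    also have "\<dots> = M u u - (M u w)\<^sup>2 / M w w"
      using pos by (simp add: power2_eq_square field_simps)
    finally show ?thesis using pos by (simp add: field_simps)
  next
    case True
    have "M u w = 0"
    proof (rule ccontr)
      assume "M u w \<noteq> 0"
      \<comment> \<open>With \<open>M w w = 0\<close> the quadratic polynomial in the parameter is
        affine with non-zero slope; at this parameter it equals -1.\<close>
      then have "M u u + 2 * (- (M u u + 1) / (2 * M u w)) * M u w = -1" by (simp add: field_simps)
      moreover have "0 \<le> M u u + 2 * (- (M u u + 1) / (2 * M u w)) * M u w"
        using nn exp True by (metis add.right_neutral mult_zero_right)
      ultimately show False by simp
    qed
    then show ?thesis using True by simp
  qed
qed

lemma form_Basis_expansion:
  assumes "linear l"
  shows "(\<Sum>b\<in>Basis. (w \<bullet> b) * l b) = (l w :: real)"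
proof -
  have "l (\<Sum>b\<in>Basis. (w \<bullet> b) *\<^sub>R b) = (\<Sum>b\<in>Basis. (w \<bullet> b) * l b)"
    by (subst linear_sum[OF assms]) (simp add: linear_scale[OF assms])
  then show ?thesis by (simp add: euclidean_representation)
qed

text \<open>Lagrange's reduction: a vector \<open>c\<close> with \<open>M c c > 0\<close> splits off
  the square of the form \<open>M c / sqrt (M c c)\<close>, and Cauchy-Schwarz keeps the remainder
  non-negative. Traces of products are thereby reduced to rank one without diagonalising
  anything.\<close>

lemma psd_form_sum_of_squares:
  fixes M :: "'e::euclidean_space \<Rightarrow> 'e \<Rightarrow> real"
  assumes "psd_form M"
  obtains ps where "\<And>p. p \<in> set ps \<Longrightarrow> linear p" "\<And>u w. M u w = (\<Sum>p\<leftarrow>ps. p u * p w)"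
proof -
  \<comment> \<open>\<open>C\<close> holds the basis vectors still to be eliminated; the form
    already vanishes on the others. If \<open>M c c = 0\<close>, Cauchy-Schwarz gives
    \<open>M c w = 0\<close> for all \<open>w\<close>, and \<open>c\<close> is dropped without
    adding a square.\<close>
  have "\<exists>ps. (\<forall>p\<in>set ps. linear p) \<and> (\<forall>u w. M u w = (\<Sum>p\<leftarrow>ps. p u * p w))"
    if "finite C" "C \<subseteq> Basis" "psd_form M" "\<forall>b\<in>Basis - C. \<forall>w. M b w = 0" for C M
    using that
  proof (induction C arbitrary: M rule: finite_induct)
    case empty
    have "M u w = 0" for u w
      using form_Basis_expansion[OF bilinear_linear(2)[of M w], of u] empty.prems by (simp add: psd_form_def)
    then show ?case by (intro exI[of _ "[]"]) simp
  next
    case (insert c C)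
    have bl: "bilinear M" and sym: "\<And>u v. M u v = M v u" and nn: "\<And>v. M v v \<ge> 0"
      using insert.prems by (auto simp: psd_form_def)
    note CS = psd_form_cauchy_schwarz[OF insert.prems(2)]
    show ?case
    proof (cases "M c c = 0")
      case True
      have "M c w = 0" for w using CS[of c w] True by simp
      then show ?thesis using insert.prems by (intro insert.IH) auto
    next
      case False
      then have pos: "M c c > 0" using nn[of c] by simp
      define p where "p u = M c u / sqrt (M c c)" for u
      define M' where "M' u w = M u w - p u * p w" for u w
      have lin: "linear p" unfolding p_def divide_inverse mult.commute[of _ "inverse _"]
        using linear_compose[OF bilinear_linear(1)[OF bl], of "\<lambda>x. inverse (sqrt (M c c)) * x"]
        by (simp add: o_def linear_times)
      have pp: "p u * p w = M c u * M c w / M c c" for u w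
        using pos by (simp add: p_def real_sqrt_mult[symmetric])
      have "bilinear M'" unfolding bilinear_def M'_def
        using bilinear_linear[OF bl] lin
        by (auto intro!: linear_compose_sub linear_compose[of p, unfolded o_def] linear_times
            simp: mult.commute[of "p _" "p _"])
      moreover have "M' u v = M' v u" for u v by (simp add: M'_def sym mult.commute)
      moreover have "M' v v \<ge> 0" for v
        using CS[of c v] pos by (simp add: M'_def pp field_simps power2_eq_square)
      ultimately have "psd_form M'" by (simp add: psd_form_def)
      moreover have "\<forall>b\<in>Basis - C. \<forall>w. M' b w = 0"
      proof (intro ballI allI)
        fix b w assume b: "b \<in> Basis - C"
        show "M' b w = 0"
        proof (cases "b = c")
          case True then show ?thesis using pos by (simp add: M'_def pp)
        next
          case False
          then have "\<forall>w. M b w = 0" using b insert.prems by blast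
          then show ?thesis using sym[of c b] by (simp add: M'_def pp)
        qed
      qed
      ultimately obtain ps where ps: "\<forall>p\<in>set ps. linear p" "\<forall>u w. M' u w = (\<Sum>p\<leftarrow>ps. p u * p w)"
        using insert.IH[of M'] insert.prems(1) by auto
      have "M u w = (\<Sum>p\<leftarrow>p # ps. p u * p w)" for u w
        using ps(2)[rule_format, of u w] by (simp add: M'_def)
      then show ?thesis using ps(1) lin by (intro exI[of _ "p # ps"]) auto
    qed
  qed
  from this[OF finite_Basis order_refl assms] show thesis using that by blast
qed

section \<open>Representation of linear forms by a definite form\<close>

lemma riesz_unique:
  assumes "inner_form B" "\<And>w. B z w = l w"
  shows "riesz B l = z"
  unfolding riesz_def
proof (rule the_equality)
  fix y assume y: "\<forall>w. B y w = l w"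
  have bl: "bilinear B" using assms by (simp add: inner_form_def)
  have "B (y - z) (y - z) = 0" using y assms(2) by (simp add: bilinear_lsub[OF bl])
  then show "y = z" using assms(1) unfolding inner_form_def by (metis less_irrefl right_minus_eq)
qed (use assms in auto)

text \<open>\<open>T z\<close> collects the values of \<open>B z\<close> on \<open>Basis\<close>.
  Definiteness makes \<open>T\<close> injective, hence surjective by dimension, and a preimage of
  the values of \<open>l\<close> represents \<open>l\<close>.\<close>

lemma riesz:
  assumes B: "inner_form B" and l: "linear l"
  shows "B (riesz B l) w = l w"
proof -
  have bl: "bilinear B" using assms by (simp add: inner_form_def)
  define T where "T z = (\<Sum>b\<in>Basis. B z b *\<^sub>R b)" for z
  have T: "T z \<bullet> b = B z b" if "b \<in> Basis" for z b
    using that by (simp add: T_def inner_sum_left inner_Basis if_distrib cong: if_cong)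
  have lin: "linear T"
  proof (rule linearI; rule euclidean_eqI)
    show "T (x + y) \<bullet> b = (T x + T y) \<bullet> b" if "b \<in> Basis" for x y b
      using that by (simp add: T bilinear_ladd[OF bl] inner_add_left)
    show "T (r *\<^sub>R x) \<bullet> b = (r *\<^sub>R T x) \<bullet> b" if "b \<in> Basis" for r x b
      using that by (simp add: T bilinear_lmul[OF bl])
  qed
  have "inj T"
    unfolding linear_injective_0[OF lin]
  proof (intro allI impI)
    fix z assume "T z = 0"
    then have "\<And>b. b \<in> Basis \<Longrightarrow> B z b = 0" using T[of _ z] by simp
    then have "B z z = 0"
      using form_Basis_expansion[OF bilinear_linear(1)[OF bl], of z z] by simp
    then show "z = 0" using B unfolding inner_form_def by (metis less_irrefl)
  qed
  then have "surj T" using lin linear_injective_imp_surjective by blast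
  then obtain z where z: "T z = (\<Sum>b\<in>Basis. l b *\<^sub>R b)" by (metis surjD)
  have "B z b = l b" if "b \<in> Basis" for b
    using T[OF that, of z] that unfolding z by (simp add: inner_sum_left inner_Basis if_distrib cong: if_cong)
  then have "B z w = l w" for w
    using form_Basis_expansion[OF bilinear_linear(1)[OF bl], of w z] form_Basis_expansion[OF l, of w] by simp
  then show ?thesis using riesz_unique[OF B] by metis
qed

lemma inner_form_bilinear: "inner_form B \<Longrightarrow> bilinear B"
  by (simp add: inner_form_def)

lemma riesz_add:
  assumes B: "inner_form B" and l: "linear l" and m: "linear m"
  shows "riesz B (\<lambda>w. l w + m w) = riesz B l + riesz B m"
  by (rule riesz_unique[OF B]) (simp add: riesz[OF B l] riesz[OF B m] bilinear_ladd[OF inner_form_bilinear[OF B]])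

lemma riesz_diff:
  assumes B: "inner_form B" and l: "linear l" and m: "linear m"
  shows "riesz B (\<lambda>w. l w - m w) = riesz B l - riesz B m"
  by (rule riesz_unique[OF B]) (simp add: riesz[OF B l] riesz[OF B m] bilinear_lsub[OF inner_form_bilinear[OF B]])

lemma riesz_cmult:
  assumes B: "inner_form B" and l: "linear l"
  shows "riesz B (\<lambda>w. c * l w) = c *\<^sub>R riesz B l"
  by (rule riesz_unique[OF B]) (simp add: riesz[OF B l] bilinear_lmul[OF inner_form_bilinear[OF B]])

lemma riesz_zero: "inner_form B \<Longrightarrow> riesz B (\<lambda>w. 0) = 0"
  by (rule riesz_unique) (simp_all add: bilinear_lzero[OF inner_form_bilinear])

lemma riesz_self: "inner_form B \<Longrightarrow> riesz B (B z) = z"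
  by (rule riesz_unique) auto

section \<open>Traces with respect to a definite form\<close>

lemma trace_form_self:
  fixes B :: "'e::euclidean_space \<Rightarrow> 'e \<Rightarrow> real"
  shows "inner_form B \<Longrightarrow> trace_form B B = real DIM('e)"
  by (simp add: trace_form_def riesz_self)

lemma trace_form_add:
  assumes B: "inner_form B" and M: "bilinear M" and N: "bilinear N"
  shows "trace_form B (\<lambda>u w. M u w + N u w) = trace_form B M + trace_form B N"
  using M N by (simp add: trace_form_def riesz_add[OF B] bilinear_linear(1) inner_add_left sum.distrib)

lemma trace_form_cmult:
  assumes B: "inner_form B" and M: "bilinear M"
  shows "trace_form B (\<lambda>u w. c * M u w) = c * trace_form B M"
  using M by (simp add: trace_form_def riesz_cmult[OF B] bilinear_linear(1) sum_distrib_left)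

lemma trace_form_rank_one:
  assumes B: "inner_form B" and "linear p" "linear q"
  shows "trace_form B (\<lambda>u w. p u * q w) = p (riesz B q)"
  using form_Basis_expansion[OF assms(2), of "riesz B q"]
  by (simp add: trace_form_def riesz_cmult[OF assms(1,3)] mult.commute)

lemma linear_sum_list: "(\<And>p. p \<in> set ps \<Longrightarrow> linear (f p)) \<Longrightarrow> linear (\<lambda>w. \<Sum>p\<leftarrow>ps. f p w)"
  by (induction ps) (auto intro!: linear_compose_add linear_zero)

lemma riesz_sum_list:
  assumes B: "inner_form B" and "\<And>p. p \<in> set ps \<Longrightarrow> linear (f p)"
  shows "riesz B (\<lambda>w. \<Sum>p\<leftarrow>ps. f p w) = (\<Sum>p\<leftarrow>ps. riesz B (f p))"
  using assms(2)
proof (induction ps)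
  case Nil
  then show ?case by (simp add: riesz_zero[OF B])
next
  case (Cons p ps)
  then show ?case by (simp add: riesz_add[OF B] linear_sum_list)
qed

text \<open>For matrices: \<open>tr (S K S M) \<le> 0\<close>, where \<open>S\<close> is the inverse of the matrix of \<open>B\<close>.\<close>

lemma trace_form_compose_nonpos:
  assumes B: "inner_form B" and M: "psd_form M"
    and K: "bilinear K" "\<And>v. K v v \<le> 0"
  shows "trace_form B (\<lambda>u w. K (riesz B (M u)) w) \<le> 0"
proof -
  obtain ps where lin: "\<And>p. p \<in> set ps \<Longrightarrow> linear p" and ps: "\<And>u w. M u w = (\<Sum>p\<leftarrow>ps. p u * p w)"
    using psd_form_sum_of_squares[OF M] by blast
  have 1: "riesz B (M u) = (\<Sum>p\<leftarrow>ps. p u *\<^sub>R riesz B p)" for u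
  proof -
    have "M u = (\<lambda>w. \<Sum>p\<leftarrow>ps. p u * p w)" using ps by blast
    moreover have "linear (\<lambda>w. p u * p w)" if "p \<in> set ps" for p
      using linear_compose[OF lin[OF that] linear_times[of "p u"]] by (simp add: o_def)
    ultimately have "riesz B (M u) = (\<Sum>p\<leftarrow>ps. riesz B (\<lambda>w. p u * p w))"
      using riesz_sum_list[OF B, of ps "\<lambda>p w. p u * p w"] by simp
    also have "\<dots> = (\<Sum>p\<leftarrow>ps. p u *\<^sub>R riesz B p)"
      by (intro arg_cong[where f = sum_list] map_cong refl riesz_cmult[OF B lin])
    finally show ?thesis .
  qed
  have 2: "K (\<Sum>p\<leftarrow>qs. p u *\<^sub>R riesz B p) w = (\<Sum>p\<leftarrow>qs. p u * K (riesz B p) w)" for u w qs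
    by (induction qs) (auto simp: bilinear_lzero[OF K(1)] bilinear_ladd[OF K(1)] bilinear_lmul[OF K(1)])
  have "trace_form B (\<lambda>u w. \<Sum>p\<leftarrow>qs. p u * K (riesz B p) w) = (\<Sum>p\<leftarrow>qs. K (riesz B p) (riesz B p))"
    if "set qs \<subseteq> set ps" for qs
    using that
  proof (induction qs)
    case Nil
    then show ?case by (simp add: trace_form_def riesz_zero[OF B])
  next
    case (Cons p qs)
    have lp: "linear p" using Cons.prems lin by auto
    have lK: "linear (K z)" for z using bilinear_linear[OF K(1)] by blast
    have bil: "bilinear (\<lambda>u w. p u * K (riesz B p) w)" if "linear p" for p
      unfolding bilinear_def
    proof (intro conjI allI)
      show "linear (\<lambda>w. p u * K (riesz B p) w)" for u
        using linear_compose[OF lK linear_times] by (simp add: o_def)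
      show "linear (\<lambda>u. p u * K (riesz B p) w)" for w
        using linear_compose[OF that linear_times[of "K (riesz B p) w"]] by (simp add: o_def mult.commute)
    qed
    have bil2: "bilinear (\<lambda>u w. \<Sum>p\<leftarrow>qs. p u * K (riesz B p) w)"
      using Cons.prems bil lin unfolding bilinear_def by (auto intro!: linear_sum_list)
    have "K (riesz B p) (riesz B p) = trace_form B (\<lambda>u w. p u * K (riesz B p) w)"
    proof -
      have "p (riesz B (K (riesz B p))) = B (riesz B p) (riesz B (K (riesz B p)))"
        using riesz[OF B lp] by simp
      also have "\<dots> = B (riesz B (K (riesz B p))) (riesz B p)" using B by (simp add: inner_form_def)
      also have "\<dots> = K (riesz B p) (riesz B p)" by (rule riesz[OF B lK])
      finally show ?thesis using trace_form_rank_one[OF B lp lK] by simp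
    qed
    then show ?case using Cons trace_form_add[OF B bil[OF lp] bil2] by simp
  qed
  then have "trace_form B (\<lambda>u w. K (riesz B (M u)) w) = (\<Sum>p\<leftarrow>ps. K (riesz B p) (riesz B p))"
    unfolding 1 2 by simp
  also have "\<dots> \<le> 0" by (induction ps) (auto simp: K(2) add_nonpos_nonpos)
  finally show ?thesis .
qed

text \<open>The preceding lemma with \<open>K = - B\<close>, where \<open>B\<close> cancels the
  representation by \<open>riesz B\<close>.\<close>

lemma trace_form_nonneg:
  assumes B: "inner_form B" and M: "psd_form M"
  shows "trace_form B M \<ge> 0"
proof -
  have bl: "bilinear B" using B by (simp add: inner_form_def)
  have lM: "linear (M u)" for u using M by (simp add: psd_form_def bilinear_def)
  have neg: "bilinear (\<lambda>u w. - B u w)"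
    using bl unfolding bilinear_def by (auto intro: linear_compose_neg)
  have "trace_form B (\<lambda>u w. - B (riesz B (M u)) w) \<le> 0"
    using B by (intro trace_form_compose_nonpos[OF B M neg]) (auto simp: inner_form_psd psd_form_def dest: inner_form_psd)
  moreover have "trace_form B (\<lambda>u w. - B (riesz B (M u)) w) = - trace_form B M"
    using trace_form_cmult[OF B, of M "-1"] M by (simp add: riesz[OF B lM] psd_form_def)
  ultimately show ?thesis by simp
qed

lemma
  assumes B: "inner_form B" and A: "linear A" "bij A"
  shows inner_form_pullback: "inner_form (\<lambda>u w. B (A u) (A w))"
    and riesz_pullback: "linear l \<Longrightarrow> A (riesz (\<lambda>u w. B (A u) (A w)) (\<lambda>w. l (A w))) = riesz B l"
proof -
  have 0: "A v \<noteq> 0" if "v \<noteq> 0" for v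
    using A that by (metis bij_def linear_0 injD)
  then show ip: "inner_form (\<lambda>u w. B (A u) (A w))"
    using B linear_compose[OF A(1)] by (auto simp: inner_form_def bilinear_def o_def)
  assume l: "linear l"
  have "riesz (\<lambda>u w. B (A u) (A w)) (\<lambda>w. l (A w)) = inv A (riesz B l)"
    using A by (intro riesz_unique[OF ip]) (simp add: bij_is_surj surj_f_inv_f riesz[OF B l])
  then show "A (riesz (\<lambda>u w. B (A u) (A w)) (\<lambda>w. l (A w))) = riesz B l"
    using A by (simp add: bij_is_surj surj_f_inv_f)
qed

text \<open>If \<open>E\<close> is the endomorphism representing \<open>M\<close>, the pulled back
  forms are represented by its conjugate under \<open>A\<close>, and conjugate endomorphisms have
  the same trace.\<close>

lemma trace_form_pullback:
  fixes A :: "'e::euclidean_space \<Rightarrow> 'e"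
  assumes B: "inner_form B" and A: "linear A" "bij A" and M: "bilinear M"
  shows "trace_form (\<lambda>u w. B (A u) (A w)) (\<lambda>u w. M (A u) (A w)) = trace_form B M"
proof -
  define E where "E u = riesz B (M u)" for u
  have linE: "linear E"
  proof (rule linearI)
    show "E (x + y) = E x + E y" for x y
      unfolding E_def bilinear_ladd[OF M] by (rule riesz_add[OF B bilinear_linear(1)[OF M] bilinear_linear(1)[OF M]])
    show "E (r *\<^sub>R x) = r *\<^sub>R E x" for r x
      unfolding E_def bilinear_lmul[OF M] real_scaleR_def
      by (rule riesz_cmult[OF B bilinear_linear(1)[OF M]])
  qed
  have inv: "linear (inv A)" using A inj_linear_imp_inv_linear bij_def by blast
  have 1: "riesz (\<lambda>u w. B (A u) (A w)) (\<lambda>w. M (A u) (A w)) = inv A (E (A u))" for u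
    using riesz_pullback[OF B A bilinear_linear(1)[OF M], of "A u"] A
    by (simp add: E_def bij_def inv_f_eq)
  have lin2: "linear (\<lambda>v. inv A (E v) \<bullet> b)" for b
    using linear_compose[OF linE inv] by (auto simp: o_def linear_iff inner_add_left)
  have lin3: "linear (\<lambda>v. A v \<bullet> c)" for c
    using A by (auto simp: linear_iff inner_add_left)
  have "(\<Sum>b\<in>Basis. inv A (E (A b)) \<bullet> b) = (\<Sum>b\<in>Basis. \<Sum>c\<in>Basis. (A b \<bullet> c) * (inv A (E c) \<bullet> b))"
    using form_Basis_expansion[OF lin2] by simp
  also have "\<dots> = (\<Sum>c\<in>Basis. \<Sum>b\<in>Basis. (inv A (E c) \<bullet> b) * (A b \<bullet> c))"
    by (subst sum.swap) (simp add: mult.commute)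
  also have "\<dots> = (\<Sum>c\<in>Basis. A (inv A (E c)) \<bullet> c)"
    using form_Basis_expansion[OF lin3] by simp
  finally show ?thesis using A by (simp add: trace_form_def 1 bij_is_surj surj_f_inv_f E_def)
qed

section \<open>Smooth dependence of the Riesz representation\<close>

lemma riemannian_metric_inner_form: "riemannian_metric_on S G \<Longrightarrow> x \<in> S \<Longrightarrow> inner_form (G x)"
  by (simp add: riemannian_metric_on_def inner_form_def)

lemma riemannian_metric_smooth: "riemannian_metric_on S G \<Longrightarrow> smooth_on S (\<lambda>x. G x u v)"
  by (simp add: riemannian_metric_on_def)

lemma bilinear_Basis_expansion:
  assumes "bilinear M"
  shows "M u w = (\<Sum>a\<in>Basis. \<Sum>b\<in>Basis. (u \<bullet> a) * (w \<bullet> b) * (M a b :: real))"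
proof -
  have "M u w = (\<Sum>a\<in>Basis. (u \<bullet> a) * M a w)"
    using form_Basis_expansion[OF bilinear_linear(2)[OF assms]] by simp
  also have "\<dots> = (\<Sum>a\<in>Basis. (u \<bullet> a) * (\<Sum>b\<in>Basis. (w \<bullet> b) * M a b))"
    using form_Basis_expansion[OF bilinear_linear(1)[OF assms]] by simp
  finally show ?thesis by (simp add: sum_distrib_left mult.assoc)
qed

text \<open>The constant is the minimum of the quadratic form over a closed ball times the unit
  sphere, a compact set; homogeneity extends the bound to all vectors.\<close>

lemma metric_locally_coercive:
  fixes G :: "'e::euclidean_space metric_field"
  assumes S: "open S" "x0 \<in> S" and G: "riemannian_metric_on S G"
  obtains c d where "c > 0" "d > 0" "ball x0 d \<subseteq> S" "\<And>x v. x \<in> ball x0 d \<Longrightarrow> c * (norm v)\<^sup>2 \<le> G x v v"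
proof -
  obtain d where d: "d > 0" "cball x0 d \<subseteq> S" using S open_contains_cball by blast
  let ?K = "cball x0 d \<times> sphere (0::'e) 1"
  \<comment> \<open>Smoothness of \<open>G\<close> is given only for fixed vectors; the expansion in
    \<open>Basis\<close> makes it jointly continuous in point and vector.\<close>
  let ?q = "\<lambda>p. \<Sum>a\<in>Basis. \<Sum>b\<in>Basis. (snd p \<bullet> a) * (snd p \<bullet> b) * G (fst p) a b"
  have contG: "continuous_on ?K (\<lambda>p. G (fst p) a b)" for a b
    using smooth_on_continuous[OF riemannian_metric_smooth[OF G], of a b] d
    by (intro continuous_on_compose2[of S "\<lambda>x. G x a b" ?K fst] continuous_on_fst continuous_on_id) auto
  have cont: "continuous_on ?K ?q"
    by (intro continuous_intros contG)
  have q: "?q (x, v) = G x v v" if "x \<in> S" for x v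
    unfolding fst_conv snd_conv
    by (rule bilinear_Basis_expansion[OF inner_form_bilinear[OF riemannian_metric_inner_form[OF G that]], symmetric])
  obtain e :: 'e where e: "e \<in> Basis" using nonempty_Basis by blast
  have "?K \<noteq> {}" using d e by (auto intro!: exI[of _ x0] exI[of _ e])
  moreover have "compact ?K" by (intro compact_Times compact_cball compact_sphere)
  ultimately obtain m where m: "m \<in> ?K" "\<And>p. p \<in> ?K \<Longrightarrow> ?q m \<le> ?q p"
    using continuous_attains_inf[OF _ _ cont] by blast
  obtain y w where yw: "m = (y, w)" "y \<in> S" "norm w = 1" using m(1) d by (cases m) auto
  have pos: "?q m > 0"
  proof -
    have "w \<noteq> 0" using yw(3) by auto
    then have "G y w w > 0" using riemannian_metric_inner_form[OF G yw(2)] by (simp add: inner_form_def)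
    then show ?thesis unfolding yw(1) q[OF yw(2)] .
  qed
  show thesis
  proof (rule that[OF pos d(1)])
    show "ball x0 d \<subseteq> S" using d ball_subset_cball by blast
    fix x v assume x: "x \<in> ball x0 d"
    then have xS: "x \<in> S" using d by auto
    have bl: "bilinear (G x)" using inner_form_bilinear[OF riemannian_metric_inner_form[OF G xS]] .
    show "?q m * (norm v)\<^sup>2 \<le> G x v v"
    proof (cases "v = 0")
      case False
      have "?q m \<le> ?q (x, v /\<^sub>R norm v)" using False x by (intro m(2)) auto
      also have "\<dots> = G x v v / (norm v)\<^sup>2"
        unfolding q[OF xS] by (simp add: bilinear_lmul[OF bl] bilinear_rmul[OF bl] power2_eq_square divide_inverse)
      finally show ?thesis using False by (simp add: pos_le_divide_eq)
    qed (simp add: bilinear_lzero[OF bl])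
  qed
qed

lemma linear_form_norm_bound:
  fixes l :: "'e::euclidean_space \<Rightarrow> real"
  assumes "linear l"
  shows "\<bar>l w\<bar> \<le> (\<Sum>b\<in>Basis. \<bar>l b\<bar>) * norm w"
proof -
  have "\<bar>l w\<bar> \<le> (\<Sum>b\<in>Basis. \<bar>(w \<bullet> b) * l b\<bar>)"
    using form_Basis_expansion[OF assms, of w] sum_abs[of "\<lambda>b. (w \<bullet> b) * l b" Basis] by simp
  also have "\<dots> \<le> (\<Sum>b\<in>Basis. norm w * \<bar>l b\<bar>)"
    by (intro sum_mono) (auto simp: abs_mult intro!: mult_right_mono Basis_le_norm)
  finally show ?thesis by (simp add: sum_distrib_left mult.commute sum_distrib_right)
qed

text \<open>The residual \<open>r x\<close> of the old representative \<open>X x0\<close> in the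
  equation at \<open>x\<close> is continuous and vanishes at \<open>x0\<close>. Coercivity bounds
  the distance between \<open>X x\<close> and \<open>X x0\<close> by it.\<close>

lemma isCont_riesz:
  fixes G :: "'e::euclidean_space metric_field"
  assumes S: "open S" "x0 \<in> S" and G: "riemannian_metric_on S G"
    and l: "\<And>w. continuous_on S (\<lambda>x. l x w)" "\<And>x. x \<in> S \<Longrightarrow> linear (l x)"
  shows "isCont (\<lambda>x. riesz (G x) (l x)) x0"
proof -
  define X where "X x = riesz (G x) (l x)" for x
  obtain c d where c: "c > 0" and d: "d > 0" "ball x0 d \<subseteq> S"
    and coer: "\<And>x v. x \<in> ball x0 d \<Longrightarrow> c * (norm v)\<^sup>2 \<le> G x v v"
    using metric_locally_coercive[OF S G] by blast
  define r where "r x w = l x w - G x (X x0) w" for x w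
  define R where "R x = (\<Sum>b\<in>Basis. \<bar>r x b\<bar>)" for x
  have ipS: "inner_form (G x)" if "x \<in> S" for x using riemannian_metric_inner_form[OF G that] .
  have "norm (X x - X x0) \<le> R x / c" if x: "x \<in> ball x0 d" for x
  proof (cases "X x = X x0")
    case False
    have xS: "x \<in> S" using x d by auto
    note bl = inner_form_bilinear[OF ipS[OF xS]]
    have lin: "linear (r x)" unfolding r_def
      by (intro linear_compose_sub l(2)[OF xS] bilinear_linear(1)[OF bl])
    have "c * (norm (X x - X x0))\<^sup>2 \<le> G x (X x - X x0) (X x - X x0)" using coer[OF x] .
    also have "\<dots> = r x (X x - X x0)"
      unfolding r_def bilinear_lsub[OF bl, of _ _ "X x - X x0"]
      using riesz[OF ipS[OF xS] l(2)[OF xS]] by (simp add: X_def)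
    also have "\<dots> \<le> R x * norm (X x - X x0)"
      using linear_form_norm_bound[OF lin, of "X x - X x0"] by (simp add: R_def)
    finally have "c * norm (X x - X x0) * norm (X x - X x0) \<le> R x * norm (X x - X x0)"
      by (simp add: power2_eq_square)
    then have "c * norm (X x - X x0) \<le> R x" using False by simp
    then show ?thesis using c by (simp add: field_simps)
  qed (use c in \<open>simp add: R_def sum_nonneg\<close>)
  then have ev: "\<forall>\<^sub>F x in at x0. norm (X x - X x0) \<le> R x / c"
    unfolding eventually_at using d by (intro exI[of _ d]) (auto simp: dist_commute)
  have "R x0 = 0"
    using riesz[OF ipS[OF S(2)] l(2)[OF S(2)]] by (simp add: R_def r_def X_def)
  moreover have "continuous_on S (\<lambda>x. R x / c)" unfolding R_def r_def
    using smooth_on_continuous[OF riemannian_metric_smooth[OF G]] c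
    by (intro continuous_intros l(1)) auto
  then have "isCont (\<lambda>x. R x / c) x0" using S by (simp add: continuous_on_eq_continuous_at)
  ultimately have "((\<lambda>x. R x / c) \<longlongrightarrow> 0) (at x0)" by (simp add: isCont_def)
  from Lim_null_comparison[OF ev this] have "((\<lambda>x. X x - X x0) \<longlongrightarrow> 0) (at x0)" .
  then show ?thesis unfolding X_def[symmetric] isCont_def by (simp add: LIM_zero_iff)
qed

text \<open>If one factor vanishes at the point, mere continuity of the other is enough for the
  product rule. This lets \<open>riesz\<close> be differentiated when only its continuity is
  known.\<close>

lemma has_derivative_mult_vanishing:
  fixes h k :: "'a::real_normed_vector \<Rightarrow> real"
  assumes k: "isCont k x0" and h: "(h has_derivative h') (at x0)" "h x0 = 0"
  shows "((\<lambda>x. k x * h x) has_derivative (\<lambda>v. k x0 * h' v)) (at x0)"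
proof -
  have "((\<lambda>x. (k x - k x0) * h x) has_derivative (\<lambda>v. 0)) (at x0)"
    unfolding has_derivative_at_alt
  proof (intro conjI allI impI bounded_linear_zero)
    fix e :: real assume e: "e > 0"
    obtain B where B: "B > 0" "\<And>v. norm (h' v) \<le> norm v * B"
      using bounded_linear.pos_bounded[OF has_derivative_bounded_linear[OF h(1)]] by blast
    obtain d1 where d1: "d1 > 0" "\<And>y. norm (y - x0) < d1 \<Longrightarrow> norm (h y - h x0 - h' (y - x0)) \<le> 1 * norm (y - x0)"
      using h(1) unfolding has_derivative_at_alt by (metis zero_less_one)
    have "e / (B + 1) > 0" using e B by simp
    then obtain d2 where d2: "d2 > 0" "\<And>y. norm (y - x0) < d2 \<Longrightarrow> \<bar>k y - k x0\<bar> < e / (B + 1)"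
      using k unfolding continuous_at_eps_delta dist_real_def dist_norm by (metis (mono_tags, lifting))
    show "\<exists>d>0. \<forall>y. norm (y - x0) < d \<longrightarrow>
        norm ((k y - k x0) * h y - (k x0 - k x0) * h x0 - 0) \<le> e * norm (y - x0)"
    proof (intro exI[of _ "min d1 d2"] conjI allI impI)
      fix y assume y: "norm (y - x0) < min d1 d2"
      have "\<bar>h y\<bar> \<le> norm (h y - h x0 - h' (y - x0)) + norm (h' (y - x0))"
        using h(2) by simp
      also have "\<dots> \<le> 1 * norm (y - x0) + norm (y - x0) * B" using d1(2)[of y] B(2)[of "y - x0"] y by linarith
      finally have "\<bar>h y\<bar> \<le> (B + 1) * norm (y - x0)" by (simp add: algebra_simps)
      then have "\<bar>k y - k x0\<bar> * \<bar>h y\<bar> \<le> e / (B + 1) * ((B + 1) * norm (y - x0))"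
        using d2(2)[of y] y e B by (intro mult_mono) auto
      also have "\<dots> = e * norm (y - x0)" using B by simp
      finally show "norm ((k y - k x0) * h y - (k x0 - k x0) * h x0 - 0) \<le> e * norm (y - x0)"
        by (simp add: abs_mult)
    qed (use d1 d2 in auto)
  qed
  moreover have "((\<lambda>x. k x0 * h x) has_derivative (\<lambda>v. k x0 * h' v)) (at x0)"
    by (rule bounded_linear.has_derivative[OF bounded_linear_mult_right h(1)])
  ultimately have "((\<lambda>x. (k x - k x0) * h x + k x0 * h x) has_derivative (\<lambda>v. 0 + k x0 * h' v)) (at x0)"
    by (rule has_derivative_add)
  then show ?thesis by (simp add: algebra_simps)
qed

lemma bilinear_dd:
  assumes S: "open S" "x \<in> S" and M: "\<And>u w. smooth_on S (\<lambda>y. M y u w)" "\<And>y. y \<in> S \<Longrightarrow> bilinear (M y)"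
  shows "bilinear (\<lambda>u w. dd v (\<lambda>y. M y u w) x :: real)"
proof -
  have d: "(\<lambda>y. M y u w) differentiable (at x)" for u w
    using smooth_onD_differentiable[OF M(1) S(2)] .
  have 1: "dd v (\<lambda>y. M y (a + b) w) x = dd v (\<lambda>y. M y a w) x + dd v (\<lambda>y. M y b w) x" for a b w
    unfolding dd_add[OF d d, symmetric] by (rule dd_cong[OF S]) (simp add: bilinear_ladd[OF M(2)])
  have 2: "dd v (\<lambda>y. M y w (a + b)) x = dd v (\<lambda>y. M y w a) x + dd v (\<lambda>y. M y w b) x" for a b w
    unfolding dd_add[OF d d, symmetric] by (rule dd_cong[OF S]) (simp add: bilinear_radd[OF M(2)])
  have 3: "dd v (\<lambda>y. M y (r *\<^sub>R a) w) x = r * dd v (\<lambda>y. M y a w) x" for r a w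
    unfolding dd_cmult[OF d, symmetric] by (rule dd_cong[OF S]) (simp add: bilinear_lmul[OF M(2)])
  have 4: "dd v (\<lambda>y. M y w (r *\<^sub>R a)) x = r * dd v (\<lambda>y. M y w a) x" for r a w
    unfolding dd_cmult[OF d, symmetric] by (rule dd_cong[OF S]) (simp add: bilinear_rmul[OF M(2)])
  show ?thesis using 1 2 3 4 by (simp add: bilinear_def linear_iff)
qed

lemma linear_dd_form:
  assumes S: "open S" "x \<in> S" and l: "\<And>w y. y \<in> S \<Longrightarrow> (\<lambda>x. l x w) differentiable (at y)"
    and lin: "\<And>y. y \<in> S \<Longrightarrow> linear (l y)"
  shows "linear (\<lambda>w. dd v (\<lambda>y. l y w) x :: real)"
proof (rule linearI)
  note d = l[OF S(2)]
  show "dd v (\<lambda>y. l y (a + b)) x = dd v (\<lambda>y. l y a) x + dd v (\<lambda>y. l y b) x" for a b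
    unfolding dd_add[OF d d, symmetric] by (rule dd_cong[OF S]) (simp add: linear_add[OF lin])
  show "dd v (\<lambda>y. l y (r *\<^sub>R a)) x = r *\<^sub>R dd v (\<lambda>y. l y a) x" for r a
    unfolding real_scaleR_def dd_cmult[OF d, symmetric] by (rule dd_cong[OF S]) (simp add: linear_scale[OF lin])
qed

text \<open>Implicit differentiation of \<open>G x (X x) w = l x w\<close>. Freezing the metric at
  \<open>x0\<close> turns the equation into
  \<open>G x0 (X x) w = l x w - (G x - G x0) (X x) w\<close>; in the last term the continuous
  \<open>X x\<close> multiplies a difference that vanishes at \<open>x0\<close>.\<close>

lemma has_derivative_riesz:
  fixes G :: "'e::euclidean_space metric_field"
  assumes S: "open S" "x0 \<in> S" and G: "riemannian_metric_on S G"
    and l: "\<And>w x. x \<in> S \<Longrightarrow> (\<lambda>x. l x w) differentiable (at x)" "\<And>x. x \<in> S \<Longrightarrow> linear (l x)"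
  defines "X \<equiv> \<lambda>x. riesz (G x) (l x)"
  shows "(X has_derivative (\<lambda>v. riesz (G x0) (\<lambda>w. dd v (\<lambda>y. l y w) x0 - dd v (\<lambda>y. G y (X x0) w) x0))) (at x0)"
proof -
  have ipS: "inner_form (G x)" if "x \<in> S" for x using riemannian_metric_inner_form[OF G that] .
  note bl = inner_form_bilinear[OF ipS]
  have dG: "(\<lambda>y. G y u w) differentiable (at x0)" for u w
    using smooth_onD_differentiable[OF riemannian_metric_smooth[OF G] S(2)] .
  have "continuous_on S (\<lambda>x. l x w)" for w
    using l(1) by (intro continuous_at_imp_continuous_on ballI differentiable_imp_continuous_within) auto
  then have contX: "isCont X x0" unfolding X_def by (rule isCont_riesz[where l = l, OF S G _ l(2)])
  define e where "e b = riesz (G x0) (\<lambda>w. w \<bullet> b)" for b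
  define c where "c x b = l x b - (\<Sum>a\<in>Basis. (X x \<bullet> a) * (G x a b - G x0 a b))" for x b
  have rep: "riesz (G x0) k = (\<Sum>b\<in>Basis. k b *\<^sub>R e b)" if "linear k" for k
  proof (rule riesz_unique[OF ipS[OF S(2)]])
    fix w
    have "linear (\<lambda>w. w \<bullet> b)" for b :: 'e by (simp add: linear_iff inner_add_left)
    then have "G x0 (e b) w = w \<bullet> b" for b using riesz[OF ipS[OF S(2)]] by (simp add: e_def)
    then have "G x0 (\<Sum>b\<in>Basis. k b *\<^sub>R e b) w = (\<Sum>b\<in>Basis. (w \<bullet> b) * k b)"
      by (subst linear_sum[OF bilinear_linear(2)[OF bl[OF S(2)]]])
        (simp add: bilinear_lmul[OF bl[OF S(2)]] mult.commute)
    then show "G x0 (\<Sum>b\<in>Basis. k b *\<^sub>R e b) w = k w" using form_Basis_expansion[OF that] by simp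
  qed
  have XS: "X x = (\<Sum>b\<in>Basis. c x b *\<^sub>R e b)" if x: "x \<in> S" for x
  proof -
    have lin: "linear (\<lambda>w. l x w - (G x (X x) w - G x0 (X x) w))"
      by (intro linear_compose_sub l(2)[OF x] bilinear_linear(1)[OF bl] x S)
    have "X x = riesz (G x0) (\<lambda>w. l x w - (G x (X x) w - G x0 (X x) w))"
      using riesz[OF ipS[OF x] l(2)[OF x]] by (intro riesz_unique[OF ipS[OF S(2)], symmetric]) (simp add: X_def)
    also have "\<dots> = (\<Sum>b\<in>Basis. (l x b - (G x (X x) b - G x0 (X x) b)) *\<^sub>R e b)"
      by (rule rep[OF lin])
    finally show ?thesis
      using form_Basis_expansion[OF linear_compose_sub[OF bilinear_linear(2)[OF bl[OF x]] bilinear_linear(2)[OF bl[OF S(2)]]],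
          of "X x"]
      by (simp add: c_def)
  qed
  have contXa: "isCont (\<lambda>x. X x \<bullet> a) x0" for a using contX by (intro continuous_intros)
  have G1: "((\<lambda>x. G x a b - G x0 a b) has_derivative (\<lambda>v. dd v (\<lambda>y. G y a b) x0)) (at x0)" for a b
    using has_derivative_diff[OF has_derivative_dd[OF dG] has_derivative_const] by simp
  have "((\<lambda>x. c x b) has_derivative
      (\<lambda>v. dd v (\<lambda>y. l y b) x0 - (\<Sum>a\<in>Basis. (X x0 \<bullet> a) * dd v (\<lambda>y. G y a b) x0))) (at x0)" for b
    unfolding c_def
    by (intro has_derivative_diff has_derivative_sum has_derivative_dd l S
        has_derivative_mult_vanishing[OF contXa G1]) auto
  then have cder: "((\<lambda>x. c x b) has_derivative
      (\<lambda>v. dd v (\<lambda>y. l y b) x0 - dd v (\<lambda>y. G y (X x0) b) x0)) (at x0)" for b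
    using form_Basis_expansion[OF bilinear_linear(2)[OF bilinear_dd[OF S riemannian_metric_smooth[OF G] bl]]] by simp
  have "((\<lambda>x. \<Sum>b\<in>Basis. c x b *\<^sub>R e b) has_derivative
      (\<lambda>v. \<Sum>b\<in>Basis. (dd v (\<lambda>y. l y b) x0 - dd v (\<lambda>y. G y (X x0) b) x0) *\<^sub>R e b)) (at x0)"
    by (intro has_derivative_sum has_derivative_scaleR_left cder)
  also have "(\<lambda>v. \<Sum>b\<in>Basis. (dd v (\<lambda>y. l y b) x0 - dd v (\<lambda>y. G y (X x0) b) x0) *\<^sub>R e b)
      = (\<lambda>v. riesz (G x0) (\<lambda>w. dd v (\<lambda>y. l y w) x0 - dd v (\<lambda>y. G y (X x0) w) x0))"
    by (intro ext rep[symmetric] linear_compose_sub linear_dd_form[OF S l]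
        bilinear_linear(1)[OF bilinear_dd[OF S riemannian_metric_smooth[OF G] bl]]) auto
  finally show ?thesis
    using has_derivative_transform_within_open[OF _ S, of "\<lambda>x. \<Sum>b\<in>Basis. c x b *\<^sub>R e b" _ UNIV X] XS by simp
qed

text \<open>The derivative of a representative is again a representative, of a form that involves
  the representative itself to one order less. Hence the induction runs over \<open>n\<close> with
  \<open>l\<close> arbitrary.\<close>

lemma C_diff_riesz:
  fixes G :: "'e::euclidean_space metric_field"
  assumes S: "open S" and G: "riemannian_metric_on S G"
    and "\<And>w. C_diff n S (\<lambda>x. l x w)" "\<And>x. x \<in> S \<Longrightarrow> linear (l x)"
  shows "C_diff n S (\<lambda>x. riesz (G x) (l x))"
  using assms(3,4)
proof (induction n arbitrary: l)
  case 0
  then show ?case using isCont_riesz[OF S _ G] by (auto intro!: continuous_at_imp_continuous_on)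
next
  case (Suc n)
  let ?X = "\<lambda>x. riesz (G x) (l x)"
  have bl: "bilinear (G x)" if "x \<in> S" for x
    using inner_form_bilinear[OF riemannian_metric_inner_form[OF G that]] .
  have l: "(\<lambda>x. l x w) differentiable (at x)" if "x \<in> S" for x w
    using Suc.prems(1)[of w] that by (simp add: C_diff_Suc_dd)
  note der = has_derivative_riesz[OF S _ G l Suc.prems(2)]
  have X: "C_diff n S ?X" using C_diff_SucD[OF Suc.prems(1)] Suc.prems(2) by (rule Suc.IH)
  \<comment> \<open>The derivative of \<open>G\<close> is smooth for fixed arguments only, while
    \<open>?X x\<close> moves with \<open>x\<close>; the expansion in \<open>Basis\<close> separates
    the two.\<close>
  define k where "k v x w = dd v (\<lambda>y. l y w) x - (\<Sum>a\<in>Basis. (?X x \<bullet> a) * dd v (\<lambda>y. G y a w) x)" for v x w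
  have k: "k v x = (\<lambda>w. dd v (\<lambda>y. l y w) x - dd v (\<lambda>y. G y (?X x) w) x)" if "x \<in> S" for v x
    using form_Basis_expansion[OF bilinear_linear(2)[OF bilinear_dd[OF S that riemannian_metric_smooth[OF G] bl]]]
    by (simp add: k_def fun_eq_iff)
  have "C_diff n S (\<lambda>x. riesz (G x) (k v x))" for v
  proof (rule Suc.IH)
    have dG: "C_diff n S (dd v (\<lambda>y. G y a w))" for a w
      using smooth_on_dd[OF riemannian_metric_smooth[OF G]] by (simp add: smooth_on_def)
    have m: "C_diff n S (\<lambda>x. - ((?X x \<bullet> a) * dd v (\<lambda>y. G y a w) x))" for a w
      by (intro C_diff_linear_compose[OF S bounded_linear_minus[OF bounded_linear_ident]]
          C_diff_bilinear[OF S bounded_bilinear_mult] C_diff_linear_compose[OF S bounded_linear_inner_left] X dG)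
    have "C_diff n S (\<lambda>x. dd v (\<lambda>y. l y w) x + (\<Sum>a\<in>Basis. - ((?X x \<bullet> a) * dd v (\<lambda>y. G y a w) x)))" for w
      using Suc.prems(1) by (intro C_diff_add C_diff_sum S m) (simp add: C_diff_Suc_dd)
    then show "C_diff n S (\<lambda>x. k v x w)" for w by (simp add: k_def sum_negf)
    show "linear (k v x)" if "x \<in> S" for x
      unfolding k[OF that]
      by (intro linear_compose_sub linear_dd_form[OF S that l Suc.prems(2)]
          bilinear_linear(1)[OF bilinear_dd[OF S that riemannian_metric_smooth[OF G] bl]])
  qed
  moreover have "dd v ?X x = riesz (G x) (k v x)" if "x \<in> S" for v x
    unfolding k[OF that] by (rule dd_eqI[OF der[OF that]])
  ultimately have "C_diff n S (dd v ?X)" for v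
    using C_diff_cong[OF S, of "dd v ?X" "\<lambda>x. riesz (G x) (k v x)"] by simp
  then show ?case using der by (auto simp: C_diff_Suc_dd differentiable_def)
qed

lemma smooth_on_riesz:
  fixes G :: "'e::euclidean_space metric_field"
  assumes S: "open S" and G: "riemannian_metric_on S G"
    and l: "\<And>w. smooth_on S (\<lambda>x. l x w)" "\<And>x. x \<in> S \<Longrightarrow> linear (l x)"
  shows "smooth_on S (\<lambda>x. riesz (G x) (l x))"
  using C_diff_riesz[where l = l, OF S G _ l(2)] l(1) unfolding smooth_on_def by blast

lemma dd_riesz:
  fixes G :: "'e::euclidean_space metric_field"
  assumes S: "open S" "x \<in> S" and G: "riemannian_metric_on S G"
    and l: "\<And>w. smooth_on S (\<lambda>x. l x w)" "\<And>x. x \<in> S \<Longrightarrow> linear (l x)"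
  shows "G x (dd v (\<lambda>x. riesz (G x) (l x)) x) w
    = dd v (\<lambda>y. l y w) x - dd v (\<lambda>y. G y (riesz (G x) (l x)) w) x"
proof -
  have bl: "bilinear (G x)" if "x \<in> S" for x
    using inner_form_bilinear[OF riemannian_metric_inner_form[OF G that]] .
  note d = smooth_onD_differentiable[OF l(1)]
  let ?k = "\<lambda>w. dd v (\<lambda>y. l y w) x - dd v (\<lambda>y. G y (riesz (G x) (l x)) w) x"
  have "linear ?k"
    by (intro linear_compose_sub linear_dd_form[OF S d l(2)]
          bilinear_linear(1)[OF bilinear_dd[OF S riemannian_metric_smooth[OF G] bl]])
  moreover have "dd v (\<lambda>x. riesz (G x) (l x)) x = riesz (G x) ?k"
    by (rule dd_eqI[OF has_derivative_riesz[OF S G d l(2)]])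
  ultimately show ?thesis using riesz[OF riemannian_metric_inner_form[OF G S(2)], of ?k] by simp
qed

section \<open>Levi-Civita connection and Hessian in coordinates\<close>

lemma bilinear_add:
  "bilinear M \<Longrightarrow> bilinear N \<Longrightarrow> bilinear (\<lambda>u w. M u w + N u w)"
  by (simp add: bilinear_def linear_compose_add)

lemma bilinear_diff:
  "bilinear M \<Longrightarrow> bilinear N \<Longrightarrow> bilinear (\<lambda>u w. M u w - N u w)"
  by (simp add: bilinear_def linear_compose_sub)

lemma bilinear_linear_compose: "linear l \<Longrightarrow> bilinear M \<Longrightarrow> bilinear (\<lambda>u w. l (M u w))"
  unfolding bilinear_def
  using linear_compose[where g = l and f = "M u" for u] linear_compose[where g = l and f = "\<lambda>u. M u w" for w]
  by (auto simp: o_def)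

lemma bilinear_cmult: "bilinear M \<Longrightarrow> bilinear (\<lambda>u w. c * M u w :: real)"
  by (rule bilinear_linear_compose[OF linear_times])

lemma bilinear_compose: "bilinear M \<Longrightarrow> linear A \<Longrightarrow> bilinear (\<lambda>u w. M (A u) (A w))"
  unfolding bilinear_def using linear_compose[of A] by (auto simp: o_def)

lemma bilinear_rank_one:
  assumes "linear p" "linear q"
  shows "bilinear (\<lambda>u w. p u * q w :: real)"
  using linear_add[OF assms(1)] linear_add[OF assms(2)] linear_scale[OF assms(1)] linear_scale[OF assms(2)]
  by (simp add: bilinear_def linear_iff algebra_simps)

lemma bilinear_second_dd:
  assumes S: "open S" "x \<in> S" and h: "smooth_on S (h :: 'e::euclidean_space \<Rightarrow> real)"
  shows "bilinear (\<lambda>u w. dd u (dd w h) x)"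
proof -
  have "linear (\<lambda>w. dd u (dd w h) x)" for u
    by (rule linear_dd_form[OF S smooth_onD_differentiable[OF smooth_on_dd[OF h]]
          linear_dd[OF smooth_onD_differentiable[OF h]]])
  moreover have "linear (\<lambda>u. dd u (dd w h) x)" for w
    by (rule linear_dd[OF smooth_onD_differentiable[OF smooth_on_dd[OF h] S(2)]])
  ultimately show ?thesis by (simp add: bilinear_def)
qed

lemma sharp_eq_riesz: "sharp G x l = riesz (G x) l"
  by (simp add: sharp_def riesz_def)

lemma smooth_on_divide_const: "open S \<Longrightarrow> smooth_on S f \<Longrightarrow> smooth_on S (\<lambda>x. f x / (c::real))"
  by (rule smooth_on_linear_compose[OF _ bounded_linear_divide])

context
  fixes S :: "'e::euclidean_space set" and G :: "'e metric_field"
  assumes S: "open S" and G: "riemannian_metric_on S G"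
begin

lemma metric_inner_form: "x \<in> S \<Longrightarrow> inner_form (G x)"
  by (rule riemannian_metric_inner_form[OF G])

lemma metric_bilinear: "x \<in> S \<Longrightarrow> bilinear (G x)"
  by (rule inner_form_bilinear[OF metric_inner_form])

lemma metric_sym: "x \<in> S \<Longrightarrow> G x u v = G x v u"
  using metric_inner_form unfolding inner_form_def by blast

lemma metric_smooth: "smooth_on S (\<lambda>y. G y u v)"
  by (rule riemannian_metric_smooth[OF G])

lemma metric_nondegenerate:
  assumes "x \<in> S" "\<And>w. G x u w = G x v w"
  shows "u = v"
  using riesz_unique[OF metric_inner_form[OF assms(1)]] assms(2) by (metis (no_types))

lemma dd_metric_bilinear: "x \<in> S \<Longrightarrow> bilinear (\<lambda>v w. dd u (\<lambda>y. G y v w) x)"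
  by (rule bilinear_dd[OF S _ metric_smooth metric_bilinear])

lemma dd_metric_sym: "x \<in> S \<Longrightarrow> dd u (\<lambda>y. G y v w) x = dd u (\<lambda>y. G y w v) x"
  by (rule dd_cong[OF S _ metric_sym])

text \<open>The base point comes before \<open>w\<close>, so that \<open>koszul u v x\<close> is the
  linear form that the Christoffel vector represents.\<close>

definition koszul :: "'e \<Rightarrow> 'e \<Rightarrow> 'e \<Rightarrow> 'e \<Rightarrow> real" where
  "koszul u v x w = (dd u (\<lambda>y. G y v w) x + dd v (\<lambda>y. G y u w) x - dd w (\<lambda>y. G y u v) x) / 2"

lemma christoffel_eq_riesz: "christoffel G x u v = riesz (G x) (koszul u v x)"
  unfolding christoffel_def sharp_eq_riesz koszul_def dd_def ..

lemma linear_koszul: "x \<in> S \<Longrightarrow> linear (koszul u v x)"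
  unfolding koszul_def
  by (rule linear_compose[OF _ bounded_linear.linear[OF bounded_linear_divide], unfolded o_def])
    (intro linear_compose_sub linear_compose_add bilinear_linear(1)[OF dd_metric_bilinear]
      linear_dd[OF smooth_onD_differentiable[OF metric_smooth]])

lemma smooth_koszul: "smooth_on S (\<lambda>x. koszul u v x w)"
  unfolding koszul_def
  by (intro smooth_on_divide_const smooth_on_diff smooth_on_add smooth_on_dd metric_smooth S)

lemma metric_christoffel: "x \<in> S \<Longrightarrow> G x (christoffel G x u v) w = koszul u v x w"
  unfolding christoffel_eq_riesz by (rule riesz[OF metric_inner_form linear_koszul])

lemma smooth_christoffel: "smooth_on S (\<lambda>x. christoffel G x u v)"
  unfolding christoffel_eq_riesz by (rule smooth_on_riesz[OF S G smooth_koszul linear_koszul])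

lemma metric_dd_christoffel:
  "x \<in> S \<Longrightarrow> G x (dd a (\<lambda>y. christoffel G y u v) x) w
    = dd a (\<lambda>y. koszul u v y w) x - dd a (\<lambda>y. G y (christoffel G x u v) w) x"
  unfolding christoffel_eq_riesz by (rule dd_riesz[OF S _ G smooth_koszul linear_koszul])

lemma christoffel_sym: "x \<in> S \<Longrightarrow> christoffel G x u v = christoffel G x v u"
  by (rule metric_nondegenerate) (auto simp: metric_christoffel koszul_def dd_metric_sym[of x _ u v])

lemma bilinear_christoffel:
  assumes x: "x \<in> S"
  shows "bilinear (christoffel G x)"
proof -
  note b = dd_metric_bilinear[OF x] and bG = metric_bilinear[OF x]
  have l: "linear (\<lambda>u. dd u (\<lambda>y. G y v w) x)" for v w
    by (rule linear_dd[OF smooth_onD_differentiable[OF metric_smooth x]])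
  have "christoffel G x u (a + b') = christoffel G x u a + christoffel G x u b'" for u a b'
    by (rule metric_nondegenerate[OF x])
      (simp add: metric_christoffel[OF x] koszul_def bilinear_ladd[OF bG] bilinear_radd[OF b] bilinear_ladd[OF b]
        linear_add[OF l] add_divide_distrib diff_divide_distrib)
  moreover have "christoffel G x u (r *\<^sub>R a) = r *\<^sub>R christoffel G x u a" for u a r
    by (rule metric_nondegenerate[OF x])
      (simp add: metric_christoffel[OF x] koszul_def bilinear_lmul[OF bG] bilinear_rmul[OF b] bilinear_lmul[OF b]
        linear_scale[OF l] algebra_simps)
  ultimately show ?thesis
    unfolding bilinear_def linear_iff by (metis christoffel_sym[OF x])
qed

lemma metric_compatible:
  assumes "x \<in> S"
  shows "dd u (\<lambda>y. G y v w) x = G x (christoffel G x u v) w + G x v (christoffel G x u w)"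
  using assms dd_metric_sym[OF assms, of u w v]
  by (simp add: metric_sym[of x v] metric_christoffel koszul_def field_simps)

section \<open>Gradient, Hessian and Laplacian\<close>

lemma gradient_eq_riesz: "gradient G h x = riesz (G x) (\<lambda>w. dd w h x)"
  by (simp add: gradient_def sharp_eq_riesz dd_def)

lemma metric_gradient: "x \<in> S \<Longrightarrow> smooth_on S h \<Longrightarrow> G x (gradient G h x) w = dd w h x"
  unfolding gradient_eq_riesz by (rule riesz[OF metric_inner_form linear_dd[OF smooth_onD_differentiable]])

text \<open>Differentiating the metric in the equation for the gradient gives two Christoffel terms
  by compatibility. One cancels the Christoffel term of the connection, the other is the first-order
  term of the result.\<close>

lemma metric_hessian:
  assumes x: "x \<in> S" and h: "smooth_on S h"
  shows "G x (hessian G h x v) w = dd v (dd w h) x - dd (christoffel G x v w) h x"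
proof -
  have grad: "gradient G h = (\<lambda>x. riesz (G x) (\<lambda>w. dd w h x))"
    by (rule ext) (rule gradient_eq_riesz)
  have "G x (dd v (gradient G h) x) w = dd v (dd w h) x - dd v (\<lambda>y. G y (gradient G h x) w) x"
    unfolding grad
    by (rule dd_riesz[OF S x G smooth_on_dd[OF h] linear_dd[OF smooth_onD_differentiable[OF h]]])
  also have "dd v (\<lambda>y. G y (gradient G h x) w) x
      = G x (christoffel G x v (gradient G h x)) w + dd (christoffel G x v w) h x"
    unfolding metric_compatible[OF x] by (simp add: metric_gradient[OF x h])
  finally show ?thesis
    by (simp add: hessian_def nabla_def dd_def[symmetric] bilinear_ladd[OF metric_bilinear[OF x]])
qed

lemma laplace_beltrami_eq_trace:
  assumes x: "x \<in> S" and h: "smooth_on S h"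
  shows "laplace_beltrami G h x = trace_form (G x) (\<lambda>u w. dd u (dd w h) x - dd (christoffel G x u w) h x)"
proof -
  have "hessian G h x u = riesz (G x) (\<lambda>w. dd u (dd w h) x - dd (christoffel G x u w) h x)" for u
    by (rule riesz_unique[OF metric_inner_form[OF x], symmetric]) (rule metric_hessian[OF x h])
  then show ?thesis by (simp add: laplace_beltrami_def divergence_def trace_form_def hessian_def)
qed

text \<open>The derivative of \<open>1 / h\<close> adds to the Hessian a multiple of the rank-one
  form \<open>dd u h x * dd w h x\<close>, whose trace is the squared gradient.\<close>

lemma laplace_beltrami_ln:
  assumes x: "x \<in> S" and h: "smooth_on S h" and pos: "\<And>y. y \<in> S \<Longrightarrow> h y > 0"
  shows "laplace_beltrami G (\<lambda>y. ln (h y)) x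
    = laplace_beltrami G h x / h x - G x (gradient G h x) (gradient G h x) / (h x)\<^sup>2"
proof -
  have d: "h differentiable (at y)" "dd w h differentiable (at y)" if "y \<in> S" for y w
    using that h smooth_onD_differentiable smooth_on_dd by blast+
  have 1: "dd w (\<lambda>y. ln (h y)) y = dd w h y * inverse (h y)" if "y \<in> S" for w y
    by (rule dd_eqI[OF has_derivative_ln[OF pos[OF that] has_derivative_dd[OF d(1)[OF that]]]])
  have inv: "((\<lambda>y. inverse (h y)) has_derivative (\<lambda>v. - (inverse (h x) * dd v h x * inverse (h x)))) (at x)"
    using pos[OF x] by (intro Deriv.has_derivative_inverse has_derivative_dd d x) auto
  have 2: "dd u (dd w (\<lambda>y. ln (h y))) x
      = dd u (dd w h) x * inverse (h x) - dd u h x * dd w h x * (inverse (h x))\<^sup>2" for u w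
  proof -
    have "dd u (dd w (\<lambda>y. ln (h y))) x = dd u (\<lambda>y. dd w h y * inverse (h y)) x"
      by (rule dd_cong[OF S x 1])
    also have "\<dots> = dd w h x * - (inverse (h x) * dd u h x * inverse (h x)) + dd u (dd w h) x * inverse (h x)"
      by (rule dd_eqI[OF has_derivative_mult[OF has_derivative_dd[OF d(2)[OF x]] inv]])
    finally show ?thesis by (simp add: power2_eq_square algebra_simps)
  qed
  let ?H = "\<lambda>u w. dd u (dd w h) x - dd (christoffel G x u w) h x"
  have ld: "linear (\<lambda>w. dd w h x)" by (rule linear_dd[OF d(1)[OF x]])
  have lc: "linear (\<lambda>w. dd w h x * c)" for c using ld by (auto simp: linear_iff algebra_simps)
  have ip: "inner_form (G x)" by (rule metric_inner_form[OF x])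
  have bH: "bilinear ?H"
    by (intro bilinear_diff bilinear_second_dd[OF S x h] bilinear_linear_compose[OF ld bilinear_christoffel[OF x]])
  note bH' = bilinear_cmult[OF bH, of "inverse (h x)"]
  have bR: "bilinear (\<lambda>u w. dd u h x * (dd w h x * - (inverse (h x))\<^sup>2))"
    by (rule bilinear_rank_one[OF ld lc])
  have "laplace_beltrami G (\<lambda>y. ln (h y)) x
      = trace_form (G x) (\<lambda>u w. inverse (h x) * ?H u w + dd u h x * (dd w h x * - (inverse (h x))\<^sup>2))"
    by (simp add: laplace_beltrami_eq_trace[OF x smooth_on_ln[OF S h pos]] 2 1[OF x] algebra_simps)
  also have "\<dots> = inverse (h x) * laplace_beltrami G h x
      + dd (riesz (G x) (\<lambda>w. dd w h x * - (inverse (h x))\<^sup>2)) h x"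
    unfolding trace_form_add[OF ip bH' bR] trace_form_cmult[OF ip bH] trace_form_rank_one[OF ip ld lc]
      laplace_beltrami_eq_trace[OF x h] ..
  also have "riesz (G x) (\<lambda>w. dd w h x * - (inverse (h x))\<^sup>2) = (- (inverse (h x))\<^sup>2) *\<^sub>R gradient G h x"
    unfolding gradient_eq_riesz riesz_cmult[OF ip ld, symmetric] by (simp add: mult.commute)
  also have "dd \<dots> h x = - (inverse (h x))\<^sup>2 * G x (gradient G h x) (gradient G h x)"
    unfolding linear_scale[OF ld] by (simp add: metric_gradient[OF x h])
  finally show ?thesis by (simp add: divide_inverse power_inverse mult.commute)
qed

lemma laplace_beltrami_add_cmult:
  assumes x: "x \<in> S" and h: "smooth_on S h" and h': "smooth_on S h'"
  shows "laplace_beltrami G (\<lambda>y. h y + c * h' y) x = laplace_beltrami G h x + c * laplace_beltrami G h' x"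
proof -
  have ch: "smooth_on S (\<lambda>y. c * h' y)" by (rule smooth_on_linear_compose[OF S bounded_linear_mult_right h'])
  note d = smooth_onD_differentiable
  have 1: "dd w (\<lambda>y. h y + c * h' y) y = dd w h y + c * dd w h' y" if "y \<in> S" for w y
    using dd_add[OF d[OF h that] d[OF ch that]] dd_cmult[OF d[OF h' that]] by simp
  have 2: "dd u (dd w (\<lambda>y. h y + c * h' y)) x = dd u (dd w h) x + c * dd u (dd w h') x" for u w
  proof -
    have "dd u (dd w (\<lambda>y. h y + c * h' y)) x = dd u (\<lambda>y. dd w h y + c * dd w h' y) x"
      by (rule dd_cong[OF S x 1])
    also have "\<dots> = dd u (dd w h) x + c * dd u (dd w h') x"
      using dd_add[OF d[OF smooth_on_dd[OF h] x]
          d[OF smooth_on_linear_compose[OF S bounded_linear_mult_right smooth_on_dd[OF h']] x]]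
        dd_cmult[OF d[OF smooth_on_dd[OF h'] x]] by simp
    finally show ?thesis .
  qed
  have bH: "bilinear (\<lambda>u w. dd u (dd w h) x - dd (christoffel G x u w) h x)"
    if "smooth_on S h" for h :: "'e \<Rightarrow> real"
    by (intro bilinear_diff bilinear_second_dd[OF S x that]
        bilinear_linear_compose[OF linear_dd[OF d[OF that x]] bilinear_christoffel[OF x]])
  note bH' = bilinear_cmult[OF bH[OF h'], of c]
  have "laplace_beltrami G (\<lambda>y. h y + c * h' y) x
      = trace_form (G x) (\<lambda>u w. (dd u (dd w h) x - dd (christoffel G x u w) h x)
          + c * (dd u (dd w h') x - dd (christoffel G x u w) h' x))"
    unfolding laplace_beltrami_eq_trace[OF x smooth_on_add[OF S h ch]] 2 1[OF x]
    by (rule arg_cong[where f = "trace_form _"]) (simp add: fun_eq_iff algebra_simps)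
  also have "\<dots> = laplace_beltrami G h x + c * laplace_beltrami G h' x"
    unfolding trace_form_add[OF metric_inner_form[OF x] bH[OF h] bH']
      trace_form_cmult[OF metric_inner_form[OF x] bH[OF h']]
      laplace_beltrami_eq_trace[OF x h] laplace_beltrami_eq_trace[OF x h'] ..
  finally show ?thesis .
qed

end

section \<open>Kaehler metrics in holomorphic coordinates\<close>

lemma J_add: "J (u + v) = J u + J v" and J_scaleR: "J (r *\<^sub>R v) = r *\<^sub>R J v"
  and J_J: "J (J v) = - v" and J_minus: "J (- v) = - J v"
  for u v :: "complex ^ 'n::finite"
  by (auto simp: J_def vec_eq_iff algebra_simps)

lemma linear_J: "linear J"
  by (rule linearI) (simp_all add: J_add J_scaleR)

lemma bounded_linear_J: "bounded_linear (J :: complex ^ 'n::finite \<Rightarrow> _)"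
  using linear_J by (rule linear_conv_bounded_linear[THEN iffD1])

lemma bij_J: "bij (J :: complex ^ 'n::finite \<Rightarrow> _)"
  by (rule bij_betw_byWitness[where f' = "\<lambda>v. - J v"]) (auto simp: J_J J_minus)

text \<open>Four times the real part of the complex Hessian, the sum of the mixed derivatives of
  \<open>h\<close> in z_i and conjugate z_j against u_i and conjugate w_j. The codomain is left
  general because vector-valued Riesz representatives are also differentiated in this way.\<close>

definition levi :: "(complex ^ 'n::finite \<Rightarrow> 'b::real_normed_vector) \<Rightarrow> complex ^ 'n \<Rightarrow> complex ^ 'n \<Rightarrow> complex ^ 'n \<Rightarrow> 'b"
  where "levi h x u w = dd u (dd w h) x + dd (J u) (dd (J w) h) x"

lemma bilinear_levi:
  fixes h :: "complex ^ 'n::finite \<Rightarrow> real"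
  assumes "open S" "x \<in> S" "smooth_on S h"
  shows "bilinear (levi h x)"
  unfolding levi_def
  using bilinear_second_dd[OF assms] bilinear_compose[OF bilinear_second_dd[OF assms] linear_J] by (rule bilinear_add)

lemma levi_sym:
  fixes h :: "complex ^ 'n::finite \<Rightarrow> real"
  assumes "open S" "x \<in> S" "smooth_on S h"
  shows "levi h x u w = levi h x w u"
  unfolding levi_def using dd_commute[OF assms, of u w] dd_commute[OF assms, of "J u" "J w"] by simp

context
  fixes S :: "(complex ^ 'n::finite) set" and G :: "(complex ^ 'n) metric_field"
  assumes S: "open S" and K: "kaehler_metric_on S G"
begin

lemma kaehler_riemannian: "riemannian_metric_on S G"
  using K by (simp add: kaehler_metric_on_def)

lemma metric_J: "x \<in> S \<Longrightarrow> G x (J u) (J v) = G x u v"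
  using K by (simp add: kaehler_metric_on_def)

lemma metric_J_left: "x \<in> S \<Longrightarrow> G x (J u) v = - G x u (J v)"
  using metric_J[of x u "- J v"] bilinear_rneg[OF metric_bilinear[OF S kaehler_riemannian]]
  by (simp add: J_minus J_J)

lemma metric_v_Jv: "x \<in> S \<Longrightarrow> G x v (J v) = 0"
  using metric_J_left[of x v v] metric_sym[OF S kaehler_riemannian, of x v "J v"] by simp

lemma dd_metric_J_left: "x \<in> S \<Longrightarrow> dd a (\<lambda>y. G y (J u) v) x = - dd a (\<lambda>y. G y u (J v)) x"
  unfolding dd_minus[OF smooth_onD_differentiable[OF metric_smooth[OF S kaehler_riemannian]], symmetric]
  by (rule dd_cong[OF S _ metric_J_left])

lemma kaehler_form_closed:
  assumes "x \<in> S"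
  shows "dd u (\<lambda>y. G y (J v) w) x - dd v (\<lambda>y. G y (J u) w) x + dd w (\<lambda>y. G y (J u) v) x = 0"
proof -
  have "d_form (kaehler_form G) x u v w = 0" using K assms by (simp add: kaehler_metric_on_def)
  then show ?thesis by (simp add: d_form_def kaehler_form_def dd_def)
qed

lemma dd_metric_minus_left: "x \<in> S \<Longrightarrow> dd a (\<lambda>y. G y (- u) v) x = - dd a (\<lambda>y. G y u v) x"
  using bilinear_lneg[OF dd_metric_bilinear[OF S kaehler_riemannian]] by blast

lemma dd_metric_minus_right: "x \<in> S \<Longrightarrow> dd a (\<lambda>y. G y u (- v)) x = - dd a (\<lambda>y. G y u v) x"
  using bilinear_rneg[OF dd_metric_bilinear[OF S kaehler_riemannian]] by blast

text \<open>Closedness of the Kaehler form on \<open>J u\<close>, \<open>v\<close>, \<open>w\<close>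
  replaces the last two terms of Koszul's formula by a single derivative in direction
  \<open>J u\<close>.\<close>

lemma kaehler_christoffel:
  assumes x: "x \<in> S"
  shows "2 * G x (christoffel G x u v) w = dd u (\<lambda>y. G y v w) x + dd (J u) (\<lambda>y. G y v (J w)) x"
  using kaehler_form_closed[OF x, of "J u" v w]
  by (simp add: metric_christoffel[OF S kaehler_riemannian x] koszul_def[OF S kaehler_riemannian] J_J dd_metric_minus_left[OF x] dd_metric_J_left[OF x])

text \<open>Parallelism of \<open>J\<close>, in coordinates where \<open>J\<close> is constant. In
  \<open>kaehler_christoffel\<close>, replacing \<open>v\<close> by \<open>J v\<close> has the same
  effect as replacing \<open>w\<close> by \<open>- J w\<close>.\<close>

lemma christoffel_J_right:
  assumes x: "x \<in> S"
  shows "christoffel G x u (J v) = J (christoffel G x u v)"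
proof (rule metric_nondegenerate[OF S kaehler_riemannian x])
  fix w
  have "2 * G x (christoffel G x u (J v)) w = - 2 * G x (christoffel G x u v) (J w)"
    unfolding mult_minus_left kaehler_christoffel[OF x]
    by (simp add: dd_metric_J_left[OF x] J_J dd_metric_minus_right[OF x])
  then show "G x (christoffel G x u (J v)) w = G x (J (christoffel G x u v)) w"
    by (simp add: metric_J_left[OF x])
qed

lemma christoffel_J_left: "x \<in> S \<Longrightarrow> christoffel G x (J u) v = J (christoffel G x u v)"
  using christoffel_J_right[of x v u] christoffel_sym[OF S kaehler_riemannian] by metis

text \<open>The adjoint moves \<open>J\<close> to the second slot, and the Christoffel terms cancel
  because the Christoffel form changes sign when both arguments are multiplied by
  \<open>J\<close>.\<close>

lemma metric_hessian_J:
  assumes x: "x \<in> S" and h: "smooth_on S h"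
  shows "G x (hessian G h x v + adjoint_at G x J (hessian G h x (J v))) v = levi h x v v"
proof -
  note bG = metric_bilinear[OF S kaehler_riemannian x]
  have lin: "linear (\<lambda>w. G x (hessian G h x (J v)) (J w))"
    using linear_compose[OF linear_J bilinear_linear(1)[OF bG]] by (simp add: o_def)
  have "G x (adjoint_at G x J (hessian G h x (J v))) v = G x (hessian G h x (J v)) (J v)"
    unfolding adjoint_at_def sharp_eq_riesz by (rule riesz[OF metric_inner_form[OF S kaehler_riemannian x] lin])
  moreover have "dd (christoffel G x (J v) (J v)) h x = - dd (christoffel G x v v) h x"
    using linear_neg[OF linear_dd[OF smooth_onD_differentiable[OF h x]]]
    by (simp add: christoffel_J_right[OF x] christoffel_J_left[OF x] J_J)
  ultimately show ?thesis
    by (simp add: bilinear_ladd[OF bG] metric_hessian[OF S kaehler_riemannian x h] levi_def)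
qed

text \<open>\<open>J\<close> is an isometry, so the Hessian and its pullback under \<open>J\<close>
  have the same trace, and their sum is the Levi form.\<close>

lemma laplace_beltrami_eq_trace_levi:
  assumes x: "x \<in> S" and h: "smooth_on S h"
  shows "laplace_beltrami G h x = 1/2 * trace_form (G x) (levi h x)"
proof -
  let ?H = "\<lambda>u w. dd u (dd w h) x - dd (christoffel G x u w) h x"
  have ip: "inner_form (G x)" by (rule metric_inner_form[OF S kaehler_riemannian x])
  have bH: "bilinear ?H"
    by (intro bilinear_diff bilinear_second_dd[OF S x h]
        bilinear_linear_compose[OF linear_dd[OF smooth_onD_differentiable[OF h x]] bilinear_christoffel[OF S kaehler_riemannian x]])
  then have bH': "bilinear (\<lambda>u w. ?H (J u) (J w))"
    by (rule bilinear_compose[OF _ linear_J])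
  have "G x = (\<lambda>u w. G x (J u) (J w))" using metric_J[OF x] by (simp add: fun_eq_iff)
  then have "trace_form (G x) (\<lambda>u w. ?H (J u) (J w)) = trace_form (G x) ?H"
    using trace_form_pullback[OF ip linear_J bij_J bH] by simp
  then have "2 * trace_form (G x) ?H = trace_form (G x) (\<lambda>u w. ?H u w + ?H (J u) (J w))"
    using trace_form_add[OF ip bH bH'] by simp
  also have "(\<lambda>u w. ?H u w + ?H (J u) (J w)) = levi h x"
    using linear_neg[OF linear_dd[OF smooth_onD_differentiable[OF h x]]]
    by (simp add: fun_eq_iff levi_def christoffel_J_right[OF x] christoffel_J_left[OF x] J_J)
  finally show ?thesis by (simp add: laplace_beltrami_eq_trace[OF S kaehler_riemannian x h])
qed

text \<open>The two sides are twice the pairings of \<open>w\<close> with the Christoffel vectors of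
  \<open>u\<close>, \<open>v\<close> and of \<open>v\<close>, \<open>u\<close>, which
  coincide.\<close>

lemma dd_metric_exchange:
  assumes x: "x \<in> S"
  shows "dd u (\<lambda>y. G y v w) x + dd (J u) (\<lambda>y. G y v (J w)) x
       = dd v (\<lambda>y. G y u w) x + dd (J v) (\<lambda>y. G y u (J w)) x"
  using kaehler_christoffel[OF x, of u v w] kaehler_christoffel[OF x, of v u w] christoffel_sym[OF S kaehler_riemannian x, of u v]
  by simp

lemma dd_dd_metric_v_Jv:
  assumes x: "x \<in> S"
  shows "dd p (dd a (\<lambda>y. G y v (J v))) x = 0"
proof -
  have "dd a (\<lambda>y. G y v (J v)) y = 0" if "y \<in> S" for y
  proof -
    have "dd a (\<lambda>y. G y v (J v)) y = dd a (\<lambda>y. 0) y" by (intro dd_cong[OF S that] metric_v_Jv)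
    then show ?thesis by (simp add: dd_const)
  qed
  then have "dd p (dd a (\<lambda>y. G y v (J v))) x = dd p (\<lambda>y. 0) x" by (rule dd_cong[OF S x])
  then show ?thesis by (simp add: dd_const)
qed

text \<open>This symmetry is the infinitesimal form of the existence of a Kaehler potential.\<close>

lemma levi_metric_exchange:
  assumes x: "x \<in> S"
  shows "levi (\<lambda>y. G y v v) x w w = levi (\<lambda>y. G y w w) x v v"
proof -
  note sm = metric_smooth[OF S kaehler_riemannian]
  note comm = dd_commute[OF S x sm]
  have d: "(\<lambda>y. dd a (\<lambda>z. G z b c) y) differentiable (at x)" for a b c
    using smooth_onD_differentiable[OF smooth_on_dd[OF sm] x] .
  have two: "dd p (\<lambda>y. dd a (\<lambda>z. G z b c) y) x + dd p (\<lambda>y. dd a' (\<lambda>z. G z b' c') y) x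
      = dd p (\<lambda>y. dd e (\<lambda>z. G z f g) y) x + dd p (\<lambda>y. dd e' (\<lambda>z. G z f' g') y) x"
    if "\<And>y. y \<in> S \<Longrightarrow> dd a (\<lambda>z. G z b c) y + dd a' (\<lambda>z. G z b' c') y = dd e (\<lambda>z. G z f g) y + dd e' (\<lambda>z. G z f' g') y"
    for p a b c a' b' c' e f g e' f' g'
    unfolding dd_add[OF d d, symmetric] by (rule dd_cong[OF S x that])
  have symm: "dd p (dd a (\<lambda>z. G z b c)) x = dd p (dd a (\<lambda>z. G z c b)) x" for p a b c
    by (rule dd_cong[OF S x]) (rule dd_metric_sym[OF S kaehler_riemannian])
  \<comment> \<open>The exchange rule turns each pure second derivative into mixed ones; the extra
    term differentiates \<open>G y v (J v)\<close> or \<open>G y w (J w)\<close>, which vanishes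
    identically. Both sides then consist of the same four mixed derivatives, up to their order and
    the symmetry of the metric.\<close>
  have 1: "dd w (dd w (\<lambda>y. G y v v)) x = dd w (dd v (\<lambda>y. G y w v)) x + dd w (dd (J v) (\<lambda>y. G y w (J v))) x"
    using two[of w v v "J w" v "J v" v w v "J v" w "J v" w] dd_metric_exchange[of _ w v v] dd_dd_metric_v_Jv[OF x] by simp
  have 2: "dd (J w) (dd (J w) (\<lambda>y. G y v v)) x
      = dd (J w) (dd v (\<lambda>y. G y (J w) v)) x + dd (J w) (dd (J v) (\<lambda>y. G y (J w) (J v))) x"
    using two[of "J w" v v "J (J w)" v "J v" v "J w" v "J v" "J w" "J v" "J w"]
      dd_metric_exchange[of _ "J w" v v] dd_dd_metric_v_Jv[OF x] by simp
  have 3: "dd v (dd v (\<lambda>y. G y w w)) x = dd v (dd w (\<lambda>y. G y v w)) x + dd v (dd (J w) (\<lambda>y. G y v (J w))) x"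
    using two[of v w w "J v" w "J w" w v w "J w" v "J w" v] dd_metric_exchange[of _ v w w] dd_dd_metric_v_Jv[OF x] by simp
  have 4: "dd (J v) (dd (J v) (\<lambda>y. G y w w)) x
      = dd (J v) (dd w (\<lambda>y. G y (J v) w)) x + dd (J v) (dd (J w) (\<lambda>y. G y (J v) (J w))) x"
    using two[of "J v" w w "J (J v)" w "J w" w "J v" w "J w" "J v" "J w" "J v"]
      dd_metric_exchange[of _ "J v" w w] dd_dd_metric_v_Jv[OF x] by simp
  show ?thesis
    unfolding levi_def 1 2 3 4
    using comm[of w v w v] comm[of w "J v" w "J v"] comm[of "J w" v "J w" v] comm[of "J w" "J v" "J w" "J v"]
      symm[of _ _ w v] symm[of _ _ w "J v"] symm[of _ _ "J w" v] symm[of _ _ "J w" "J v"]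
    by simp
qed

text \<open>The real form of the classical expression for Kaehler curvature: minus the complex
  Hessian of the metric plus a term quadratic in its first derivatives.\<close>

lemma bisectional_curvature_eq:
  assumes x: "x \<in> S"
  shows "G x (Rm G x v w w) v + G x (Rm G x v (J w) (J w)) v
    = 2 * G x (christoffel G x w v) (christoffel G x w v) - 1/2 * levi (\<lambda>y. G y v v) x w w"
proof -
  let ?C = "\<lambda>u v y. christoffel G y u v"
  note bG = metric_bilinear[OF S kaehler_riemannian x] and bC = bilinear_christoffel[OF S kaehler_riemannian x]
  note sm = metric_smooth[OF S kaehler_riemannian]
  have dC: "?C a b differentiable (at x)" for a b
    by (rule smooth_onD_differentiable[OF smooth_christoffel[OF S kaehler_riemannian] x])
  have C0: "christoffel G x 0 b = 0" for b by (rule bilinear_lzero[OF bC])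
  have nab: "nabla G (\<lambda>_. a) (\<lambda>_. b) = ?C a b" for a b
    by (simp add: nabla_def fun_eq_iff)
  have Rm: "Rm G x a b c = dd a (?C b c) x + christoffel G x a (christoffel G x b c)
      - (dd b (?C a c) x + christoffel G x b (christoffel G x a c))" for a b c
    by (simp add: Rm_def riemann_def nab) (simp add: nabla_def lie_bracket_def dd_def C0)
  have CJ: "dd a (?C b (J c)) x = J (dd a (?C b c) x)" for a b c
    unfolding dd_linear_compose[OF bounded_linear_J dC, symmetric]
    by (rule dd_cong[OF S x]) (rule christoffel_J_right)
  have CJ': "dd a (?C (J b) c) x = J (dd a (?C b c) x)" for a b c
    unfolding dd_linear_compose[OF bounded_linear_J dC, symmetric]
    by (rule dd_cong[OF S x]) (rule christoffel_J_left)
  \<comment> \<open>Between \<open>w\<close> and \<open>J w\<close> the products of Christoffel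
    vectors and the derivatives in direction \<open>v\<close> cancel by complex bilinearity.\<close>
  have sum: "Rm G x v w w + Rm G x v (J w) (J w) = - (dd w (?C w v) x + J (dd (J w) (?C w v) x))"
  proof -
    have "?C v w y = ?C w v y" if "y \<in> S" for y using christoffel_sym[OF S kaehler_riemannian that] .
    then have "dd a (?C v w) x = dd a (?C w v) x" for a by (rule dd_cong[OF S x])
    then show ?thesis
      by (simp add: Rm CJ CJ' christoffel_J_right[OF x] christoffel_J_left[OF x] J_J J_minus
          bilinear_rneg[OF bC])
  qed
  let ?c = "christoffel G x w v"
  have eq: "2 * G x (dd a (?C w v) x) z = dd a (dd w (\<lambda>y. G y v z)) x + dd a (dd (J w) (\<lambda>y. G y v (J z))) x
      - 2 * dd a (\<lambda>y. G y ?c z) x" for a z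
  proof -
    have ds: "(\<lambda>y. dd w (\<lambda>y. G y v z) y) differentiable (at x)" "(\<lambda>y. dd (J w) (\<lambda>y. G y v (J z)) y) differentiable (at x)"
      using smooth_onD_differentiable[OF smooth_on_dd[OF sm] x] by auto
    have "dd a (\<lambda>y. 2 * koszul G w v y z) x = dd a (\<lambda>y. dd w (\<lambda>y. G y v z) y + dd (J w) (\<lambda>y. G y v (J z)) y) x"
      by (rule dd_cong[OF S x]) (simp add: kaehler_christoffel metric_christoffel[OF S kaehler_riemannian, symmetric])
    also have "\<dots> = dd a (dd w (\<lambda>y. G y v z)) x + dd a (dd (J w) (\<lambda>y. G y v (J z))) x"
      using dd_add[OF ds] by simp
    finally have "2 * dd a (\<lambda>y. koszul G w v y z) x = \<dots>"
      using dd_cmult[OF smooth_onD_differentiable[OF smooth_koszul[OF S kaehler_riemannian] x], of a 2] by simp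
    then show ?thesis using metric_dd_christoffel[OF S kaehler_riemannian x, of a w v z] by simp
  qed
  have neg: "dd p (dd a (\<lambda>y. G y v (- v))) x = - dd p (dd a (\<lambda>y. G y v v)) x" for p a
  proof -
    have "dd p (dd a (\<lambda>y. G y v (- v))) x = dd p (\<lambda>y. - dd a (\<lambda>y. G y v v) y) x"
      by (rule dd_cong[OF S x]) (rule dd_metric_minus_right)
    then show ?thesis using dd_minus[OF smooth_onD_differentiable[OF smooth_on_dd[OF sm] x]] by simp
  qed
  have "2 * (G x (Rm G x v w w) v + G x (Rm G x v (J w) (J w)) v)
      = - 2 * G x (dd w (?C w v) x) v + 2 * G x (dd (J w) (?C w v) x) (J v)"
    unfolding bilinear_ladd[OF bG, symmetric] sum
    by (simp add: bilinear_lneg[OF bG] bilinear_ladd[OF bG] bilinear_lsub[OF bG] metric_J_left[OF x])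
  also have "\<dots> = 2 * (dd w (\<lambda>y. G y v ?c) x + dd (J w) (\<lambda>y. G y v (J ?c)) x) - levi (\<lambda>y. G y v v) x w w"
    using eq[of w v] eq[of "J w" "J v"] dd_dd_metric_v_Jv[OF x] neg dd_metric_sym[OF S kaehler_riemannian x, of w v ?c]
      dd_metric_sym[OF S kaehler_riemannian x, of "J w" v "J ?c"] dd_metric_J_left[OF x, of "J w" ?c v]
    by (simp add: levi_def J_J)
  \<comment> \<open>The quadratic term reappears here: it comes from differentiating the metric in
    the equation that defines the Christoffel vector.\<close>
  also have "\<dots> = 2 * (2 * G x ?c ?c) - levi (\<lambda>y. G y v v) x w w"
    using kaehler_christoffel[OF x, of w v ?c] by simp
  finally show ?thesis by simp
qed

end

section \<open>Holomorphic changes of coordinates\<close>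

lemma dd_dd_compose:
  fixes F :: "'a::euclidean_space \<Rightarrow> 'b::euclidean_space" and h :: "'b \<Rightarrow> real"
  assumes S: "open S" and S': "open S'" "x \<in> S'" and F: "smooth_on S' F" "F ` S' \<subseteq> S" and h: "smooth_on S h"
  shows "dd u (dd w (\<lambda>y. h (F y))) x
    = dd (dd u F x) (dd (dd w F x) h) (F x) + dd (dd u (dd w F) x) h (F x)"
proof -
  note d = smooth_onD_differentiable
  have FS: "F y \<in> S" if "y \<in> S'" for y using F that by blast
  have hF: "smooth_on S' (\<lambda>y. k (F y))" if "smooth_on S k" for k :: "'b \<Rightarrow> real"
    by (rule smooth_on_compose[OF S S'(1) F(2,1) that])
  have 1: "dd w (\<lambda>y. h (F y)) y = (\<Sum>b\<in>Basis. (dd w F y \<bullet> b) * dd b h (F y))" if "y \<in> S'" for y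
    using dd_compose[OF d[OF F(1) that] d[OF h FS[OF that]]] dd_Basis_expansion[OF d[OF h FS[OF that]], of "dd w F y"]
    by simp
  have dF: "(\<lambda>y. dd w F y \<bullet> b) differentiable (at x)" for b
    by (rule d[OF smooth_on_linear_compose[OF S'(1) bounded_linear_inner_left smooth_on_dd[OF F(1)]] S'(2)])
  have dh: "(\<lambda>y. dd b h (F y)) differentiable (at x)" for b
    by (rule d[OF hF[OF smooth_on_dd[OF h]] S'(2)])
  have "dd u (dd w (\<lambda>y. h (F y))) x = dd u (\<lambda>y. \<Sum>b\<in>Basis. (dd w F y \<bullet> b) * dd b h (F y)) x"
    by (rule dd_cong[OF S' 1])
  also have "\<dots> = (\<Sum>b\<in>Basis. dd u (\<lambda>y. (dd w F y \<bullet> b) * dd b h (F y)) x)"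
    by (intro dd_sum differentiable_mult dF dh)
  also have "\<dots> = (\<Sum>b\<in>Basis. (dd w F x \<bullet> b) * dd u (\<lambda>y. dd b h (F y)) x
      + (dd u (dd w F) x \<bullet> b) * dd b h (F x))"
    using dd_mult[OF dF dh] dd_linear_compose[OF bounded_linear_inner_left d[OF smooth_on_dd[OF F(1)] S'(2)]]
    by simp
  also have "\<dots> = (\<Sum>b\<in>Basis. (dd w F x \<bullet> b) * dd (dd u F x) (dd b h) (F x))
      + (\<Sum>b\<in>Basis. (dd u (dd w F) x \<bullet> b) * dd b h (F x))"
    using dd_compose[OF d[OF F(1) S'(2)] d[OF smooth_on_dd[OF h] FS[OF S'(2)]]]
    by (simp add: sum.distrib)
  also have "(\<Sum>b\<in>Basis. (dd w F x \<bullet> b) * dd (dd u F x) (dd b h) (F x)) = dd (dd u F x) (dd (dd w F x) h) (F x)"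
    by (rule form_Basis_expansion[OF bilinear_linear(1)[OF bilinear_second_dd[OF S FS[OF S'(2)] h]]])
  also have "(\<Sum>b\<in>Basis. (dd u (dd w F) x \<bullet> b) * dd b h (F x)) = dd (dd u (dd w F) x) h (F x)"
    by (rule form_Basis_expansion[OF linear_dd[OF d[OF h FS[OF S'(2)]]]])
  finally show ?thesis .
qed

lemma holomorphic_map_dd_J: "holomorphic_map_on S F \<Longrightarrow> x \<in> S \<Longrightarrow> dd (J v) F x = J (dd v F x)"
  by (simp add: holomorphic_map_on_def dd_def)

text \<open>The chain rule adds only second derivatives of \<open>F\<close>. Those along
  \<open>J u\<close>, \<open>J w\<close> are the negatives of those along \<open>u\<close>,
  \<open>w\<close>, since each \<open>J\<close> can be pulled out after commuting the
  derivatives.\<close>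

lemma levi_compose:
  fixes h :: "complex ^ 'n::finite \<Rightarrow> real"
  assumes S: "open S" and S': "open S'" "x \<in> S'" and F: "holomorphic_map_on S' F" "F ` S' \<subseteq> S"
    and h: "smooth_on S h"
  shows "levi (\<lambda>y. h (F y)) x u w = levi h (F x) (dd u F x) (dd w F x)"
proof -
  have sF: "smooth_on S' F" using F by (simp add: holomorphic_map_on_def)
  have FS: "F x \<in> S" using F S' by blast
  have J1: "dd a (dd (J b) F) x = J (dd a (dd b F) x)" for a b
    unfolding dd_linear_compose[OF bounded_linear_J smooth_onD_differentiable[OF smooth_on_dd[OF sF] S'(2)], symmetric]
    by (rule dd_cong[OF S']) (rule holomorphic_map_dd_J[OF F(1)])
  have "dd (J u) (dd (J w) F) x = J (dd w (dd (J u) F) x)"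
    unfolding J1 dd_commute[OF S' sF, of "J u" w] ..
  also have "\<dots> = - dd u (dd w F) x"
    unfolding J1 J_J dd_commute[OF S' sF, of w u] ..
  finally have "dd (J u) (dd (J w) F) x = - dd u (dd w F) x" .
  then show ?thesis
    using dd_dd_compose[OF S S' sF F(2) h] linear_neg[OF linear_dd[OF smooth_onD_differentiable[OF h FS]]]
    by (simp add: levi_def holomorphic_map_dd_J[OF F(1) S'(2)])
qed

lemma trace_levi_compose:
  fixes h :: "complex ^ 'n::finite \<Rightarrow> real"
  assumes "open S" "open S'" "x \<in> S'" "holomorphic_map_on S' F" "F ` S' \<subseteq> S" "smooth_on S h"
    and B: "inner_form B" and bij: "bij (\<lambda>v. dd v F x)"
  shows "trace_form (\<lambda>u w. B (dd u F x) (dd w F x)) (levi (\<lambda>y. h (F y)) x) = trace_form B (levi h (F x))"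
proof -
  have lin: "linear (\<lambda>v. dd v F x)"
    using assms by (intro linear_dd smooth_onD_differentiable) (auto simp: holomorphic_map_on_def)
  have "levi (\<lambda>y. h (F y)) x = (\<lambda>u w. levi h (F x) (dd u F x) (dd w F x))"
    using levi_compose[OF assms(1-6)] by (simp add: fun_eq_iff)
  then show ?thesis
    using trace_form_pullback[OF B lin bij bilinear_levi[OF assms(1) _ assms(6)], of "F x"] assms by auto
qed

lemma frechet_derivative_eq_dd: "frechet_derivative f (at x) = (\<lambda>v. dd v f x)"
  by (simp add: dd_def)

text \<open>\<open>F\<close> is an isometry from \<open>G'\<close> to \<open>G\<close> at this
  point, so its differential carries the gradient of the composed function to that of
  \<open>h\<close>.\<close>

lemma gradient_compose:
  fixes F :: "'e::euclidean_space \<Rightarrow> 'e" and h :: "'e \<Rightarrow> real"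
  assumes F: "F differentiable (at x)" and h: "h differentiable (at (F x))"
    and B: "inner_form (G (F x))" and bij: "bij (\<lambda>v. dd v F x)"
    and G': "G' x = (\<lambda>u w. G (F x) (dd u F x) (dd w F x))"
  shows "dd (gradient G' (\<lambda>y. h (F y)) x) F x = gradient G h (F x)"
  using riesz_pullback[OF B linear_dd[OF F] bij linear_dd[OF h]]
  by (simp add: gradient_def sharp_eq_riesz frechet_derivative_eq_dd dd_compose[OF F h] G')

section \<open>Second derivatives at a minimum\<close>

text \<open>Everything is tested on the line through \<open>x\<close> in direction \<open>w\<close>.
  If the second derivative were negative, the first derivative would be negative just after
  \<open>x\<close>, and the mean value theorem would give a smaller value.\<close>

lemma
  fixes f :: "'a::euclidean_space \<Rightarrow> real"
  assumes S: "open S" "x \<in> S" and f: "smooth_on S f" and min: "\<And>y. y \<in> S \<Longrightarrow> f x \<le> f y"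
  shows dd_local_min: "dd w f x = 0"
    and dd_dd_local_min: "dd w (dd w f) x \<ge> 0"
proof -
  have "open ((\<lambda>r. x + r *\<^sub>R w) -` S)"
    by (intro open_vimage S continuous_intros)
  moreover have "0 \<in> (\<lambda>r. x + r *\<^sub>R w) -` S" using S by simp
  ultimately obtain d where "d > 0" "ball 0 d \<subseteq> (\<lambda>r. x + r *\<^sub>R w) -` S"
    using openE by blast
  then have d: "d > 0" "\<And>r. \<bar>r\<bar> < d \<Longrightarrow> x + r *\<^sub>R w \<in> S"
    by (auto simp: subset_iff)
  note der = has_real_derivative_line[OF f d(2)]
  have "((\<lambda>r. f (x + r *\<^sub>R w)) has_real_derivative dd w f x) (at 0)"
    using der[of 0] d by simp
  then show 1: "dd w f x = 0"
    by (rule DERIV_local_min[OF _ d(1)]) (use min d in auto)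
  show "dd w (dd w f) x \<ge> 0"
  proof (rule ccontr)
    assume "\<not> dd w (dd w f) x \<ge> 0"
    moreover have "((\<lambda>r. dd w f (x + r *\<^sub>R w)) has_real_derivative dd w (dd w f) x) (at 0)"
      using has_real_derivative_line[OF smooth_on_dd[OF f], of x 0 w] S by simp
    ultimately obtain e where e: "e > 0" "\<And>r. 0 < r \<Longrightarrow> r < e \<Longrightarrow> dd w f (x + (0 + r) *\<^sub>R w) < dd w f (x + 0 *\<^sub>R w)"
      using DERIV_neg_dec_right[of "\<lambda>r. dd w f (x + r *\<^sub>R w)"] by (metis not_le)
    define r where "r = min d e / 2"
    have r: "r > 0" "r < d" "r < e" using d e by (auto simp: r_def)
    have "\<exists>z>0. z < r \<and> f (x + r *\<^sub>R w) - f (x + 0 *\<^sub>R w) = (r - 0) * dd w f (x + z *\<^sub>R w)"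
      using der r by (intro MVT2) auto
    then obtain z where z: "z > 0" "z < r" "f (x + r *\<^sub>R w) - f x = r * dd w f (x + z *\<^sub>R w)" by auto
    have "dd w f (x + z *\<^sub>R w) < 0" using e(2)[of z] z r 1 by simp
    with r(1) have "r * dd w f (x + z *\<^sub>R w) < 0" by (rule mult_pos_neg)
    then have "f (x + r *\<^sub>R w) < f x" using z(3) by linarith
    then show False using min[OF d(2)[of r]] r by simp
  qed
qed

lemma dd_dd_mult:
  fixes f g :: "'a::euclidean_space \<Rightarrow> real"
  assumes S: "open S" "x \<in> S" and f: "smooth_on S f" and g: "smooth_on S g"
  shows "dd w (dd w (\<lambda>y. f y * g y)) x = f x * dd w (dd w g) x + 2 * dd w f x * dd w g x + dd w (dd w f) x * g x"
proof -
  note d = smooth_onD_differentiable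
  have "dd w (dd w (\<lambda>y. f y * g y)) x = dd w (\<lambda>y. f y * dd w g y + dd w f y * g y) x"
    by (rule dd_cong[OF S]) (rule dd_mult[OF d[OF f] d[OF g]])
  also have "\<dots> = dd w (\<lambda>y. f y * dd w g y) x + dd w (\<lambda>y. dd w f y * g y) x"
    by (intro dd_add differentiable_mult d[OF _ S(2)] f g smooth_on_dd)
  also have "\<dots> = f x * dd w (dd w g) x + 2 * dd w f x * dd w g x + dd w (dd w f) x * g x"
    using dd_mult[OF d[OF f S(2)] d[OF smooth_on_dd[OF g] S(2)]]
      dd_mult[OF d[OF smooth_on_dd[OF f] S(2)] d[OF g S(2)]]
    by simp
  finally show ?thesis .
qed

lemma dd_dd_add:
  assumes S: "open S" "x \<in> S" and f: "smooth_on S f" and g: "smooth_on S g"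
  shows "dd u (dd w (\<lambda>y. f y + g y)) x = dd u (dd w f) x + dd u (dd w g) x"
proof -
  note d = smooth_onD_differentiable
  have "dd u (dd w (\<lambda>y. f y + g y)) x = dd u (\<lambda>y. dd w f y + dd w g y) x"
    by (rule dd_cong[OF S]) (rule dd_add[OF d[OF f] d[OF g]])
  then show ?thesis using dd_add[OF d[OF smooth_on_dd[OF f] S(2)] d[OF smooth_on_dd[OF g] S(2)]] by simp
qed

lemma dd_dd_linear_compose:
  assumes S: "open S" "x \<in> S" and f: "smooth_on S f" and L: "bounded_linear L"
  shows "dd u (dd w (\<lambda>y. L (f y))) x = L (dd u (dd w f) x)"
proof -
  note d = smooth_onD_differentiable
  have "dd u (dd w (\<lambda>y. L (f y))) x = dd u (\<lambda>y. L (dd w f y)) x"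
    by (rule dd_cong[OF S]) (rule dd_linear_compose[OF L d[OF f]])
  then show ?thesis using dd_linear_compose[OF L d[OF smooth_on_dd[OF f] S(2)]] by simp
qed

lemma dd_dd_sum:
  assumes S: "open S" "x \<in> S" and f: "\<And>i. i \<in> I \<Longrightarrow> smooth_on S (f i)"
  shows "dd u (dd w (\<lambda>y. \<Sum>i\<in>I. f i y)) x = (\<Sum>i\<in>I. dd u (dd w (f i)) x)"
proof -
  note d = smooth_onD_differentiable
  have "dd u (dd w (\<lambda>y. \<Sum>i\<in>I. f i y)) x = dd u (\<lambda>y. \<Sum>i\<in>I. dd w (f i) y) x"
    by (rule dd_cong[OF S]) (rule dd_sum[OF d[OF f]])
  also have "\<dots> = (\<Sum>i\<in>I. dd u (dd w (f i)) x)"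
    by (rule dd_sum[OF d[OF smooth_on_dd[OF f] S(2)]])
  finally show ?thesis .
qed

lemma dd_dd_cong:
  assumes S: "open S" "x \<in> S" and "\<And>y. y \<in> S \<Longrightarrow> f y = g y"
  shows "dd u (dd w f) x = dd u (dd w g) x"
  by (rule dd_cong[OF S]) (rule dd_cong[OF S(1) _ assms(3)])

section \<open>Calculus of the Levi form\<close>

lemma
  assumes S: "open S" "x \<in> S"
  shows levi_cong: "(\<And>y. y \<in> S \<Longrightarrow> f y = g y) \<Longrightarrow> levi f x u w = levi g x u w"
    and levi_add: "smooth_on S f \<Longrightarrow> smooth_on S g \<Longrightarrow> levi (\<lambda>y. f y + g y) x u w = levi f x u w + levi g x u w"
    and levi_linear_compose: "smooth_on S f \<Longrightarrow> bounded_linear L \<Longrightarrow> levi (\<lambda>y. L (f y)) x u w = L (levi f x u w)"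
  unfolding levi_def
  using dd_dd_cong[OF S, of f g] dd_dd_add[OF S, of f g] dd_dd_linear_compose[OF S, of f L]
  by (auto simp: linear_add[OF bounded_linear.linear])

lemma smooth_on_levi: "open S \<Longrightarrow> smooth_on S h \<Longrightarrow> smooth_on S (\<lambda>y. levi h y u w)"
  unfolding levi_def by (intro smooth_on_add smooth_on_dd)

lemma smooth_on_gradient:
  fixes h :: "'e::euclidean_space \<Rightarrow> real"
  assumes "open S" "riemannian_metric_on S G" "smooth_on S h"
  shows "smooth_on S (gradient G h)"
  unfolding gradient_eq_riesz[OF assms(1,2), abs_def]
  by (rule smooth_on_riesz[OF assms(1,2) smooth_on_dd[OF assms(3)] linear_dd[OF smooth_onD_differentiable[OF assms(3)]]])

lemma smooth_on_metric_gradient: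
  fixes h k :: "'e::euclidean_space \<Rightarrow> real"
  assumes S: "open S" and G: "riemannian_metric_on S G" and h: "smooth_on S h" and k: "smooth_on S k"
  shows "smooth_on S (\<lambda>y. G y (gradient G h y) (gradient G k y))"
proof -
  have "G y (gradient G h y) (gradient G k y) = (\<Sum>b\<in>Basis. (gradient G k y \<bullet> b) * dd b h y)" if "y \<in> S" for y
    unfolding metric_gradient[OF S G that h]
    by (rule form_Basis_expansion[OF linear_dd[OF smooth_onD_differentiable[OF h that]], symmetric])
  moreover have "smooth_on S (\<lambda>y. \<Sum>b\<in>Basis. (gradient G k y \<bullet> b) * dd b h y)"
    by (intro smooth_on_sum smooth_on_mult smooth_on_linear_compose[OF S bounded_linear_inner_left]
        smooth_on_gradient[OF S G k] smooth_on_dd h S)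
  ultimately show ?thesis using smooth_on_cong[OF S] by (metis (no_types, lifting))
qed

lemma smooth_on_trace_levi:
  fixes h :: "complex ^ 'n::finite \<Rightarrow> real"
  assumes S: "open S" and G: "riemannian_metric_on S G" and h: "smooth_on S h"
  shows "smooth_on S (\<lambda>y. trace_form (G y) (levi h y))"
  unfolding trace_form_def
  by (intro smooth_on_sum smooth_on_linear_compose[OF S bounded_linear_inner_left] S
      smooth_on_riesz[OF S G smooth_on_levi[OF S h] bilinear_linear(1)[OF bilinear_levi[OF S _ h]]])

text \<open>Plain partial derivatives of order four commute. No curvature arises from this exchange;
  it enters only through the second derivatives of the metric.\<close>

lemma levi_levi_commute:
  fixes h :: "complex ^ 'n::finite \<Rightarrow> real"
  assumes S: "open S" "x \<in> S" and h: "smooth_on S h"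
  shows "levi (\<lambda>y. levi h y u u) x v v = levi (\<lambda>y. levi h y v v) x u u"
proof -
  have comm: "dd b (dd b (dd a (dd a h))) x = dd a (dd a (dd b (dd b h))) x" for a b
  proof -
    have sm: "smooth_on S (dd a h)" "smooth_on S (dd b h)" "smooth_on S (dd a (dd a h))" "smooth_on S (dd a (dd b h))"
      using h by (auto intro: smooth_on_dd)
    have "dd b (dd b (dd a (dd a h))) x = dd b (dd a (dd b (dd a h))) x"
      by (rule dd_cong[OF S]) (rule dd_commute[OF S(1) _ sm(1)])
    also have "\<dots> = dd b (dd a (dd a (dd b h))) x"
      by (rule dd_dd_cong[OF S]) (rule dd_commute[OF S(1) _ h])
    also have "\<dots> = dd a (dd b (dd a (dd b h))) x"
      by (rule dd_commute[OF S sm(4)])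
    also have "\<dots> = dd a (dd a (dd b (dd b h))) x"
      by (rule dd_cong[OF S]) (rule dd_commute[OF S(1) _ sm(2)])
    finally show ?thesis .
  qed
  have "dd a (dd a (\<lambda>y. levi h y w w)) x = dd a (dd a (dd w (dd w h))) x + dd a (dd a (dd (J w) (dd (J w) h))) x" for a w
    unfolding levi_def by (rule dd_dd_add[OF S]) (intro smooth_on_dd h)+
  then show ?thesis
    unfolding levi_def[of "\<lambda>y. levi h y u u"] levi_def[of "\<lambda>y. levi h y v v"]
    using comm by simp
qed

section \<open>The evolution inequality at a minimum, in normal coordinates\<close>

lemma bilinear_dd_dd:
  assumes S: "open S" "x \<in> S" and M: "\<And>u w. smooth_on S (\<lambda>y. M y u w)" "\<And>y. y \<in> S \<Longrightarrow> bilinear (M y)"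
  shows "bilinear (\<lambda>u w. dd a (dd b (\<lambda>y. M y u w)) x :: real)"
  by (rule bilinear_dd[OF S smooth_on_dd[OF M(1)] bilinear_dd[OF S(1) _ M]])

lemma bilinear_levi_form:
  assumes S: "open S" "x \<in> S" and M: "\<And>u w. smooth_on S (\<lambda>y. M y u w)" "\<And>y. y \<in> S \<Longrightarrow> bilinear (M y)"
  shows "bilinear (\<lambda>u w. levi (\<lambda>y. M y u w) x a b :: real)"
  unfolding levi_def by (intro bilinear_add bilinear_dd_dd[OF S M])

context
  fixes S :: "(complex ^ 'n::finite) set" and G :: "(complex ^ 'n) metric_field" and x :: "complex ^ 'n"
  assumes S: "open S" "x \<in> S" and G: "riemannian_metric_on S G"
    and flat: "\<And>a u w. dd a (\<lambda>y. G y u w) x = 0"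
begin

text \<open>Differentiate \<open>G y (X y) z = l y z\<close>, where \<open>X\<close> is the
  representative, once and twice at \<open>x\<close>. All terms with a first derivative of the
  metric vanish there.\<close>

lemma
  assumes l: "\<And>w. smooth_on S (\<lambda>y. l y w)" "\<And>y. y \<in> S \<Longrightarrow> linear (l y)"
  shows dd_riesz_normal: "G x (dd a (\<lambda>y. riesz (G y) (l y)) x) z = dd a (\<lambda>y. l y z) x"
    and dd_dd_riesz_normal: "G x (dd a (dd a (\<lambda>y. riesz (G y) (l y))) x) z
      = dd a (dd a (\<lambda>y. l y z)) x - dd a (dd a (\<lambda>y. G y (riesz (G x) (l x)) z)) x"
proof -
  let ?X = "\<lambda>y. riesz (G y) (l y)"
  note bG = metric_bilinear[OF S(1) G] and sG = metric_smooth[OF S(1) G]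
  note d = smooth_onD_differentiable
  show "G x (dd a ?X x) z = dd a (\<lambda>y. l y z) x"
    using dd_riesz[OF S G l] flat by simp
  have sX: "smooth_on S ?X" by (rule smooth_on_riesz[OF S(1) G l])
  have sXb: "smooth_on S (\<lambda>y. ?X y \<bullet> b)" for b
    by (rule smooth_on_linear_compose[OF S(1) bounded_linear_inner_left sX])
  have "dd a (dd a (\<lambda>y. l y z)) x = dd a (dd a (\<lambda>y. \<Sum>b\<in>Basis. (?X y \<bullet> b) * G y b z)) x"
  proof (rule dd_dd_cong[OF S])
    fix y assume y: "y \<in> S"
    show "l y z = (\<Sum>b\<in>Basis. (?X y \<bullet> b) * G y b z)"
      using form_Basis_expansion[OF bilinear_linear(2)[OF bG[OF y]]] riesz[OF metric_inner_form[OF S(1) G y] l(2)[OF y]]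
      by simp
  qed
  also have "\<dots> = (\<Sum>b\<in>Basis. dd a (dd a (\<lambda>y. (?X y \<bullet> b) * G y b z)) x)"
    by (rule dd_dd_sum[OF S smooth_on_mult[OF S(1) sXb sG]])
  also have "\<dots> = (\<Sum>b\<in>Basis. (?X x \<bullet> b) * dd a (dd a (\<lambda>y. G y b z)) x + (dd a (dd a ?X) x \<bullet> b) * G x b z)"
    using dd_dd_mult[OF S sXb sG] flat dd_dd_linear_compose[OF S sX bounded_linear_inner_left] by simp
  also have "\<dots> = dd a (dd a (\<lambda>y. G y (?X x) z)) x + G x (dd a (dd a ?X) x) z"
    using form_Basis_expansion[OF bilinear_linear(2)[OF bilinear_dd_dd[OF S sG bG]]]
      form_Basis_expansion[OF bilinear_linear(2)[OF bG[OF S(2)]]]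
    by (simp add: sum.distrib)
  finally show "G x (dd a (dd a ?X) x) z = dd a (dd a (\<lambda>y. l y z)) x - dd a (dd a (\<lambda>y. G y (?X x) z)) x"
    by simp
qed

text \<open>The second derivative of G^-1 P at a point where the first derivatives of G vanish: G^-1
  P'' - G^-1 G'' G^-1 P.\<close>

lemma levi_trace_form_normal:
  assumes P: "\<And>u w. smooth_on S (\<lambda>y. P y u w)" "\<And>y. y \<in> S \<Longrightarrow> bilinear (P y)"
  shows "levi (\<lambda>y. trace_form (G y) (P y)) x v v
    = trace_form (G x) (\<lambda>u w. levi (\<lambda>y. P y u w) x v v)
      - trace_form (G x) (\<lambda>u w. levi (\<lambda>y. G y (riesz (G x) (P x u)) w) x v v)"
proof -
  note bG = metric_bilinear[OF S(1) G] and sG = metric_smooth[OF S(1) G]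
  have ip: "inner_form (G x)" by (rule metric_inner_form[OF S(1) G S(2)])
  have lP: "linear (P y b)" if "y \<in> S" for y b by (rule bilinear_linear(1)[OF P(2)[OF that]])
  let ?Z = "\<lambda>b y. riesz (G y) (P y b)"
  have sZ: "smooth_on S (?Z b)" for b by (rule smooth_on_riesz[OF S(1) G P(1) lP])
  let ?M = "\<lambda>u w. levi (\<lambda>y. P y u w) x v v"
  let ?K = "\<lambda>u w. levi (\<lambda>y. G y (riesz (G x) (P x u)) w) x v v"
  have lM: "linear (?M u)" for u by (rule bilinear_linear(1)[OF bilinear_levi_form[OF S P]])
  have lK: "linear (?K u)" for u by (rule bilinear_linear(1)[OF bilinear_levi_form[OF S sG bG]])
  have lZ: "levi (?Z b) x v v = riesz (G x) (?M b) - riesz (G x) (?K b)" for b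
  proof -
    have "levi (?Z b) x v v = riesz (G x) (\<lambda>w. ?M b w - ?K b w)"
      by (rule riesz_unique[OF ip, symmetric])
        (simp add: levi_def bilinear_ladd[OF bG[OF S(2)]] dd_dd_riesz_normal[OF P(1) lP])
    then show ?thesis using riesz_diff[OF ip lM lK] by simp
  qed
  have 1: "dd a (dd a (\<lambda>y. trace_form (G y) (P y))) x = (\<Sum>b\<in>Basis. dd a (dd a (?Z b)) x \<bullet> b)" for a
    unfolding trace_form_def
    using dd_dd_sum[OF S smooth_on_linear_compose[OF S(1) bounded_linear_inner_left sZ]]
      dd_dd_linear_compose[OF S sZ bounded_linear_inner_left] by simp
  have "levi (\<lambda>y. trace_form (G y) (P y)) x v v = (\<Sum>b\<in>Basis. levi (?Z b) x v v \<bullet> b)"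
    unfolding levi_def 1 by (simp add: inner_add_left sum.distrib)
  then show ?thesis unfolding lZ by (simp add: trace_form_def inner_diff_left sum_subtractf)
qed

text \<open>A Bochner formula in coordinates. The square of the gradient is expanded as the sum of
  \<open>(Z y \<bullet> b) * dd b h y\<close>; its second derivative consists of a quadratic term, a
  transport term along \<open>Z x\<close> and a term with the second derivatives of the
  metric.\<close>

lemma levi_gradient_normal:
  assumes h: "smooth_on S h"
  defines "Z \<equiv> gradient G h"
  shows "levi (\<lambda>y. G y (Z y) (Z y)) x v v
    = 2 * G x (dd v Z x) (dd v Z x) + 2 * G x (dd (J v) Z x) (dd (J v) Z x)
      + 2 * dd (Z x) (\<lambda>y. levi h y v v) x - levi (\<lambda>y. G y (Z x) (Z x)) x v v"
    and "G x (dd a Z x) w = dd a (dd w h) x"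
proof -
  note bG = metric_bilinear[OF S(1) G] and sG = metric_smooth[OF S(1) G]
  note d = smooth_onD_differentiable
  have Z: "Z = (\<lambda>y. riesz (G y) (\<lambda>w. dd w h y))"
    by (rule ext) (simp add: Z_def gradient_eq_riesz[OF S(1) G])
  have lh: "linear (\<lambda>w. dd w h y)" if "y \<in> S" for y by (rule linear_dd[OF d[OF h that]])
  have sZ: "smooth_on S Z" unfolding Z by (rule smooth_on_riesz[OF S(1) G smooth_on_dd[OF h] lh])
  have sZb: "smooth_on S (\<lambda>y. Z y \<bullet> b)" for b
    by (rule smooth_on_linear_compose[OF S(1) bounded_linear_inner_left sZ])
  show DZ: "G x (dd a Z x) w = dd a (dd w h) x" for a w
    unfolding Z by (rule dd_riesz_normal[OF smooth_on_dd[OF h] lh])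
  have DDZ: "G x (dd a (dd a Z) x) w = dd a (dd a (dd w h)) x - dd a (dd a (\<lambda>y. G y (Z x) w)) x" for a w
    unfolding Z by (rule dd_dd_riesz_normal[OF smooth_on_dd[OF h] lh])
  have GZ: "G y (Z y) w = dd w h y" if "y \<in> S" for y w
    unfolding Z_def by (rule metric_gradient[OF S(1) G that h])
  have 1: "dd a (dd a (\<lambda>y. G y (Z y) (Z y))) x
      = 2 * G x (dd a Z x) (dd a Z x) + 2 * dd a (dd a (dd (Z x) h)) x - dd a (dd a (\<lambda>y. G y (Z x) (Z x))) x" for a
  proof -
    have "dd a (dd a (\<lambda>y. G y (Z y) (Z y))) x = dd a (dd a (\<lambda>y. \<Sum>b\<in>Basis. (Z y \<bullet> b) * dd b h y)) x"
      by (rule dd_dd_cong[OF S]) (simp add: GZ form_Basis_expansion[OF lh])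
    also have "\<dots> = (\<Sum>b\<in>Basis. dd a (dd a (\<lambda>y. (Z y \<bullet> b) * dd b h y)) x)"
      by (rule dd_dd_sum[OF S smooth_on_mult[OF S(1) sZb smooth_on_dd[OF h]]])
    also have "\<dots> = (\<Sum>b\<in>Basis. (Z x \<bullet> b) * dd a (dd a (dd b h)) x + 2 * ((dd a Z x \<bullet> b) * dd a (dd b h) x)
        + (dd a (dd a Z) x \<bullet> b) * dd b h x)"
      using dd_dd_mult[OF S sZb smooth_on_dd[OF h]] dd_dd_linear_compose[OF S sZ bounded_linear_inner_left]
        dd_linear_compose[OF bounded_linear_inner_left d[OF sZ S(2)]]
      by (simp add: mult.assoc)
    also have "\<dots> = dd a (dd a (dd (Z x) h)) x + 2 * dd a (dd (dd a Z x) h) x + dd (dd a (dd a Z) x) h x"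
    proof -
      have l2: "linear (\<lambda>w. dd a (dd w h) x)" by (rule bilinear_linear(1)[OF bilinear_second_dd[OF S h]])
      have l3: "linear (\<lambda>w. dd a (dd a (dd w h)) x)"
        by (rule linear_dd_form[OF S d[OF smooth_on_dd[OF smooth_on_dd[OF h]]]
              bilinear_linear(1)[OF bilinear_second_dd[OF S(1) _ h]]])
      show ?thesis
        using form_Basis_expansion[OF l2] form_Basis_expansion[OF l3] form_Basis_expansion[OF lh[OF S(2)]]
        by (simp add: sum.distrib sum_distrib_left[symmetric])
    qed
    also have "dd (dd a (dd a Z) x) h x = dd a (dd a (dd (Z x) h)) x - dd a (dd a (\<lambda>y. G y (Z x) (Z x))) x"
      unfolding GZ[OF S(2), symmetric] metric_sym[OF S(1) G S(2), of "Z x"] DDZ ..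
    finally show ?thesis by (simp add: DZ)
  qed
  have "dd (Z x) (\<lambda>y. levi h y v v) x = dd (Z x) (dd v (dd v h)) x + dd (Z x) (dd (J v) (dd (J v) h)) x"
    unfolding levi_def
    using dd_add[OF d[OF smooth_on_dd[OF smooth_on_dd[OF h]] S(2)] d[OF smooth_on_dd[OF smooth_on_dd[OF h]] S(2)]]
    by simp
  moreover have "dd (Z x) (dd a (dd a h)) x = dd a (dd a (dd (Z x) h)) x" for a
  proof -
    have "dd (Z x) (dd a (dd a h)) x = dd a (dd (Z x) (dd a h)) x"
      by (rule dd_commute[OF S smooth_on_dd[OF h]])
    also have "\<dots> = dd a (dd a (dd (Z x) h)) x"
      by (rule dd_cong[OF S]) (rule dd_commute[OF S(1) _ h])
    finally show ?thesis .
  qed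
  ultimately show "levi (\<lambda>y. G y (Z y) (Z y)) x v v
    = 2 * G x (dd v Z x) (dd v Z x) + 2 * G x (dd (J v) Z x) (dd (J v) Z x)
      + 2 * dd (Z x) (\<lambda>y. levi h y v v) x - levi (\<lambda>y. G y (Z x) (Z x)) x v v"
    unfolding levi_def[of "\<lambda>y. G y (Z y) (Z y)"] levi_def[of "\<lambda>y. G y (Z x) (Z x)"] 1 by simp
qed

text \<open>
  Replacing \<open>levi h\<close> by the non-negative form \<open>P = s levi h + c G\<close> changes the trace only by a factor
  and a constant, since the trace of \<open>G\<close> is the dimension; this gives the sign of the curvature term.
\<close>

lemma levi_evolution_at_minimum:
  assumes h: "smooth_on S h" and s: "s > 0"
    and curv: "\<And>w. levi (\<lambda>y. G y w w) x v v \<le> 0"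
    and exch: "\<And>w. levi (\<lambda>y. G y w w) x v v = levi (\<lambda>y. G y v v) x w w"
    and GJ: "G x (J v) (J v) = G x v v"
    and nonneg: "\<And>y u. y \<in> S \<Longrightarrow> s * levi h y u u + c * G y u u \<ge> 0"
    and zero: "s * levi h x v v + c * G x v v = 0"
  shows "(levi h x v v)\<^sup>2 \<le> G x v v * levi (\<lambda>y. 1/2 * trace_form (G y) (levi h y)
      + G y (gradient G h y) (gradient G h y)) x v v"
proof -
  note bG = metric_bilinear[OF S(1) G] and sG = metric_smooth[OF S(1) G]
  note d = smooth_onD_differentiable
  have ip: "inner_form (G y)" if "y \<in> S" for y by (rule metric_inner_form[OF S(1) G that])
  note bl = bilinear_levi[OF S(1) _ h]
  define P where "P y u w = s * levi h y u w + c * G y u w" for y u w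
  have sP: "smooth_on S (\<lambda>y. P y u w)" for u w
    unfolding P_def by (intro smooth_on_add smooth_on_mult smooth_on_const smooth_on_levi h sG S)
  have bP: "bilinear (P y)" if "y \<in> S" for y
    unfolding P_def by (intro bilinear_add bilinear_cmult bl bG that)
  have symP: "P y u w = P y w u" if "y \<in> S" for y u w
    unfolding P_def using levi_sym[OF S(1) that h, of u w] metric_sym[OF S(1) G that, of u w] by simp
  have psdP: "psd_form (P x)"
    using bP symP nonneg S(2) by (auto simp: psd_form_def P_def)
  have minP: "P x v v \<le> P y v v" if "y \<in> S" for y
    using nonneg[OF that] zero by (simp add: P_def)
  have slev: "levi (\<lambda>y. P y u u) x a a = s * levi (\<lambda>y. levi h y u u) x a a + c * levi (\<lambda>y. G y u u) x a a" for u a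
    unfolding P_def
    using levi_add[OF S smooth_on_linear_compose[OF S(1) bounded_linear_mult_right smooth_on_levi[OF S(1) h]]
        smooth_on_linear_compose[OF S(1) bounded_linear_mult_right sG]]
      levi_linear_compose[OF S smooth_on_levi[OF S(1) h] bounded_linear_mult_right]
      levi_linear_compose[OF S sG bounded_linear_mult_right]
    by simp
  let ?M = "\<lambda>u w. levi (\<lambda>y. P y u w) x v v"
  have "psd_form ?M"
    unfolding psd_form_def
  proof (intro conjI allI)
    show "bilinear ?M" by (rule bilinear_levi_form[OF S sP bP])
    show "?M u w = ?M w u" for u w by (rule levi_cong[OF S symP])
    fix u
    \<comment> \<open>The roles of the two directions are exchanged, for \<open>h\<close> by
      commuting derivatives and for the metric by \<open>exch\<close>. The right-hand side is a
      second derivative of \<open>P y v v\<close>, which has its minimum at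
      \<open>x\<close>.\<close>
    have "?M u u = levi (\<lambda>y. P y v v) x u u"
      unfolding slev using levi_levi_commute[OF S h, of u v] exch[of u] by simp
    then show "?M u u \<ge> 0"
      unfolding levi_def using dd_dd_local_min[OF S sP minP] by simp
  qed
  then have "trace_form (G x) ?M \<ge> 0" by (rule trace_form_nonneg[OF ip[OF S(2)]])
  \<comment> \<open>Here curvature enters: the second derivatives of the metric form a non-positive
    form, contracted with the non-negative \<open>P\<close>. This contraction would have no sign for
    the Levi form of \<open>h\<close> itself.\<close>
  moreover have "trace_form (G x) (\<lambda>u w. levi (\<lambda>y. G y (riesz (G x) (P x u)) w) x v v) \<le> 0"
    by (rule trace_form_compose_nonpos[OF ip[OF S(2)] psdP bilinear_levi_form[OF S sG bG] curv])
  ultimately have lP: "levi (\<lambda>y. trace_form (G y) (P y)) x v v \<ge> 0"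
    using levi_trace_form_normal[where P = P, OF sP bP, of v] by linarith
  note smT = smooth_on_trace_levi[OF S(1) G h]
  have "levi (\<lambda>y. trace_form (G y) (P y)) x v v
      = levi (\<lambda>y. s * trace_form (G y) (levi h y) + c * DIM(complex ^ 'n)) x v v"
  proof (rule levi_cong[OF S])
    fix y assume y: "y \<in> S"
    show "trace_form (G y) (P y) = s * trace_form (G y) (levi h y) + c * DIM(complex ^ 'n)"
      unfolding P_def trace_form_add[OF ip[OF y] bilinear_cmult[OF bl[OF y]] bilinear_cmult[OF bG[OF y]]]
        trace_form_cmult[OF ip[OF y] bl[OF y]] trace_form_cmult[OF ip[OF y] bG[OF y]] trace_form_self[OF ip[OF y]] ..
  qed
  also have "\<dots> = s * levi (\<lambda>y. trace_form (G y) (levi h y)) x v v + levi (\<lambda>y. c * DIM(complex ^ 'n)) x v v"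
    using levi_add[OF S smooth_on_linear_compose[OF S(1) bounded_linear_mult_right smT] smooth_on_const]
      levi_linear_compose[OF S smT bounded_linear_mult_right] by simp
  also have "levi (\<lambda>y. c * DIM(complex ^ 'n)) x v v = 0"
    by (simp add: levi_def dd_const[abs_def] dd_const)
  finally have lT: "levi (\<lambda>y. trace_form (G y) (levi h y)) x v v \<ge> 0"
    using lP s by (simp add: zero_le_mult_iff)
  define Z where "Z = gradient G h"
  \<comment> \<open>The first-order condition at the minimum disposes of the transport term; the
    derivative of the metric in \<open>P\<close> vanishes in these coordinates.\<close>
  have grad0: "dd (Z x) (\<lambda>y. levi h y v v) x = 0"
  proof -
    have "dd (Z x) (\<lambda>y. P y v v) x = s * dd (Z x) (\<lambda>y. levi h y v v) x + c * dd (Z x) (\<lambda>y. G y v v) x"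
      unfolding P_def
      using dd_add[OF d[OF smooth_on_linear_compose[OF S(1) bounded_linear_mult_right smooth_on_levi[OF S(1) h]] S(2)]
          d[OF smooth_on_linear_compose[OF S(1) bounded_linear_mult_right sG] S(2)]]
        dd_cmult[OF d[OF smooth_on_levi[OF S(1) h] S(2)]] dd_cmult[OF d[OF sG S(2)]]
      by simp
    then show ?thesis using dd_local_min[OF S sP minP, of "Z x"] flat s by simp
  qed
  have sZ: "smooth_on S (\<lambda>y. G y (Z y) (Z y))"
    unfolding Z_def by (rule smooth_on_metric_gradient[OF S(1) G h h])
  let ?q = "\<lambda>a. G x (dd a Z x) (dd a Z x)"
  have "levi (\<lambda>y. 1/2 * trace_form (G y) (levi h y) + G y (Z y) (Z y)) x v v
      = 1/2 * levi (\<lambda>y. trace_form (G y) (levi h y)) x v v + levi (\<lambda>y. G y (Z y) (Z y)) x v v"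
    unfolding levi_add[OF S smooth_on_linear_compose[OF S(1) bounded_linear_mult_right smT] sZ]
      levi_linear_compose[OF S smT bounded_linear_mult_right] ..
  also have "\<dots> \<ge> 2 * ?q v + 2 * ?q (J v)"
    using lT levi_gradient_normal(1)[OF h, of v] grad0 curv[of "Z x"] by (simp add: Z_def)
  finally have main: "2 * ?q v + 2 * ?q (J v)
      \<le> levi (\<lambda>y. 1/2 * trace_form (G y) (levi h y) + G y (Z y) (Z y)) x v v" .
  have cs: "(dd a (dd a h) x)\<^sup>2 \<le> ?q a * G x a a" for a
    using psd_form_cauchy_schwarz[OF inner_form_psd[OF ip[OF S(2)]], of "dd a Z x" a]
    unfolding Z_def levi_gradient_normal(2)[OF h] .
  \<comment> \<open>The factor 2 lost in (p + q)^2 \<le> 2 (p^2 + q^2) is exactly the one in front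
    of the two gradient terms, so the square survives with coefficient one.\<close>
  have "(levi h x v v)\<^sup>2 \<le> 2 * ((dd v (dd v h) x)\<^sup>2 + (dd (J v) (dd (J v) h) x)\<^sup>2)"
    unfolding levi_def using sum_squares_bound[of "dd v (dd v h) x" "dd (J v) (dd (J v) h) x"]
    by (simp add: power2_sum)
  also have "\<dots> \<le> G x v v * (2 * ?q v + 2 * ?q (J v))"
    using cs[of v] cs[of "J v"] GJ by (simp add: algebra_simps)
  also have "\<dots> \<le> G x v v * levi (\<lambda>y. 1/2 * trace_form (G y) (levi h y) + G y (Z y) (Z y)) x v v"
    using main inner_form_psd[OF ip[OF S(2)]] by (intro mult_left_mono) (auto simp: psd_form_def)
  finally show ?thesis unfolding Z_def .
qed

end

section \<open>Holomorphic normal coordinates\<close>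

lemma riemannian_metric_pullback:
  fixes G :: "'e::euclidean_space metric_field"
  assumes S: "open S" and G: "riemannian_metric_on S G"
    and S': "open S'" and F: "smooth_on S' F" "F ` S' \<subseteq> S" and bij: "\<And>y. y \<in> S' \<Longrightarrow> bij (\<lambda>v. dd v F y)"
  shows "riemannian_metric_on S' (\<lambda>y u w. G (F y) (dd u F y) (dd w F y))"
proof -
  have ip: "inner_form (\<lambda>u w. G (F y) (dd u F y) (dd w F y))" if "y \<in> S'" for y
    using inner_form_pullback[OF riemannian_metric_inner_form[OF G] linear_dd[OF smooth_onD_differentiable[OF F(1) that]] bij[OF that]]
      F that by blast
  have sm: "smooth_on S' (\<lambda>y. G (F y) (dd u F y) (dd w F y))" for u w
  proof -
    have "G (F y) (dd u F y) (dd w F y)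
        = (\<Sum>a\<in>Basis. \<Sum>b\<in>Basis. (dd u F y \<bullet> a) * (dd w F y \<bullet> b) * G (F y) a b)" if "y \<in> S'" for y
      using bilinear_Basis_expansion[OF metric_bilinear[OF S G, of "F y"], of "dd u F y" "dd w F y"] F that by blast
    moreover have "smooth_on S' (\<lambda>y. \<Sum>a\<in>Basis. \<Sum>b\<in>Basis. (dd u F y \<bullet> a) * (dd w F y \<bullet> b) * G (F y) a b)"
      by (intro smooth_on_sum smooth_on_mult smooth_on_linear_compose[OF S' bounded_linear_inner_left] smooth_on_dd F S'
          smooth_on_compose[OF S S' F(2,1) metric_smooth[OF S G]])
    ultimately show ?thesis using smooth_on_cong[OF S'] by (metis (no_types, lifting))
  qed
  show ?thesis using sm ip by (simp add: riemannian_metric_on_def inner_form_def)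
qed

text \<open>Derivatives in direction \<open>w\<close> at 0 only see the line spanned by
  \<open>w\<close>. The pulled back metric below has this quadratic form on each line, because the
  differential of the coordinate change is affine in the point.\<close>

lemma
  fixes q k1 k2 k3 :: "'a::euclidean_space \<Rightarrow> real"
  assumes S: "open S" "0 \<in> S" and sm: "smooth_on S q" "smooth_on S k1" "smooth_on S k2" "smooth_on S k3"
    and eq: "\<And>r. r *\<^sub>R w \<in> S \<Longrightarrow> q (r *\<^sub>R w) = k1 (r *\<^sub>R w) - 2 * r * k2 (r *\<^sub>R w) + r * r * k3 (r *\<^sub>R w)"
  shows dd_quadratic_line: "dd w q 0 = dd w k1 0 - 2 * k2 0"
    and dd_dd_quadratic_line: "dd w (dd w q) 0 = dd w (dd w k1) 0 - 4 * dd w k2 0 + 2 * k3 0"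
proof -
  define T where "T = (\<lambda>r. r *\<^sub>R w) -` S"
  have T: "open T" "0 \<in> T" unfolding T_def using S by (auto intro!: open_vimage continuous_intros)
  have der: "((\<lambda>r. f (r *\<^sub>R w)) has_real_derivative dd w f (r *\<^sub>R w)) (at r)"
    if "smooth_on S f" "r \<in> T" for f :: "'a \<Rightarrow> real" and r
    using has_real_derivative_line[OF that(1), of 0 r w] that(2) by (simp add: T_def)
  let ?e = "\<lambda>r. dd w k1 (r *\<^sub>R w) - 2 * k2 (r *\<^sub>R w) - 2 * r * dd w k2 (r *\<^sub>R w)
    + 2 * r * k3 (r *\<^sub>R w) + r * r * dd w k3 (r *\<^sub>R w)"
  have 1: "dd w q (r *\<^sub>R w) = ?e r" if r: "r \<in> T" for r
  proof (rule DERIV_unique[OF der[OF sm(1) r]])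
    have "((\<lambda>r. k1 (r *\<^sub>R w) - 2 * r * k2 (r *\<^sub>R w) + r * r * k3 (r *\<^sub>R w)) has_real_derivative ?e r) (at r)"
      by (auto intro!: derivative_eq_intros der[OF sm(2) r] der[OF sm(3) r] der[OF sm(4) r])
    then show "((\<lambda>r. q (r *\<^sub>R w)) has_real_derivative ?e r) (at r)"
      by (rule has_field_derivative_transform_within_open[OF _ T(1) r]) (simp add: T_def eq)
  qed
  show "dd w q 0 = dd w k1 0 - 2 * k2 0" using 1[OF T(2)] by simp
  have "((\<lambda>r. ?e r) has_real_derivative dd w (dd w k1) 0 - 4 * dd w k2 0 + 2 * k3 0) (at 0)"
    using T(2) by (auto intro!: derivative_eq_intros der[OF sm(3) T(2), simplified] der[OF sm(4) T(2), simplified]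
        der[OF smooth_on_dd[OF sm(2)] T(2), simplified] der[OF smooth_on_dd[OF sm(3)] T(2), simplified]
        der[OF smooth_on_dd[OF sm(4)] T(2), simplified])
  then have "((\<lambda>r. dd w q (r *\<^sub>R w)) has_real_derivative dd w (dd w k1) 0 - 4 * dd w k2 0 + 2 * k3 0) (at 0)"
    by (rule has_field_derivative_transform_within_open[OF _ T]) (simp add: 1)
  then show "dd w (dd w q) 0 = dd w (dd w k1) 0 - 4 * dd w k2 0 + 2 * k3 0"
    using DERIV_unique[OF der[OF smooth_on_dd[OF sm(1)] T(2)]] by simp
qed

text \<open>The function \<open>\<phi> = log \<rho> + f/2\<close> satisfies \<open>\<partial>\<phi>/\<partial>t = evolution \<phi> - W/2\<close>.\<close>

definition evolution :: "(complex ^ 'n::finite) metric_field \<Rightarrow> (complex ^ 'n \<Rightarrow> real) \<Rightarrow> complex ^ 'n \<Rightarrow> real" where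
  "evolution G h y = 1/2 * trace_form (G y) (levi h y) + G y (gradient G h y) (gradient G h y)"

lemma smooth_on_evolution:
  fixes h :: "complex ^ 'n::finite \<Rightarrow> real"
  assumes "open S" "riemannian_metric_on S G" "smooth_on S h"
  shows "smooth_on S (evolution G h)"
  unfolding evolution_def[abs_def]
  by (intro smooth_on_add smooth_on_linear_compose[OF _ bounded_linear_mult_right]
      smooth_on_trace_levi smooth_on_metric_gradient assms)

text \<open>
  The substitution \<open>y \<mapsto> x + y - \<Gamma>(y,y)/2\<close> is holomorphic because the Christoffel form of a Kaehler
  metric is complex bilinear.
\<close>

lemma kaehler_normal_coordinates:
  fixes G :: "(complex ^ 'n::finite) metric_field"
  assumes S: "open S" "x \<in> S" and K: "kaehler_metric_on S G"
  obtains S' F where "open S'" "0 \<in> S'" "holomorphic_map_on S' F" "F ` S' \<subseteq> S" "F 0 = x"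
    "\<And>y. y \<in> S' \<Longrightarrow> bij (\<lambda>v. dd v F y)"
    "\<And>y v. dd v F y = v - christoffel G x y v"
proof -
  note G = kaehler_riemannian[OF S(1) K]
  let ?C = "christoffel G x"
  have blC: "bilinear ?C" by (rule bilinear_christoffel[OF S(1) G S(2)])
  then have bb: "bounded_bilinear ?C" by (simp add: bilinear_conv_bounded_bilinear)
  define F where "F y = x + y - (1/2) *\<^sub>R ?C y y" for y
  have der: "(F has_derivative (\<lambda>v. v - ?C y v)) (at y)" for y
  proof -
    have "(F has_derivative (\<lambda>v. 0 + v - (1/2) *\<^sub>R (?C y v + ?C v y))) (at y)"
      unfolding F_def
      by (intro has_derivative_diff has_derivative_add has_derivative_const has_derivative_ident
          has_derivative_scaleR_right bounded_bilinear.FDERIV[OF bb])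
    moreover have "(1/2) *\<^sub>R (?C y v + ?C v y) = ?C y v" for v
      unfolding christoffel_sym[OF S(1) G S(2), of v y] by (simp add: scaleR_2[symmetric])
    ultimately show ?thesis by simp
  qed
  then have ddF: "dd v F y = v - ?C y v" for v y by (rule dd_eqI)
  have contF: "continuous_on UNIV F"
    using der by (meson continuous_at_imp_continuous_on has_derivative_continuous)
  obtain k where k: "k > 0" "\<And>a b. norm (?C a b) \<le> norm a * norm b * k"
    using bounded_bilinear.pos_bounded[OF bb] by blast
  \<comment> \<open>Within radius \<open>1/k\<close> the Christoffel correction of a non-zero vector
    is shorter than the vector, so the differential is injective.\<close>
  define S' where "S' = ball 0 (1/k) \<inter> F -` S"
  have "F 0 = x" by (simp add: F_def bilinear_lzero[OF blC])
  show thesis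
  proof (rule that)
    show S': "open S'" unfolding S'_def by (intro open_Int open_ball open_vimage S contF)
    show "0 \<in> S'" using S \<open>F 0 = x\<close> k by (simp add: S'_def)
    have "smooth_on S' F" unfolding F_def
      by (intro smooth_on_diff smooth_on_add smooth_on_const smooth_on_ident S'
          smooth_on_linear_compose[OF S' bounded_linear_scaleR_right] smooth_on_bilinear[OF S' bb])
    then show "holomorphic_map_on S' F"
      using ddF christoffel_J_right[OF S(1) K S(2)]
      by (simp add: holomorphic_map_on_def frechet_derivative_eq_dd J_def[symmetric]
          linear_diff[OF linear_J])
    show "F ` S' \<subseteq> S" by (auto simp: S'_def)
    show "bij (\<lambda>v. dd v F y)" if y: "y \<in> S'" for y
    proof -
      have lin: "linear (\<lambda>v. dd v F y)" using der linear_dd differentiableI by blast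
      have "v = 0" if "dd v F y = 0" for v
      proof (rule ccontr)
        assume v: "v \<noteq> 0"
        have "norm v = norm (?C y v)" using that ddF by simp
        also have "\<dots> \<le> norm y * norm v * k" by (rule k(2))
        also have "\<dots> < 1 / k * norm v * k"
          using y v k(1) by (intro mult_strict_right_mono) (auto simp: S'_def)
        finally show False using k(1) by simp
      qed
      then have "inj (\<lambda>v. dd v F y)" using linear_injective_0[OF lin] by blast
      then show ?thesis using linear_injective_imp_surjective[OF lin] by (simp add: bij_def)
    qed
  qed (use ddF \<open>F 0 = x\<close> in auto)
qed

text \<open>On the diagonal the first derivative is \<open>dd a (\<lambda>y. G y v v) x\<close>
  minus twice the pairing of \<open>v\<close> with the Christoffel vector, which is zero by
  compatibility; polarisation gives the rest. For the Levi form, the cross terms along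
  \<open>w\<close> and \<open>J w\<close> add up to -8 squares of the Christoffel vector and the
  quadratic terms to +4.\<close>

lemma
  fixes G :: "(complex ^ 'n::finite) metric_field"
  assumes S: "open S" "x \<in> S" and K: "kaehler_metric_on S G"
    and S': "open S'" "0 \<in> S'" and F: "holomorphic_map_on S' F" "F ` S' \<subseteq> S" "F 0 = x"
    and bij: "\<And>y. y \<in> S' \<Longrightarrow> bij (\<lambda>v. dd v F y)"
    and ddF: "\<And>y v. dd v F y = v - christoffel G x y v"
  defines "G' \<equiv> \<lambda>y u w. G (F y) (dd u F y) (dd w F y)"
  shows normal_metric_flat: "dd a (\<lambda>y. G' y u w) 0 = 0"
    and levi_normal_metric: "levi (\<lambda>y. G' y v v) 0 w w
      = levi (\<lambda>y. G y v v) x w w - 4 * G x (christoffel G x w v) (christoffel G x w v)"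
proof -
  note G = kaehler_riemannian[OF S(1) K]
  let ?C = "christoffel G x"
  have blC: "bilinear ?C" by (rule bilinear_christoffel[OF S(1) G S(2)])
  note sG = metric_smooth[OF S(1) G] and bG = metric_bilinear[OF S(1) G]
  have sF: "smooth_on S' F" using F by (simp add: holomorphic_map_on_def)
  have G': "riemannian_metric_on S' G'"
    unfolding G'_def by (rule riemannian_metric_pullback[OF S(1) G S'(1) sF F(2) bij])
  note sG' = metric_smooth[OF S'(1) G'] and bG' = metric_bilinear[OF S'(1) G']
  define k where "k a b y = G (F y) a b" for a b y
  have sk: "smooth_on S' (k a b)" for a b
    unfolding k_def by (rule smooth_on_compose[OF S(1) S'(1) F(2) sF sG])
  have ddF0: "dd u F 0 = u" for u using ddF[of u 0] by (simp add: bilinear_lzero[OF blC])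
  have dk: "dd u (k a b) 0 = dd u (\<lambda>y. G y a b) x" for u a b
    using dd_compose[OF smooth_onD_differentiable[OF sF S'(2)], of "\<lambda>y. G y a b" u]
      smooth_onD_differentiable[OF sG S(2)] by (simp add: ddF0 F(3) k_def[abs_def])
  have line: "G' (r *\<^sub>R w) v v = k v v (r *\<^sub>R w) - 2 * r * k v (?C w v) (r *\<^sub>R w)
      + r * r * k (?C w v) (?C w v) (r *\<^sub>R w)" if "r *\<^sub>R w \<in> S'" for r v w
  proof -
    have y: "F (r *\<^sub>R w) \<in> S" using F that by blast
    show ?thesis
      using metric_sym[OF S(1) G y, of "?C w v" v]
      by (simp add: G'_def ddF k_def bilinear_lmul[OF blC] bilinear_lsub[OF bG[OF y]] bilinear_rsub[OF bG[OF y]]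
          bilinear_lmul[OF bG[OF y]] bilinear_rmul[OF bG[OF y]] algebra_simps)
  qed
  have "dd a (\<lambda>y. G' y v v) 0 = 0" for v
    using dd_quadratic_line[OF S' sG' sk sk sk line, of a v] metric_compatible[OF S(1) G S(2), of a v v]
      metric_sym[OF S(1) G S(2), of "?C a v" v]
    by (simp add: dk) (simp add: k_def F(3))
  note diag = this
  have bD: "bilinear (\<lambda>u w. dd a (\<lambda>y. G' y u w) 0)" by (rule bilinear_dd[OF S' sG' bG'])
  have symD: "dd a (\<lambda>y. G' y u w) 0 = dd a (\<lambda>y. G' y w u) 0"
    by (rule dd_metric_sym[OF S'(1) G' S'(2)])
  show "dd a (\<lambda>y. G' y u w) 0 = 0"
    using diag[of "u + w"] symD by (simp add: bilinear_ladd[OF bD] bilinear_radd[OF bD] diag)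
  have lk: "levi (k v v) 0 w w = levi (\<lambda>y. G y v v) x w w"
    using levi_compose[OF S(1) S' F(1,2) sG, of v v w w] by (simp add: ddF0 F(3) k_def[abs_def])
  have 1: "dd w (dd w (\<lambda>y. G' y v v)) 0 = dd w (dd w (k v v)) 0 - 4 * dd w (\<lambda>y. G y v (?C w v)) x
      + 2 * G x (?C w v) (?C w v)" for w
    using dd_dd_quadratic_line[OF S' sG' sk sk sk line, of w v] by (simp add: dk) (simp add: k_def F(3))
  show "levi (\<lambda>y. G' y v v) 0 w w = levi (\<lambda>y. G y v v) x w w - 4 * G x (?C w v) (?C w v)"
    using 1[of w] 1[of "J w"] lk kaehler_christoffel[OF S(1) K S(2), of w v "?C w v"]
    by (simp add: levi_def christoffel_J_left[OF S(1) K S(2)] metric_J[OF S(1) K S(2)])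
qed

text \<open>Both sides are unchanged by a holomorphic coordinate change whose differential at 0 is
  the identity, so the estimate at a minimum in normal coordinates applies. The weights
  \<open>s\<close> and \<open>c\<close> will be the two coefficients of the barrier.\<close>

proposition levi_evolution_inequality:
  fixes G :: "(complex ^ 'n::finite) metric_field"
  assumes S: "open S" "x \<in> S" and K: "kaehler_metric_on S G" and h: "smooth_on S h" and s: "s > 0"
    and curv: "\<And>w. G x (Rm G x w v v) w + G x (Rm G x w (J v) (J v)) w \<ge> 0"
    and nonneg: "\<And>y u. y \<in> S \<Longrightarrow> s * levi h y u u + c * G y u u \<ge> 0"
    and zero: "s * levi h x v v + c * G x v v = 0"
  shows "(levi h x v v)\<^sup>2 \<le> G x v v * levi (evolution G h) x v v"
proof -
  note G = kaehler_riemannian[OF S(1) K]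
  let ?C = "christoffel G x"
  obtain S' F where S': "open S'" "0 \<in> S'" and F: "holomorphic_map_on S' F" "F ` S' \<subseteq> S" "F 0 = x"
    and bij: "\<And>y. y \<in> S' \<Longrightarrow> bij (\<lambda>v. dd v F y)"
    and ddF: "\<And>y v. dd v F y = v - ?C y v"
    using kaehler_normal_coordinates[OF S K] by metis
  define G' where "G' = (\<lambda>y u w. G (F y) (dd u F y) (dd w F y))"
  have sF: "smooth_on S' F" using F by (simp add: holomorphic_map_on_def)
  have G': "riemannian_metric_on S' G'"
    unfolding G'_def by (rule riemannian_metric_pullback[OF S(1) G S'(1) sF F(2) bij])
  have flat: "dd a (\<lambda>y. G' y u w) 0 = 0" for a u w
    unfolding G'_def by (rule normal_metric_flat[OF S K S' F bij ddF])
  have lG': "levi (\<lambda>y. G' y v v) 0 w w = levi (\<lambda>y. G y v v) x w w - 4 * G x (?C w v) (?C w v)" for v w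
    unfolding G'_def by (rule levi_normal_metric[OF S K S' F bij ddF])
  have ddF0: "dd u F 0 = u" for u
    using ddF[of u 0] by (simp add: bilinear_lzero[OF bilinear_christoffel[OF S(1) G S(2)]])
  have G'0: "G' 0 u w = G x u w" for u w by (simp add: G'_def ddF0 F(3))
  define h' where "h' y = h (F y)" for y
  have h': "smooth_on S' h'" unfolding h'_def by (rule smooth_on_compose[OF S(1) S'(1) F(2) sF h])
  have FS: "F y \<in> S" if "y \<in> S'" for y using F that by blast
  have lh: "levi h' y u w = levi h (F y) (dd u F y) (dd w F y)" if "y \<in> S'" for y u w
    unfolding h'_def by (rule levi_compose[OF S(1) S'(1) that F(1,2) h])
  have lh0: "levi h' 0 u w = levi h x u w" for u w using lh[OF S'(2)] by (simp add: ddF0 F(3))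
  have ev: "1/2 * trace_form (G' y) (levi h' y) + G' y (gradient G' h' y) (gradient G' h' y)
      = evolution G h (F y)" if y: "y \<in> S'" for y
  proof -
    note ip = metric_inner_form[OF S(1) G FS[OF y]]
    have "trace_form (G' y) (levi h' y) = trace_form (G (F y)) (levi h (F y))"
      unfolding h'_def G'_def by (rule trace_levi_compose[OF S(1) S'(1) y F(1,2) h ip bij[OF y]])
    moreover have "dd (gradient G' h' y) F y = gradient G h (F y)"
      unfolding h'_def
      by (rule gradient_compose[where G = G, OF smooth_onD_differentiable[OF sF y] smooth_onD_differentiable[OF h FS[OF y]] ip bij[OF y]])
        (simp add: G'_def)
    ultimately show ?thesis by (simp add: evolution_def G'_def)
  qed
  have "(levi h' 0 v v)\<^sup>2 \<le> G' 0 v v * levi (\<lambda>y. 1/2 * trace_form (G' y) (levi h' y)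
      + G' y (gradient G' h' y) (gradient G' h' y)) 0 v v"
  proof (rule levi_evolution_at_minimum[OF S' G' flat h' s])
    \<comment> \<open>In normal coordinates this quantity is minus twice the bisectional curvature
      of \<open>w\<close> and \<open>v\<close>.\<close>
    show "levi (\<lambda>y. G' y w w) 0 v v \<le> 0" for w
      using curv[of w] unfolding bisectional_curvature_eq[OF S(1) K S(2)] lG' by simp
    show "levi (\<lambda>y. G' y w w) 0 v v = levi (\<lambda>y. G' y v v) 0 w w" for w
      unfolding lG' levi_metric_exchange[OF S(1) K S(2), of w v] christoffel_sym[OF S(1) G S(2), of v w] ..
    show "G' 0 (J v) (J v) = G' 0 v v"
      unfolding G'0 by (rule metric_J[OF S(1) K S(2)])
    show "s * levi h' y u u + c * G' y u u \<ge> 0" if "y \<in> S'" for y u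
      unfolding lh[OF that] G'_def by (rule nonneg[OF FS[OF that]])
    show "s * levi h' 0 v v + c * G' 0 v v = 0"
      unfolding lh0 G'0 by (rule zero)
  qed
  also have "levi (\<lambda>y. 1/2 * trace_form (G' y) (levi h' y) + G' y (gradient G' h' y) (gradient G' h' y)) 0 v v
      = levi (\<lambda>y. evolution G h (F y)) 0 v v"
    by (rule levi_cong[OF S' ev])
  also have "\<dots> = levi (evolution G h) x v v"
    using levi_compose[OF S(1) S' F(1,2) smooth_on_evolution[OF S(1) G h]] by (simp add: ddF0 F(3))
  finally show ?thesis unfolding lh0 G'0 .
qed

section \<open>Charts of a Kaehler manifold\<close>

lemma local_rep_apply: "local_rep c h x = h (chart_inv c x)"
  by (simp add: local_rep_def)

text \<open>The chain rule gives the differential a left inverse; injectivity suffices by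
  dimension.\<close>

lemma bij_dd_inverse:
  fixes F :: "'e::euclidean_space \<Rightarrow> 'e"
  assumes O: "open O1" "x \<in> O1" and F: "F differentiable (at x)" and F': "F' differentiable (at (F x))"
    and inv: "\<And>y. y \<in> O1 \<Longrightarrow> F' (F y) = y"
  shows "bij (\<lambda>v. dd v F x)"
proof -
  have "dd (dd v F x) F' (F x) = v" for v
  proof -
    have "dd v (\<lambda>y. F' (F y)) x = dd v (\<lambda>y. y) x" by (rule dd_cong[OF O inv])
    then show ?thesis using dd_compose[OF F F'] by (simp add: dd_ident)
  qed
  then have "inj (\<lambda>v. dd v F x)" by (rule inj_on_inverseI)
  then show ?thesis using linear_injective_imp_surjective[OF linear_dd[OF F]] by (simp add: bij_def)
qed

context
  fixes A :: "('m::{t2_space, second_countable_topology}, 'n::finite) chart set"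
    and g :: "('m, 'n) metric_tensor"
  assumes kaehler: "kaehler_manifold A g"
begin

lemma chart_homeomorphism: "c \<in> A \<Longrightarrow> homeomorphism (chart_dom c) (coords c ` chart_dom c) (coords c) (chart_inv c)"
  using kaehler by (simp add: kaehler_manifold_def holomorphic_atlas_def)

lemma open_chart_dom: "c \<in> A \<Longrightarrow> open (chart_dom c)"
  using kaehler by (simp add: kaehler_manifold_def holomorphic_atlas_def)

lemma open_coords_image: "c \<in> A \<Longrightarrow> open (coords c ` chart_dom c)"
  using kaehler by (simp add: kaehler_manifold_def holomorphic_atlas_def)

lemma chart_metric: "c \<in> A \<Longrightarrow> kaehler_metric_on (coords c ` chart_dom c) (g c)"
  using kaehler by (simp add: kaehler_manifold_def)

lemma chart_metric_riemannian: "c \<in> A \<Longrightarrow> riemannian_metric_on (coords c ` chart_dom c) (g c)"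
  using chart_metric by (simp add: kaehler_metric_on_def)

lemma chart_inv_coords: "c \<in> A \<Longrightarrow> p \<in> chart_dom c \<Longrightarrow> chart_inv c (coords c p) = p"
  using homeomorphism_apply1[OF chart_homeomorphism] .

lemma obtain_chart: obtains c where "c \<in> A" "p \<in> chart_dom c"
proof -
  have "(\<Union>c\<in>A. chart_dom c) = UNIV"
    using kaehler by (simp add: kaehler_manifold_def holomorphic_atlas_def)
  then have "p \<in> (\<Union>c\<in>A. chart_dom c)" by simp
  then show thesis using that by blast
qed

lemma chart_at: "chart_at A p \<in> A" "p \<in> chart_dom (chart_at A p)"
  using someI_ex[of "\<lambda>c. c \<in> A \<and> p \<in> chart_dom c"] obtain_chart[of p] unfolding chart_at_def by blast+

lemma open_overlap:
  assumes "c \<in> A" "c' \<in> A"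
  shows "open (coords c ` (chart_dom c \<inter> chart_dom c'))"
proof -
  have "openin (top_of_set (chart_dom c)) (chart_dom c \<inter> chart_dom c')"
    using open_chart_dom[OF assms(2)] by (simp add: openin_open_Int)
  then have "openin (top_of_set (coords c ` chart_dom c)) (coords c ` (chart_dom c \<inter> chart_dom c'))"
    using homeomorphism_imp_open_map[OF chart_homeomorphism[OF assms(1)]] by blast
  then show ?thesis using openin_open_trans open_coords_image[OF assms(1)] by blast
qed

lemma holomorphic_transition:
  "c \<in> A \<Longrightarrow> c' \<in> A \<Longrightarrow> holomorphic_map_on (coords c ` (chart_dom c \<inter> chart_dom c')) (transition c c')"
  using kaehler by (simp add: kaehler_manifold_def holomorphic_atlas_def)

lemma transition_coords: "c \<in> A \<Longrightarrow> p \<in> chart_dom c \<Longrightarrow> transition c c' (coords c p) = coords c' p"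
  by (simp add: transition_def chart_inv_coords)

lemma transition_image:
  "c \<in> A \<Longrightarrow> transition c c' ` (coords c ` (chart_dom c \<inter> chart_dom c')) \<subseteq> coords c' ` chart_dom c'"
  by (auto simp: transition_coords)

lemma transition_differentiable:
  "c \<in> A \<Longrightarrow> c' \<in> A \<Longrightarrow> p \<in> chart_dom c \<inter> chart_dom c' \<Longrightarrow> transition c c' differentiable (at (coords c p))"
  using holomorphic_transition smooth_onD_differentiable unfolding holomorphic_map_on_def by blast

lemma bij_dd_transition:
  assumes c: "c \<in> A" "c' \<in> A" and p: "p \<in> chart_dom c \<inter> chart_dom c'"
  shows "bij (\<lambda>v. dd v (transition c c') (coords c p))"
proof (rule bij_dd_inverse[OF open_overlap[OF c] _ transition_differentiable[OF c p]])
  show "coords c p \<in> coords c ` (chart_dom c \<inter> chart_dom c')" using p by blast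
  show "transition c' c differentiable (at (transition c c' (coords c p)))"
    using transition_differentiable[OF c(2,1), of p] p by (simp add: transition_coords[OF c(1)])
  show "transition c' c (transition c c' y) = y" if "y \<in> coords c ` (chart_dom c \<inter> chart_dom c')" for y
    using that c by (auto simp: transition_coords)
qed

lemma metric_transition:
  assumes "c \<in> A" "c' \<in> A" "p \<in> chart_dom c \<inter> chart_dom c'"
  shows "g c (coords c p) u v = g c' (coords c' p)
    (dd u (transition c c') (coords c p)) (dd v (transition c c') (coords c p))"
  using kaehler assms unfolding kaehler_manifold_def dd_def by blast

lemma local_rep_transition:
  "c \<in> A \<Longrightarrow> c' \<in> A \<Longrightarrow> y \<in> coords c ` (chart_dom c \<inter> chart_dom c') \<Longrightarrow>
    local_rep c h y = local_rep c' h (transition c c' y)"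
  by (auto simp: local_rep_apply transition_coords chart_inv_coords)

lemma levi_transition:
  assumes c: "c \<in> A" "c' \<in> A" and p: "p \<in> chart_dom c \<inter> chart_dom c'" and h: "smooth_fun A h"
  shows "levi (local_rep c h) (coords c p) u v = levi (local_rep c' h) (coords c' p)
    (dd u (transition c c') (coords c p)) (dd v (transition c c') (coords c p))"
proof -
  let ?O = "coords c ` (chart_dom c \<inter> chart_dom c')"
  have x: "coords c p \<in> ?O" using p by blast
  have "levi (local_rep c h) (coords c p) u v
      = levi (\<lambda>y. local_rep c' h (transition c c' y)) (coords c p) u v"
    by (rule levi_cong[OF open_overlap[OF c] x]) (rule local_rep_transition[OF c])
  also have "\<dots> = levi (local_rep c' h) (transition c c' (coords c p))
      (dd u (transition c c') (coords c p)) (dd v (transition c c') (coords c p))"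
    using h c by (intro levi_compose[OF open_coords_image[OF c(2)] open_overlap[OF c] x
          holomorphic_transition[OF c] transition_image[OF c(1)]]) (simp add: smooth_fun_def)
  finally show ?thesis using p by (simp add: transition_coords[OF c(1)])
qed

text \<open>\<open>Laplacian\<close> uses an arbitrary choice of chart. The metric and the Levi form
  are pulled back by the same differential of the transition map, so the trace does not see the
  choice.\<close>

lemma Laplacian_chart:
  assumes c: "c \<in> A" and p: "p \<in> chart_dom c" and h: "smooth_fun A h"
  shows "Laplacian A g h p = 1/2 * trace_form (g c (coords c p)) (levi (local_rep c h) (coords c p))"
proof -
  define c' where "c' = chart_at A p"
  have c': "c' \<in> A" and p': "p \<in> chart_dom c \<inter> chart_dom c'" using chart_at p by (auto simp: c'_def)
  have sm: "smooth_on (coords c' ` chart_dom c') (local_rep c' h)" using h c' by (simp add: smooth_fun_def)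
  let ?x = "coords c p" and ?x' = "coords c' p" and ?F = "transition c c'"
  have x': "?x' \<in> coords c' ` chart_dom c'" using p' by blast
  have ip: "inner_form (g c' ?x')" by (rule riemannian_metric_inner_form[OF chart_metric_riemannian[OF c'] x'])
  have "g c ?x = (\<lambda>u w. g c' ?x' (dd u ?F ?x) (dd w ?F ?x))"
    by (intro ext metric_transition c c' p')
  moreover have "levi (local_rep c h) ?x = (\<lambda>u w. levi (local_rep c' h) ?x' (dd u ?F ?x) (dd w ?F ?x))"
    by (intro ext levi_transition c c' p' h)
  ultimately have "trace_form (g c ?x) (levi (local_rep c h) ?x) = trace_form (g c' ?x') (levi (local_rep c' h) ?x')"
    using trace_form_pullback[OF ip linear_dd[OF transition_differentiable[OF c c' p']] bij_dd_transition[OF c c' p']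
        bilinear_levi[OF open_coords_image[OF c'] x' sm]] by simp
  then show ?thesis
    using laplace_beltrami_eq_trace_levi[OF open_coords_image[OF c'] chart_metric[OF c'] x' sm]
    by (simp add: Laplacian_def Let_def c'_def[symmetric])
qed

lemma grad_inner_chart:
  assumes c: "c \<in> A" and p: "p \<in> chart_dom c" and h: "smooth_fun A h" "smooth_fun A h'"
  shows "grad_inner A g h h' p = g c (coords c p) (gradient (g c) (local_rep c h) (coords c p))
    (gradient (g c) (local_rep c h') (coords c p))"
proof -
  define c' where "c' = chart_at A p"
  have c': "c' \<in> A" and p': "p \<in> chart_dom c \<inter> chart_dom c'" using chart_at p by (auto simp: c'_def)
  let ?x = "coords c p" and ?x' = "coords c' p" and ?F = "transition c c'"
  let ?O = "coords c ` (chart_dom c \<inter> chart_dom c')"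
  have x': "?x' \<in> coords c' ` chart_dom c'" and x: "?x \<in> ?O" using p' by blast+
  have Fx: "?F ?x = ?x'" using transition_coords[OF c] p by blast
  have grad: "dd (gradient (g c) (local_rep c h) ?x) ?F ?x = gradient (g c') (local_rep c' h) ?x'"
    if h: "smooth_fun A h" for h
  proof -
    have sm: "smooth_on (coords c' ` chart_dom c') (local_rep c' h)" using h c' by (simp add: smooth_fun_def)
    have "frechet_derivative (local_rep c h) (at ?x) = frechet_derivative (\<lambda>y. local_rep c' h (?F y)) (at ?x)"
      unfolding frechet_derivative_eq_dd
      by (intro ext dd_cong[OF open_overlap[OF c c'] x] local_rep_transition[OF c c'])
    then have "gradient (g c) (local_rep c h) ?x = gradient (g c) (\<lambda>y. local_rep c' h (?F y)) ?x"
      by (simp add: gradient_def)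
    moreover have "dd (gradient (g c) (\<lambda>y. local_rep c' h (?F y)) ?x) ?F ?x = gradient (g c') (local_rep c' h) (?F ?x)"
    proof (rule gradient_compose[OF transition_differentiable[OF c c' p'] _ _ bij_dd_transition[OF c c' p']])
      show "local_rep c' h differentiable (at (?F ?x))"
        unfolding Fx by (rule smooth_onD_differentiable[OF sm x'])
      show "inner_form (g c' (?F ?x))"
        unfolding Fx by (rule riemannian_metric_inner_form[OF chart_metric_riemannian[OF c'] x'])
      show "g c ?x = (\<lambda>u w. g c' (?F ?x) (dd u ?F ?x) (dd w ?F ?x))"
        unfolding Fx by (intro ext metric_transition c c' p')
    qed
    ultimately show ?thesis by (simp add: Fx)
  qed
  show ?thesis
    unfolding metric_transition[OF c c' p'] grad[OF h(1)] grad[OF h(2)]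
    by (simp add: grad_inner_def Let_def c'_def)
qed

end

section \<open>Functions of time and space\<close>

lemma smooth_on_Pair_left: "open D \<Longrightarrow> smooth_on D (\<lambda>x. (t, x :: 'a::euclidean_space))"
  for t :: "'b::euclidean_space"
proof -
  assume D: "open D"
  have "smooth_on D (\<lambda>x. (t, 0) + (\<lambda>x::'a. (0::'b, x)) x)"
    by (intro smooth_on_add[OF D smooth_on_const] smooth_on_linear_compose[OF D _ smooth_on_ident[OF D]]
        bounded_linear_Pair bounded_linear_zero bounded_linear_ident)
  then show "smooth_on D (\<lambda>x. (t, x))" by simp
qed

context
  fixes I :: "real set" and D :: "'a::euclidean_space set" and P :: "real \<times> 'a \<Rightarrow> real"
  assumes ID: "open I" "open D" and P: "smooth_on (I \<times> D) P"
begin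

lemma smooth_on_slice:
  assumes "t \<in> I"
  shows "smooth_on D (\<lambda>x. P (t, x))"
  using assms by (intro smooth_on_compose[OF open_Times[OF ID] ID(2) _ smooth_on_Pair_left[OF ID(2)] P]) auto

lemma dd_slice:
  assumes "t \<in> I" "x \<in> D"
  shows "dd v (\<lambda>x. P (t, x)) x = dd (0, v) P (t, x)"
proof -
  have "((\<lambda>x. (t, x)) has_derivative (\<lambda>v. (0, v))) (at x)"
    by (intro has_derivative_Pair has_derivative_const has_derivative_ident)
  from has_derivative_compose[OF this smooth_on_has_derivative[OF P]] show ?thesis
    using assms by (intro dd_eqI) auto
qed

lemma has_real_derivative_time:
  assumes "t \<in> I" "x \<in> D"
  shows "((\<lambda>s. P (s, x)) has_real_derivative dd (1, 0) P (t, x)) (at t)"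
proof -
  have tx: "(t, x) \<in> I \<times> D" using assms by simp
  have "((\<lambda>s. (s, x)) has_derivative (\<lambda>h. (h, 0))) (at t)"
    by (intro has_derivative_Pair has_derivative_const has_derivative_ident)
  from has_derivative_compose[OF this smooth_on_has_derivative[OF P]]
  have "((\<lambda>s. P (s, x)) has_derivative (\<lambda>h. dd (h, 0) P (t, x))) (at t)"
    using assms by auto
  moreover have "dd (h, 0) P (t, x) = dd (1, 0) P (t, x) * h" for h
    using linear_scale[OF linear_dd[OF smooth_onD_differentiable[OF P tx]], of h "(1, 0)"] by simp
  then have "(\<lambda>h. dd (h, 0) P (t, x)) = (*) (dd (1, 0) P (t, x))" by (rule ext)
  ultimately show ?thesis unfolding has_field_derivative_def by (simp only:)
qed

end

text \<open>A slice derivative in direction \<open>v\<close> is a joint derivative in direction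
  \<open>(0, v)\<close>, so the time derivative commutes with the spatial ones by symmetry of second
  derivatives on the product.\<close>

lemma
  fixes I :: "real set" and D :: "(complex ^ 'n::finite) set" and P :: "real \<times> (complex ^ 'n) \<Rightarrow> real"
  assumes ID: "open I" "open D" and P: "smooth_on (I \<times> D) P" and t: "t \<in> I" and x: "x \<in> D"
  shows levi_slice: "levi (\<lambda>x. P (t, x)) x u v
      = dd (0, u) (dd (0, v) P) (t, x) + dd (0, J u) (dd (0, J v) P) (t, x)"
    and has_real_derivative_levi: "((\<lambda>s. levi (\<lambda>x. P (s, x)) x v v) has_real_derivative
      levi (\<lambda>x. dd (1, 0) P (t, x)) x v v) (at t)"
proof -
  have dds: "dd a (dd b (\<lambda>x. Q (t, x))) x = dd (0, a) (dd (0, b) Q) (t, x)"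
    if "smooth_on (I \<times> D) Q" "t \<in> I" for Q :: "real \<times> (complex ^ 'n) \<Rightarrow> real" and a b t
  proof -
    have "dd a (dd b (\<lambda>x. Q (t, x))) x = dd a (\<lambda>x. dd (0, b) Q (t, x)) x"
      by (rule dd_cong[OF ID(2) x]) (rule dd_slice[OF ID that])
    then show ?thesis using dd_slice[OF ID smooth_on_dd[OF that(1)] that(2) x] by simp
  qed
  have lev: "levi (\<lambda>x. Q (t, x)) x u v = dd (0, u) (dd (0, v) Q) (t, x) + dd (0, J u) (dd (0, J v) Q) (t, x)"
    if "smooth_on (I \<times> D) Q" "t \<in> I" for Q :: "real \<times> (complex ^ 'n) \<Rightarrow> real" and u v t
    unfolding levi_def dds[OF that] ..
  show "levi (\<lambda>x. P (t, x)) x u v = dd (0, u) (dd (0, v) P) (t, x) + dd (0, J u) (dd (0, J v) P) (t, x)"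
    by (rule lev[OF P t])
  let ?Q = "\<lambda>q. dd (0, v) (dd (0, v) P) q + dd (0, J v) (dd (0, J v) P) q"
  note op = open_Times[OF ID] and tx = SigmaI[OF t x]
  have sQ: "smooth_on (I \<times> D) ?Q" using P op by (intro smooth_on_add smooth_on_dd)
  have comm: "dd (1, 0) (dd (0, a) (dd (0, a) P)) (t, x) = dd (0, a) (dd (0, a) (dd (1, 0) P)) (t, x)" for a
  proof -
    have "dd (1, 0) (dd (0, a) (dd (0, a) P)) (t, x) = dd (0, a) (dd (1, 0) (dd (0, a) P)) (t, x)"
      by (rule dd_commute[OF op tx smooth_on_dd[OF P]])
    also have "\<dots> = dd (0, a) (dd (0, a) (dd (1, 0) P)) (t, x)"
      by (rule dd_cong[OF op tx]) (rule dd_commute[OF op _ P])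
    finally show ?thesis .
  qed
  have "dd (1, 0) ?Q (t, x) = levi (\<lambda>x. dd (1, 0) P (t, x)) x v v"
    unfolding lev[OF smooth_on_dd[OF P] t]
      dd_add[OF smooth_onD_differentiable[OF smooth_on_dd[OF smooth_on_dd[OF P]] tx]
        smooth_onD_differentiable[OF smooth_on_dd[OF smooth_on_dd[OF P]] tx]] comm ..
  then have "((\<lambda>s. ?Q (s, x)) has_real_derivative levi (\<lambda>x. dd (1, 0) P (t, x)) x v v) (at t)"
    using has_real_derivative_time[OF ID sQ t x] by simp
  then show "((\<lambda>s. levi (\<lambda>x. P (s, x)) x v v) has_real_derivative levi (\<lambda>x. dd (1, 0) P (t, x)) x v v) (at t)"
    by (rule has_field_derivative_transform_within_open[OF _ ID(1) t]) (simp add: lev[OF P])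
qed

text \<open>Time, point and direction converge simultaneously, as the compactness argument requires.
  The expansion in \<open>Basis\<close> reduces this to continuity for fixed vectors.\<close>

lemma
  fixes I :: "real set" and D :: "(complex ^ 'n::finite) set" and P :: "real \<times> (complex ^ 'n) \<Rightarrow> real"
  assumes ID: "open I" "open D" and x: "X \<longlonglongrightarrow> x" "x \<in> D" "\<And>n. X n \<in> D" and v: "V \<longlonglongrightarrow> v"
  shows tendsto_metric: "riemannian_metric_on D G \<Longrightarrow> (\<lambda>n. G (X n) (V n) (V n)) \<longlonglongrightarrow> G x v v"
    and tendsto_levi_slice: "smooth_on (I \<times> D) P \<Longrightarrow> \<tau> \<longlonglongrightarrow> t \<Longrightarrow> t \<in> I \<Longrightarrow> (\<And>n. \<tau> n \<in> I) \<Longrightarrow>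
      (\<lambda>n. levi (\<lambda>y. P (\<tau> n, y)) (X n) (V n) (V n)) \<longlonglongrightarrow> levi (\<lambda>y. P (t, y)) x v v"
proof -
  assume G: "riemannian_metric_on D G"
  have "(\<lambda>n. G (X n) a b) \<longlonglongrightarrow> G x a b" for a b
    using x by (intro continuous_on_tendsto_compose[OF smooth_on_continuous[OF riemannian_metric_smooth[OF G]]]) auto
  then have "(\<lambda>n. \<Sum>a\<in>Basis. \<Sum>b\<in>Basis. (V n \<bullet> a) * (V n \<bullet> b) * G (X n) a b)
      \<longlonglongrightarrow> (\<Sum>a\<in>Basis. \<Sum>b\<in>Basis. (v \<bullet> a) * (v \<bullet> b) * G x a b)"
    by (intro tendsto_intros v)
  note lim = this
  have eq: "G y w w = (\<Sum>a\<in>Basis. \<Sum>b\<in>Basis. (w \<bullet> a) * (w \<bullet> b) * G y a b)" if "y \<in> D" for y w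
    by (rule bilinear_Basis_expansion[OF metric_bilinear[OF ID(2) G that]])
  show "(\<lambda>n. G (X n) (V n) (V n)) \<longlonglongrightarrow> G x v v"
    unfolding eq[OF x(2)] eq[OF x(3)] by (rule lim)
next
  assume P: "smooth_on (I \<times> D) P" and t: "\<tau> \<longlonglongrightarrow> t" "t \<in> I" "\<And>n. \<tau> n \<in> I"
  let ?Q = "\<lambda>a b q. dd (0, a) (dd (0, b) P) q + dd (0, J a) (dd (0, J b) P) q"
  have cQ: "continuous_on (I \<times> D) (?Q a b)" for a b
    by (intro smooth_on_continuous smooth_on_add open_Times ID smooth_on_dd P)
  have limQ: "(\<lambda>n. ?Q a b (\<tau> n, X n)) \<longlonglongrightarrow> ?Q a b (t, x)" for a b
    using x t by (intro continuous_on_tendsto_compose[OF cQ] tendsto_Pair) auto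
  have lim: "(\<lambda>n. \<Sum>a\<in>Basis. \<Sum>b\<in>Basis. (V n \<bullet> a) * (V n \<bullet> b) * ?Q a b (\<tau> n, X n))
      \<longlonglongrightarrow> (\<Sum>a\<in>Basis. \<Sum>b\<in>Basis. (v \<bullet> a) * (v \<bullet> b) * ?Q a b (t, x))"
    by (intro tendsto_sum tendsto_mult tendsto_inner tendsto_const v limQ)
  have eq: "levi (\<lambda>y. P (s, y)) y w w = (\<Sum>a\<in>Basis. \<Sum>b\<in>Basis. (w \<bullet> a) * (w \<bullet> b) * ?Q a b (s, y))"
    if "s \<in> I" "y \<in> D" for s y w
    using bilinear_Basis_expansion[OF bilinear_levi[OF ID(2) that(2) smooth_on_slice[OF ID P that(1)]], of w w]
    by (simp only: levi_slice[OF ID P that])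
  show "(\<lambda>n. levi (\<lambda>y. P (\<tau> n, y)) (X n) (V n) (V n)) \<longlonglongrightarrow> levi (\<lambda>y. P (t, y)) x v v"
    unfolding eq[OF t(2) x(2)] eq[OF t(3) x(3)] by (rule lim)
qed

section \<open>The maximum principle\<close>

context
  fixes A :: "('m::{t2_space, second_countable_topology}, 'n::finite) chart set"
    and g :: "('m, 'n) metric_tensor"
    and h :: "real \<Rightarrow> 'm \<Rightarrow> real" and W :: "'m \<Rightarrow> real" and T k :: real
  assumes kaehler: "kaehler_manifold A g"
    and compact: "compact (UNIV :: 'm set)"
    and h: "smooth_time_fun A {0<..<T} h" and W: "smooth_fun A W"
    and flow: "\<And>c t x. c \<in> A \<Longrightarrow> t \<in> {0<..<T} \<Longrightarrow> x \<in> coords c ` chart_dom c \<Longrightarrow>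
      ((\<lambda>s. local_rep c (h s) x) has_real_derivative
        evolution (g c) (local_rep c (h t)) x - 1/2 * local_rep c W x) (at t)"
    and curv: "nonneg_bisectional_curvature A g"
    and levi_W: "\<And>c x v. c \<in> A \<Longrightarrow> x \<in> coords c ` chart_dom c \<Longrightarrow>
      levi (local_rep c W) x v v \<le> 2 * k\<^sup>2 * g c x v v"
begin

lemma smooth_joint: "c \<in> A \<Longrightarrow> smooth_on ({0<..<T} \<times> coords c ` chart_dom c) (\<lambda>(t, x). local_rep c (h t) x)"
  using h by (simp add: smooth_time_fun_def)

lemma smooth_at_time: "t \<in> {0<..<T} \<Longrightarrow> smooth_fun A (h t)"
  using smooth_on_slice[OF open_greaterThanLessThan open_coords_image[OF kaehler] smooth_joint]
  by (simp add: smooth_fun_def)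

text \<open>
  \<open>\<lambda> = - \<kappa> coth (\<kappa> (t - \<epsilon>))\<close> solves \<open>\<lambda>' = \<lambda>\<^sup>2 - \<kappa>\<^sup>2\<close> and tends to \<open>- \<infinity>\<close> as \<open>t \<rightarrow> \<epsilon>\<close>. The barrier is
  \<open>levi h - \<lambda> g\<close> multiplied by \<open>sinh (\<kappa> (t - \<epsilon>))\<close>, which makes it continuous and positive at \<open>t = \<epsilon>\<close>.
  Taking \<open>\<kappa> > \<bar>k\<bar>\<close> makes the evolution inequality strict.
\<close>

definition barrier :: "real \<Rightarrow> real \<Rightarrow> ('m, 'n) chart \<Rightarrow> real \<Rightarrow> complex ^ 'n \<Rightarrow> complex ^ 'n \<Rightarrow> real" where
  "barrier \<kappa> \<epsilon> c t x v = sinh (\<kappa> * (t - \<epsilon>)) * levi (local_rep c (h t)) x v v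
    + \<kappa> * cosh (\<kappa> * (t - \<epsilon>)) * g c x v v"

lemma barrier_transition:
  assumes "c \<in> A" "c' \<in> A" "p \<in> chart_dom c \<inter> chart_dom c'" "t \<in> {0<..<T}"
  shows "barrier \<kappa> \<epsilon> c t (coords c p) v
    = barrier \<kappa> \<epsilon> c' t (coords c' p) (dd v (transition c c') (coords c p))"
  unfolding barrier_def levi_transition[OF kaehler assms(1-3) smooth_at_time[OF assms(4)]]
    metric_transition[OF kaehler assms(1-3)] ..

lemma barrier_scaleR:
  assumes c: "c \<in> A" and x: "x \<in> coords c ` chart_dom c" and t: "t \<in> {0<..<T}"
  shows "barrier \<kappa> \<epsilon> c t x (r *\<^sub>R v) = r\<^sup>2 * barrier \<kappa> \<epsilon> c t x v"
proof -
  have bl: "bilinear (levi (local_rep c (h t)) x)"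
    using smooth_at_time[OF t] c by (intro bilinear_levi[OF open_coords_image[OF kaehler c] x]) (simp add: smooth_fun_def)
  have bG: "bilinear (g c x)"
    by (rule metric_bilinear[OF open_coords_image[OF kaehler c] chart_metric_riemannian[OF kaehler c] x])
  show ?thesis
    by (simp add: barrier_def bilinear_lmul[OF bl] bilinear_rmul[OF bl] bilinear_lmul[OF bG] bilinear_rmul[OF bG]
        power2_eq_square algebra_simps)
qed

lemma tendsto_barrier:
  assumes c: "c \<in> A" and x: "X \<longlonglongrightarrow> x" "x \<in> coords c ` chart_dom c" "\<And>n. X n \<in> coords c ` chart_dom c"
    and v: "V \<longlonglongrightarrow> v" and t: "\<tau> \<longlonglongrightarrow> t" "t \<in> {0<..<T}" "\<And>n. \<tau> n \<in> {0<..<T}"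
  shows "(\<lambda>n. barrier \<kappa> \<epsilon> c (\<tau> n) (X n) (V n)) \<longlonglongrightarrow> barrier \<kappa> \<epsilon> c t x v"
  unfolding barrier_def
  using tendsto_levi_slice[OF open_greaterThanLessThan open_coords_image[OF kaehler c] x v smooth_joint[OF c] t]
  by (intro tendsto_intros t tendsto_metric[OF open_greaterThanLessThan open_coords_image[OF kaehler c] x v
        chart_metric_riemannian[OF kaehler c]]) simp

text \<open>The inequality is not strict, so that failure survives limits and the failing times in a
  compact interval form a closed set.\<close>

definition barrier_fails :: "real \<Rightarrow> real \<Rightarrow> real \<Rightarrow> bool" where
  "barrier_fails \<kappa> \<epsilon> t \<longleftrightarrow> (\<exists>c\<in>A. \<exists>x\<in>coords c ` chart_dom c. \<exists>v. v \<noteq> 0 \<and> barrier \<kappa> \<epsilon> c t x v \<le> 0)"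

text \<open>The points of failure subconverge in the compact manifold and eventually lie in one
  chart around the limit. There the directions can be normalised, and they subconverge in the unit
  sphere of the coordinate space.\<close>

lemma barrier_fails_limit:
  assumes \<tau>: "\<tau> \<longlonglongrightarrow> t" "t \<in> {0<..<T}" "\<And>n. \<tau> n \<in> {0<..<T}" and fails: "\<And>n. barrier_fails \<kappa> \<epsilon> (\<tau> n)"
  shows "barrier_fails \<kappa> \<epsilon> t"
proof -
  have "\<exists>c p v. c \<in> A \<and> p \<in> chart_dom c \<and> v \<noteq> 0 \<and> barrier \<kappa> \<epsilon> c (\<tau> n) (coords c p) v \<le> 0" for n
    using fails[of n] unfolding barrier_fails_def by blast
  then obtain c' p v' where cpv: "\<And>n. c' n \<in> A" "\<And>n. p n \<in> chart_dom (c' n)" "\<And>n. v' n \<noteq> 0"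
    "\<And>n. barrier \<kappa> \<epsilon> (c' n) (\<tau> n) (coords (c' n) (p n)) (v' n) \<le> 0"
    by metis
  have "seq_compact (UNIV :: 'm set)" using compact by (rule compact_imp_seq_compact)
  then obtain q r where r: "strict_mono r" "(p \<circ> r) \<longlonglongrightarrow> q"
    unfolding seq_compact_def by (metis UNIV_I)
  obtain c where c: "c \<in> A" "q \<in> chart_dom c" using obtain_chart[OF kaehler] by blast
  have "\<forall>\<^sub>F n in sequentially. (p \<circ> r) n \<in> chart_dom c"
    by (rule topological_tendstoD[OF r(2) open_chart_dom[OF kaehler c(1)] c(2)])
  then obtain M where M: "\<And>n. n \<ge> M \<Longrightarrow> p (r n) \<in> chart_dom c"
    unfolding eventually_sequentially by auto
  define s where "s n = r (n + M)" for n
  have ps: "p (s n) \<in> chart_dom c" for n using M by (simp add: s_def)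
  have lim_p: "(\<lambda>n. p (s n)) \<longlonglongrightarrow> q"
    using LIMSEQ_ignore_initial_segment[OF r(2), of M] by (simp add: s_def o_def)
  have lim_t: "(\<lambda>n. \<tau> (s n)) \<longlonglongrightarrow> t"
    using LIMSEQ_ignore_initial_segment[OF LIMSEQ_subseq_LIMSEQ[OF \<tau>(1) r(1)], of M] by (simp add: s_def o_def)
  \<comment> \<open>Transport to the common chart keeps the direction non-zero because the
    transition map has bijective differential; rescaling does not change the sign of the
    barrier.\<close>
  have "\<exists>w. norm w = 1 \<and> barrier \<kappa> \<epsilon> c (\<tau> (s n)) (coords c (p (s n))) w \<le> 0" for n
  proof -
    let ?c' = "c' (s n)" and ?p = "p (s n)"
    have p: "?p \<in> chart_dom ?c' \<inter> chart_dom c" using ps cpv by blast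
    define w where "w = dd (v' (s n)) (transition ?c' c) (coords ?c' ?p)"
    note lin = linear_dd[OF transition_differentiable[OF kaehler cpv(1) c(1) p]]
    have "w \<noteq> 0"
      using bij_is_inj[OF bij_dd_transition[OF kaehler cpv(1) c(1) p]] cpv(3)[of "s n"]
      unfolding w_def linear_injective_0[OF lin] by blast
    moreover have "barrier \<kappa> \<epsilon> c (\<tau> (s n)) (coords c ?p) w \<le> 0"
      using cpv(4)[of "s n"] unfolding w_def barrier_transition[OF cpv(1) c(1) p \<tau>(3)] .
    ultimately have "norm (w /\<^sub>R norm w) = 1"
      and "barrier \<kappa> \<epsilon> c (\<tau> (s n)) (coords c ?p) (w /\<^sub>R norm w) \<le> 0"
      using barrier_scaleR[OF c(1) imageI[OF ps] \<tau>(3), of \<kappa> \<epsilon> "s n" n "inverse (norm w)" w]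
      by (simp_all add: mult_nonneg_nonpos)
    then show ?thesis by blast
  qed
  then obtain u where u: "\<And>n. norm (u n) = 1" "\<And>n. barrier \<kappa> \<epsilon> c (\<tau> (s n)) (coords c (p (s n))) (u n) \<le> 0"
    by metis
  have "seq_compact (sphere (0 :: complex ^ 'n) 1)" by (simp add: compact_imp_seq_compact)
  moreover have "\<forall>n. u n \<in> sphere 0 1" using u by simp
  ultimately obtain w r' where w: "w \<in> sphere 0 1" "strict_mono r'" "(u \<circ> r') \<longlonglongrightarrow> w"
    unfolding seq_compact_def by blast
  have "continuous_on (chart_dom c) (coords c)"
    using chart_homeomorphism[OF kaehler c(1)] by (simp add: homeomorphism_def)
  then have "(\<lambda>n. coords c (p (s n))) \<longlonglongrightarrow> coords c q"
    by (rule continuous_on_tendsto_compose[OF _ lim_p c(2)]) (simp add: ps)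
  from LIMSEQ_subseq_LIMSEQ[OF this w(2)]
  have "(\<lambda>n. barrier \<kappa> \<epsilon> c (\<tau> (s (r' n))) (coords c (p (s (r' n)))) (u (r' n))) \<longlonglongrightarrow> barrier \<kappa> \<epsilon> c t (coords c q) w"
    using c ps w(3) LIMSEQ_subseq_LIMSEQ[OF lim_t w(2)] \<tau>
    by (intro tendsto_barrier[OF c(1)]) (auto simp: o_def)
  then have "barrier \<kappa> \<epsilon> c t (coords c q) w \<le> 0"
    by (rule LIMSEQ_le_const2) (use u in blast)
  moreover have "w \<noteq> 0" using w by auto
  ultimately show ?thesis using c unfolding barrier_fails_def by blast
qed

lemma has_real_derivative_barrier:
  assumes c: "c \<in> A" and t: "t \<in> {0<..<T}" and x: "x \<in> coords c ` chart_dom c"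
  shows "((\<lambda>s. barrier \<kappa> \<epsilon> c s x v) has_real_derivative
    \<kappa> * cosh (\<kappa> * (t - \<epsilon>)) * levi (local_rep c (h t)) x v v
    + sinh (\<kappa> * (t - \<epsilon>)) * (levi (evolution (g c) (local_rep c (h t))) x v v - 1/2 * levi (local_rep c W) x v v)
    + \<kappa>\<^sup>2 * sinh (\<kappa> * (t - \<epsilon>)) * g c x v v) (at t)"
proof -
  let ?D = "coords c ` chart_dom c" and ?P = "\<lambda>(t, x). local_rep c (h t) x"
  note D = open_coords_image[OF kaehler c]
  have sW: "smooth_on ?D (local_rep c W)" using W c by (simp add: smooth_fun_def)
  have sh: "smooth_on ?D (local_rep c (h t))" using smooth_at_time[OF t] c by (simp add: smooth_fun_def)
  have sE: "smooth_on ?D (evolution (g c) (local_rep c (h t)))"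
    by (rule smooth_on_evolution[OF D chart_metric_riemannian[OF kaehler c] sh])
  have "dd (1, 0) ?P (t, y) = evolution (g c) (local_rep c (h t)) y + (- 1/2) * local_rep c W y" if "y \<in> ?D" for y
    using DERIV_unique[OF has_real_derivative_time[OF open_greaterThanLessThan D smooth_joint[OF c] t that, simplified]
        flow[OF c t that]] by simp
  then have "levi (\<lambda>y. dd (1, 0) ?P (t, y)) x v v
      = levi (\<lambda>y. evolution (g c) (local_rep c (h t)) y + (- 1/2) * local_rep c W y) x v v"
    by (rule levi_cong[OF D x])
  also have "\<dots> = levi (evolution (g c) (local_rep c (h t))) x v v - 1/2 * levi (local_rep c W) x v v"
    unfolding levi_add[OF D x sE smooth_on_linear_compose[OF D bounded_linear_mult_right sW]]
      levi_linear_compose[OF D x sW bounded_linear_mult_right] by simp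
  finally have "((\<lambda>s. levi (local_rep c (h s)) x v v) has_real_derivative
      levi (evolution (g c) (local_rep c (h t))) x v v - 1/2 * levi (local_rep c W) x v v) (at t)"
    using has_real_derivative_levi[OF open_greaterThanLessThan D smooth_joint[OF c] t x, of v] by simp
  then show ?thesis
    unfolding barrier_def
    by (auto intro!: derivative_eq_intros simp: power2_eq_square algebra_simps)
qed

text \<open>At the first failing time the barrier has just come down to zero, so its time derivative
  there is at most zero. The evolution inequality shows that this derivative is positive.\<close>

lemma barrier_positive:
  assumes \<kappa>: "\<kappa> > \<bar>k\<bar>" and \<epsilon>: "\<epsilon> > 0" and t: "\<epsilon> < t" "t < T"
  shows "\<not> barrier_fails \<kappa> \<epsilon> t"
proof
  assume fail: "barrier_fails \<kappa> \<epsilon> t"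
  have \<kappa>0: "\<kappa> > 0" using \<kappa> by simp
  have mpos: "g c x v v > 0" if "c \<in> A" "x \<in> coords c ` chart_dom c" "v \<noteq> 0" for c x v
    using riemannian_metric_inner_form[OF chart_metric_riemannian[OF kaehler that(1)] that(2)] that(3)
    by (simp add: inner_form_def)
  define B where "B = {s \<in> {\<epsilon>..t}. barrier_fails \<kappa> \<epsilon> s}"
  define t0 where "t0 = Inf B"
  have inI: "s \<in> {0<..<T}" if "s \<in> {\<epsilon>..t}" for s using that \<epsilon> t by auto
  have "closed B"
    unfolding closed_sequential_limits
  proof (intro allI impI)
    fix \<tau> l assume \<tau>: "(\<forall>n. \<tau> n \<in> B) \<and> \<tau> \<longlonglongrightarrow> l"
    then have \<tau>B: "\<tau> n \<in> {\<epsilon>..t}" "barrier_fails \<kappa> \<epsilon> (\<tau> n)" for n by (auto simp: B_def)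
    have l: "l \<in> {\<epsilon>..t}"
      using closed_sequentially[OF closed_atLeastAtMost \<tau>B(1) conjunct2[OF \<tau>]] .
    then have "barrier_fails \<kappa> \<epsilon> l"
      using barrier_fails_limit[OF conjunct2[OF \<tau>] inI inI \<tau>B(2)] \<tau>B(1) by blast
    then show "l \<in> B" using l by (simp add: B_def)
  qed
  moreover have "B \<noteq> {}" using fail t by (auto simp: B_def)
  moreover have bdd: "bdd_below B" unfolding B_def by (rule bdd_belowI[of _ \<epsilon>]) auto
  ultimately have "t0 \<in> B" unfolding t0_def by (rule closed_contains_Inf[rotated 2])
  then have t0: "t0 \<in> {\<epsilon>..t}" and "barrier_fails \<kappa> \<epsilon> t0" by (auto simp: B_def)
  then obtain c x v where c: "c \<in> A" and x: "x \<in> coords c ` chart_dom c" and v: "v \<noteq> 0"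
    and le: "barrier \<kappa> \<epsilon> c t0 x v \<le> 0"
    unfolding barrier_fails_def by blast
  note t0I = inI[OF t0]
  \<comment> \<open>At \<epsilon> the hyperbolic sine vanishes and only \<kappa> times the metric is
    left. No information about the solution is used to start the comparison.\<close>
  have "t0 \<noteq> \<epsilon>" using le mpos[OF c x v] \<kappa>0 by (auto simp: barrier_def mult_le_0_iff)
  then have t0\<epsilon>: "\<epsilon> < t0" using t0 by simp
  have before: "barrier \<kappa> \<epsilon> c s y u > 0" if "\<epsilon> < s" "s < t0" "y \<in> coords c ` chart_dom c" "u \<noteq> 0" for s y u
  proof (rule ccontr)
    assume "\<not> ?thesis"
    then have "barrier_fails \<kappa> \<epsilon> s" using that c unfolding barrier_fails_def by force
    then have "s \<in> B" using that t0 by (auto simp: B_def)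
    then show False using cInf_lower[OF _ bdd, of s] that(2) by (simp add: t0_def)
  qed
  note der = has_real_derivative_barrier[OF c t0I]
  \<comment> \<open>The strict inequality before \<open>t0\<close> passes to a weak one at
    \<open>t0\<close> as a limit from the left. This holds at all points of the chart and in all
    directions, so the zero found there is a minimum.\<close>
  have nonneg: "barrier \<kappa> \<epsilon> c t0 y u \<ge> 0" if y: "y \<in> coords c ` chart_dom c" for y u
  proof (cases "u = 0")
    case True
    then show ?thesis using barrier_scaleR[OF c y t0I, of \<kappa> \<epsilon> 0 u] by simp
  next
    case False
    have "((\<lambda>s. barrier \<kappa> \<epsilon> c s y u) \<longlongrightarrow> barrier \<kappa> \<epsilon> c t0 y u) (at_left t0)"
      by (rule tendsto_within_subset[OF DERIV_isCont[OF der[OF y], unfolded isCont_def] subset_UNIV])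
    moreover have "\<forall>\<^sub>F s in at_left t0. 0 \<le> barrier \<kappa> \<epsilon> c s y u"
      using before[OF _ _ y False] t0\<epsilon> unfolding eventually_at_left_field by (metis less_eq_real_def)
    ultimately show ?thesis by (rule tendsto_lowerbound) simp
  qed
  have zero: "barrier \<kappa> \<epsilon> c t0 x v = 0" using le nonneg[OF x, of v] by simp
  define a where "a = sinh (\<kappa> * (t0 - \<epsilon>))"
  define b where "b = \<kappa> * cosh (\<kappa> * (t0 - \<epsilon>))"
  define L where "L = levi (local_rep c (h t0)) x v v"
  define E where "E = levi (evolution (g c) (local_rep c (h t0))) x v v"
  define M where "M = g c x v v"
  have a: "a > 0" using \<kappa>0 t0\<epsilon> by (simp add: a_def)
  have M: "M > 0" unfolding M_def by (rule mpos[OF c x v])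
  have bM: "b * M = - a * L" using zero by (simp add: barrier_def a_def b_def L_def M_def)
  have LE: "L\<^sup>2 \<le> M * E"
    unfolding L_def M_def E_def
  proof (rule levi_evolution_inequality[OF open_coords_image[OF kaehler c] x chart_metric[OF kaehler c] _ a])
    show "smooth_on (coords c ` chart_dom c) (local_rep c (h t0))"
      using smooth_at_time[OF t0I] c by (simp add: smooth_fun_def)
    show "0 \<le> g c x (Rm (g c) x w v v) w + g c x (Rm (g c) x w (J v) (J v)) w" for w
      using curv c x unfolding nonneg_bisectional_curvature_def by blast
    show "0 \<le> a * levi (local_rep c (h t0)) y u u + b * g c y u u" if "y \<in> coords c ` chart_dom c" for y u
      using nonneg[OF that, of u] by (simp add: barrier_def a_def b_def)
    show "a * levi (local_rep c (h t0)) x v v + b * g c x v v = 0"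
      using zero by (simp add: barrier_def a_def b_def)
  qed
  define d where "d = b * L + a * (E - 1/2 * levi (local_rep c W) x v v) + \<kappa>\<^sup>2 * a * M"
  have der0: "((\<lambda>s. barrier \<kappa> \<epsilon> c s x v) has_real_derivative d) (at t0)"
    using der[OF x, of \<kappa> \<epsilon> v] unfolding d_def a_def b_def L_def E_def M_def .
  have "d \<le> 0"
  proof (rule ccontr)
    assume "\<not> d \<le> 0"
    then obtain e where e: "e > 0" "\<And>s. 0 < s \<Longrightarrow> s < e \<Longrightarrow> barrier \<kappa> \<epsilon> c (t0 - s) x v < barrier \<kappa> \<epsilon> c t0 x v"
      using DERIV_pos_inc_left[OF der0] by auto
    define s where "s = min e (t0 - \<epsilon>) / 2"
    have "0 < s" "s < e" "s < t0 - \<epsilon>" using e(1) t0\<epsilon> by (auto simp: s_def)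
    then show False using e(2)[of s] before[of "t0 - s", OF _ _ x v] zero by simp
  qed
  \<comment> \<open>In \<open>M * d\<close> the zero of the barrier turns the term with
    \<open>b\<close> into \<open>- a * L\<^sup>2\<close>, which the evolution inequality
    compensates. The potential costs at most \<open>a * k\<^sup>2 * M\<^sup>2\<close>, strictly less
    than the gain \<open>a * \<kappa>\<^sup>2 * M\<^sup>2\<close>.\<close>
  moreover have "M * d > 0"
  proof -
    have "a * L\<^sup>2 \<le> a * (M * E)" using LE a by simp
    moreover have "a * M * levi (local_rep c W) x v v \<le> a * M * (2 * k\<^sup>2 * M)"
      using levi_W[OF c x, of v] a M by (intro mult_left_mono) (auto simp: M_def)
    moreover have "M * (b * L) = - (a * L\<^sup>2)"
      using arg_cong[OF bM, of "\<lambda>z. z * L"] by (simp add: power2_eq_square algebra_simps)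
    moreover have "a * (M * M) * k\<^sup>2 < a * (M * M) * \<kappa>\<^sup>2"
      using \<kappa> a M by (intro mult_strict_left_mono) (auto simp: abs_less_iff intro: power2_strict_mono)
    ultimately show ?thesis unfolding d_def by (simp add: algebra_simps)
  qed
  ultimately show False using M by (simp add: zero_less_mult_iff)
qed

lemma levi_lower_bound:
  assumes c: "c \<in> A" and x: "x \<in> coords c ` chart_dom c" and t: "t \<in> {0<..<T}" and k: "k \<noteq> 0"
  shows "- (k * coth (k * t)) * g c x v v \<le> levi (local_rep c (h t)) x v v"
proof -
  \<comment> \<open>The double successor makes the starting time strictly smaller than
    \<open>t\<close> already for \<open>n = 0\<close>.\<close>
  let ?\<kappa> = "\<lambda>n. \<bar>k\<bar> + inverse (real (Suc n))" and ?\<epsilon> = "\<lambda>n. t * inverse (real (Suc (Suc n)))"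
  have t0: "t > 0" "t < T" using t by auto
  have "barrier (?\<kappa> n) (?\<epsilon> n) c t x v \<ge> 0" for n
  proof (cases "v = 0")
    case True
    then show ?thesis using barrier_scaleR[OF c x t, of "?\<kappa> n" "?\<epsilon> n" 0 v] by simp
  next
    case False
    have "inverse (real (Suc (Suc n))) < 1" by (rule inverse_less_1_iff[THEN iffD2]) simp
    then have "\<not> barrier_fails (?\<kappa> n) (?\<epsilon> n) t"
      using t0 by (intro barrier_positive) auto
    then show ?thesis using c x False unfolding barrier_fails_def by force
  qed
  moreover have "(\<lambda>n. barrier (?\<kappa> n) (?\<epsilon> n) c t x v) \<longlonglongrightarrow> barrier (\<bar>k\<bar> + 0) (t * 0) c t x v"
    unfolding barrier_def
    by (intro tendsto_intros LIMSEQ_inverse_real_of_nat LIMSEQ_Suc[OF LIMSEQ_inverse_real_of_nat])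
  ultimately have "barrier \<bar>k\<bar> 0 c t x v \<ge> 0"
    using LIMSEQ_le_const[of _ "barrier (\<bar>k\<bar> + 0) (t * 0) c t x v" 0] by auto
  \<comment> \<open>The expression is even in \<open>k\<close>; this connects the sign-free barrier
    with the stated bound for negative \<open>k\<close>.\<close>
  moreover have "k * coth (k * t) = \<bar>k\<bar> * cosh (\<bar>k\<bar> * t) / sinh (\<bar>k\<bar> * t)"
    by (cases "k \<ge> 0") (auto simp: coth_def)
  moreover have "sinh (\<bar>k\<bar> * t) > 0" using k t0 by simp
  ultimately show ?thesis by (simp add: barrier_def field_simps)
qed

end

section \<open>The flow of the logarithm\<close>

text \<open>The squared gradient of \<open>ln r\<close> cancels the negative term in the Laplacian
  of \<open>ln r\<close>. The cross term with half of \<open>f\<close> is the drift divided by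
  \<open>r\<close>, and its own square leaves a quarter of the squared gradient of
  \<open>f\<close>.\<close>

lemma evolution_log:
  fixes G :: "(complex ^ 'n::finite) metric_field"
  assumes S: "open S" "x \<in> S" and K: "kaehler_metric_on S G"
    and r: "smooth_on S r" and pos: "\<And>y. y \<in> S \<Longrightarrow> r y > 0" and f: "smooth_on S f"
  shows "evolution G (\<lambda>y. ln (r y) + 1/2 * f y) x
    = (laplace_beltrami G r x + G x (gradient G r x) (gradient G f x)) / r x
      + 1/2 * (laplace_beltrami G f x + 1/2 * G x (gradient G f x) (gradient G f x))"
proof -
  note G = kaehler_riemannian[OF S(1) K]
  note bG = metric_bilinear[OF S(1) G S(2)]
  note d = smooth_onD_differentiable
  have lr: "smooth_on S (\<lambda>y. ln (r y))" by (rule smooth_on_ln[OF S(1) r pos])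
  have hf: "smooth_on S (\<lambda>y. 1/2 * f y)" by (rule smooth_on_linear_compose[OF S(1) bounded_linear_mult_right f])
  define h where "h y = ln (r y) + 1/2 * f y" for y
  have h: "smooth_on S h" unfolding h_def by (rule smooth_on_add[OF S(1) lr hf])
  have "G x (gradient G h x) w = G x ((1 / r x) *\<^sub>R gradient G r x + (1/2) *\<^sub>R gradient G f x) w" for w
  proof -
    have "dd w (\<lambda>y. ln (r y)) x = dd w r x * inverse (r x)"
      by (rule dd_eqI[OF has_derivative_ln[OF pos[OF S(2)] has_derivative_dd[OF d[OF r S(2)]]]])
    moreover have "dd w h x = dd w (\<lambda>y. ln (r y)) x + dd w (\<lambda>y. 1/2 * f y) x"
      unfolding h_def by (rule dd_add[OF d[OF lr S(2)] d[OF hf S(2)]])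
    moreover have "dd w (\<lambda>y. 1/2 * f y) x = 1/2 * dd w f x" by (rule dd_cmult[OF d[OF f S(2)]])
    ultimately have "dd w h x = (1 / r x) * dd w r x + (1/2) * dd w f x"
      by (simp only: inverse_eq_divide mult.commute)
    then show ?thesis
      unfolding bilinear_ladd[OF bG] bilinear_lmul[OF bG] metric_gradient[OF S(1) G S(2) h]
        metric_gradient[OF S(1) G S(2) r] metric_gradient[OF S(1) G S(2) f] by simp
  qed
  then have grad: "gradient G h x = (1 / r x) *\<^sub>R gradient G r x + (1/2) *\<^sub>R gradient G f x"
    by (rule metric_nondegenerate[OF S(1) G S(2)])
  have "1/2 * trace_form (G x) (levi h x) = laplace_beltrami G h x"
    by (rule laplace_beltrami_eq_trace_levi[OF S(1) K S(2) h, symmetric])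
  also have "\<dots> = laplace_beltrami G (\<lambda>y. ln (r y)) x + 1/2 * laplace_beltrami G f x"
    unfolding h_def[abs_def] by (rule laplace_beltrami_add_cmult[OF S(1) G S(2) lr f])
  also have "laplace_beltrami G (\<lambda>y. ln (r y)) x
      = laplace_beltrami G r x / r x - G x (gradient G r x) (gradient G r x) / (r x)\<^sup>2"
    by (rule laplace_beltrami_ln[OF S(1) G S(2) r pos])
  finally have trace: "1/2 * trace_form (G x) (levi h x) = \<dots> + 1/2 * laplace_beltrami G f x" .
  have "evolution G h x
    = (laplace_beltrami G r x + G x (gradient G r x) (gradient G f x)) / r x
      + 1/2 * (laplace_beltrami G f x + 1/2 * G x (gradient G f x) (gradient G f x))"
    unfolding evolution_def trace grad bilinear_ladd[OF bG] bilinear_radd[OF bG] bilinear_lmul[OF bG] bilinear_rmul[OF bG]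
      metric_sym[OF S(1) G S(2), of "gradient G f x" "gradient G r x"]
    by (simp add: power2_eq_square add_divide_distrib)
  then show ?thesis by (simp add: h_def[abs_def])
qed

theorem corollary1p5:
  fixes A :: "('m::{t2_space, second_countable_topology}, 'n::finite) chart set"
    and g :: "('m, 'n) metric_tensor"
    and f U W :: "'m \<Rightarrow> real"
    and \<rho> :: "real \<Rightarrow> 'm \<Rightarrow> real"
    and T k :: real
  assumes kaehler: "kaehler_manifold A g"
    and compact: "compact (UNIV :: 'm set)"
    and smooth_f: "smooth_fun A f"
    and smooth_U: "smooth_fun A U"
    and smooth_rho: "smooth_time_fun A {0<..<T} \<rho>"
    and pos_rho: "\<And>t p. t \<in> {0<..<T} \<Longrightarrow> \<rho> t p > 0"
    and heat_eq: "\<And>t p. t \<in> {0<..<T} \<Longrightarrow>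
      ((\<lambda>s. \<rho> s p) has_real_derivative
        Laplacian A g (\<rho> t) p + grad_inner A g (\<rho> t) f p + U p * \<rho> t p) (at t)"
    and W_def: "W = (\<lambda>p. Laplacian A g f p + 1/2 * grad_inner A g f f p - 2 * U p)"
    and k: "k \<noteq> 0"
    and curv: "nonneg_bisectional_curvature A g"
    and hess_W: "\<And>c p. c \<in> A \<Longrightarrow> p \<in> chart_dom c \<Longrightarrow>
      tangent_endo_le g c p
        (\<lambda>v. (1/2) *\<^sub>R (Hess g c p W v + J_conj g c p (Hess g c p W) v))
        (\<lambda>v. k\<^sup>2 *\<^sub>R v)"
  shows "\<forall>t \<in> {0<..<T}. \<forall>c \<in> A. \<forall>p \<in> chart_dom c.
    tangent_endo_le g c p
      (\<lambda>v. - (k * coth (k * t)) *\<^sub>R v)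
      (\<lambda>v. Hess g c p (\<lambda>q. ln (\<rho> t q) + 1/2 * f q) v
         + J_conj g c p (Hess g c p (\<lambda>q. ln (\<rho> t q) + 1/2 * f q)) v)"
proof -
  let ?I = "{0<..<T}" and ?D = "\<lambda>c :: ('m, 'n) chart. coords c ` chart_dom c"
  define h where "h t q = ln (\<rho> t q) + 1/2 * f q" for t q
  note D = open_coords_image[OF kaehler] and K = chart_metric[OF kaehler]
    and R = chart_metric_riemannian[OF kaehler]
  have sf: "smooth_on (?D c) (local_rep c f)" if "c \<in> A" for c
    using smooth_f that by (simp add: smooth_fun_def)
  have s\<rho>: "smooth_on (?I \<times> ?D c) (\<lambda>(t, x). local_rep c (\<rho> t) x)" if "c \<in> A" for c
    using smooth_rho that by (simp add: smooth_time_fun_def)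
  have s\<rho>t: "smooth_on (?D c) (local_rep c (\<rho> t))" if "c \<in> A" "t \<in> ?I" for c t
    using smooth_on_slice[OF open_greaterThanLessThan D[OF that(1)] s\<rho>[OF that(1)] that(2)] by simp
  then have \<rho>t: "smooth_fun A (\<rho> t)" if "t \<in> ?I" for t
    using that by (simp add: smooth_fun_def)
  have lap: "Laplacian A g u p = laplace_beltrami (g c) (local_rep c u) (coords c p)"
    if "c \<in> A" "p \<in> chart_dom c" "smooth_fun A u" for c p u
    using laplace_beltrami_eq_trace_levi[OF D K imageI[OF that(2)], of "local_rep c u"] that
    by (simp add: Laplacian_chart[OF kaehler] smooth_fun_def)
  have h: "smooth_time_fun A ?I h"
    unfolding smooth_time_fun_def
  proof
    fix c assume c: "c \<in> A"
    note op = open_Times[OF open_greaterThanLessThan D[OF c], of 0 T]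
    have "smooth_on (?I \<times> ?D c) (\<lambda>q. local_rep c f (snd q))"
      by (rule smooth_on_compose[OF D[OF c] op _ smooth_on_linear_compose[OF op bounded_linear_snd smooth_on_ident[OF op]] sf[OF c]])
        auto
    then have "smooth_on (?I \<times> ?D c) (\<lambda>q. ln ((\<lambda>(t, x). local_rep c (\<rho> t) x) q) + 1/2 * local_rep c f (snd q))"
      using pos_rho by (intro smooth_on_add smooth_on_ln smooth_on_linear_compose[OF op bounded_linear_mult_right] op s\<rho> c)
        (auto simp: local_rep_apply)
    then show "smooth_on (?I \<times> ?D c) (\<lambda>(t, x). local_rep c (h t) x)"
      by (simp add: case_prod_unfold h_def local_rep_apply)
  qed
  have Wc: "local_rep c W x = laplace_beltrami (g c) (local_rep c f) x
      + 1/2 * g c x (gradient (g c) (local_rep c f) x) (gradient (g c) (local_rep c f) x) - 2 * local_rep c U x"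
    if "c \<in> A" "x \<in> ?D c" for c x
    using that by (auto simp: W_def local_rep_apply chart_inv_coords[OF kaehler] lap smooth_f
        grad_inner_chart[OF kaehler _ _ smooth_f smooth_f])
  \<comment> \<open>The defining expression of \<open>W\<close> chooses a chart at each point.
    Smoothness is read off from its formula in one fixed chart, with the Laplacian written as a
    trace.\<close>
  have sW: "smooth_on (?D c) (local_rep c W)" if c: "c \<in> A" for c
  proof -
    have sU: "smooth_on (?D c) (local_rep c U)" using smooth_U c by (simp add: smooth_fun_def)
    have "smooth_on (?D c) (\<lambda>x. 1/2 * trace_form (g c x) (levi (local_rep c f) x)
        + 1/2 * g c x (gradient (g c) (local_rep c f) x) (gradient (g c) (local_rep c f) x) - 2 * local_rep c U x)"
      by (intro smooth_on_diff smooth_on_add smooth_on_linear_compose[OF D[OF c] bounded_linear_mult_right]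
          smooth_on_trace_levi smooth_on_metric_gradient D[OF c] R[OF c] sf[OF c] sU)
    then show ?thesis
      using smooth_on_cong[OF D[OF c], of "local_rep c W"] Wc[OF c]
        laplace_beltrami_eq_trace_levi[OF D[OF c] K[OF c] _ sf[OF c]] by simp
  qed
  have flow: "((\<lambda>s. local_rep c (h s) x) has_real_derivative
      evolution (g c) (local_rep c (h t)) x - 1/2 * local_rep c W x) (at t)"
    if c: "c \<in> A" and t: "t \<in> ?I" and x: "x \<in> ?D c" for c t x
  proof -
    obtain p where p: "p \<in> chart_dom c" "x = coords c p" using x by blast
    have inv: "chart_inv c x = p" using chart_inv_coords[OF kaehler c p(1)] p(2) by simp
    have pos: "\<rho> t p > 0" by (rule pos_rho[OF t])
    have "((\<lambda>s. ln (\<rho> s p) + a) has_real_derivative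
        (Laplacian A g (\<rho> t) p + grad_inner A g (\<rho> t) f p + U p * \<rho> t p) / \<rho> t p) (at t)" for a
      using DERIV_add[OF DERIV_chain2[where f = ln, OF DERIV_ln[OF pos] heat_eq[OF t]] DERIV_const]
      by (simp add: field_simps)
    \<comment> \<open>What remains after completing the square, \<open>U\<close> minus half of the
      Laplacian and a quarter of the squared gradient of \<open>f\<close>, is minus half of
      \<open>W\<close>.\<close>
    moreover have "(Laplacian A g (\<rho> t) p + grad_inner A g (\<rho> t) f p + U p * \<rho> t p) / \<rho> t p
        = evolution (g c) (\<lambda>y. ln (local_rep c (\<rho> t) y) + 1/2 * local_rep c f y) x - 1/2 * local_rep c W x"
    proof -
      have "0 < local_rep c (\<rho> t) y" for y by (simp add: local_rep_apply pos_rho[OF t])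
      note E = evolution_log[OF D[OF c] x K[OF c] s\<rho>t[OF c t] this sf[OF c]]
      show ?thesis
        unfolding E Wc[OF c x] lap[OF c p(1) \<rho>t[OF t]] grad_inner_chart[OF kaehler c p(1) \<rho>t[OF t] smooth_f] p(2)[symmetric]
        using pos by (simp add: local_rep_apply inv field_simps)
    qed
    ultimately have "((\<lambda>s. ln (\<rho> s p) + 1/2 * f p) has_real_derivative
        evolution (g c) (\<lambda>y. ln (local_rep c (\<rho> t) y) + 1/2 * local_rep c f y) x - 1/2 * local_rep c W x) (at t)"
      by simp
    then show ?thesis by (simp add: h_def[abs_def] local_rep_def o_def inv)
  qed
  have HJ: "g c (coords c p) (Hess g c p u v + J_conj g c p (Hess g c p u) v) v = levi (local_rep c u) (coords c p) v v"
    if "c \<in> A" "p \<in> chart_dom c" "smooth_on (?D c) (local_rep c u)" for c p u v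
    using metric_hessian_J[OF D K imageI[OF that(2)] that(3)] that(1) by (simp add: Hess_def J_conj_def)
  \<comment> \<open>The factor 2 undoes the one half in front of the symmetrised Hessian in the
    hypothesis on \<open>W\<close>.\<close>
  have levi_W: "levi (local_rep c W) x v v \<le> 2 * k\<^sup>2 * g c x v v" if c: "c \<in> A" and x: "x \<in> ?D c" for c x v
  proof -
    obtain p where p: "p \<in> chart_dom c" "x = coords c p" using x by blast
    note bG = metric_bilinear[OF D[OF c] R[OF c] x]
    have "g c x ((1/2) *\<^sub>R (Hess g c p W v + J_conj g c p (Hess g c p W) v)) v \<le> g c x (k\<^sup>2 *\<^sub>R v) v"
      using hess_W[OF c p(1)] by (simp add: tangent_endo_le_def endo_le_def p(2))
    then show ?thesis
      using HJ[OF c p(1) sW[OF c], of v] by (simp add: bilinear_lmul[OF bG] p(2)[symmetric])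
  qed
  have W: "smooth_fun A W" using sW by (simp add: smooth_fun_def)
  have bound: "- (k * coth (k * t)) * g c x v v \<le> levi (local_rep c (h t)) x v v"
    if "c \<in> A" "x \<in> ?D c" "t \<in> ?I" for c x t v
    by (rule levi_lower_bound[OF kaehler compact h W flow curv levi_W that k])
  show ?thesis
  proof (intro ballI)
    fix t c p assume t: "t \<in> ?I" and c: "c \<in> A" and p: "p \<in> chart_dom c"
    note x = imageI[OF p, of "coords c"]
    have sh: "smooth_on (?D c) (local_rep c (h t))"
      using h c smooth_on_slice[OF open_greaterThanLessThan D[OF c] _ t, of "\<lambda>(t, x). local_rep c (h t) x"]
      by (simp add: smooth_time_fun_def)
    show "tangent_endo_le g c p (\<lambda>v. - (k * coth (k * t)) *\<^sub>R v)
      (\<lambda>v. Hess g c p (\<lambda>q. ln (\<rho> t q) + 1/2 * f q) v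
         + J_conj g c p (Hess g c p (\<lambda>q. ln (\<rho> t q) + 1/2 * f q)) v)"
      unfolding tangent_endo_le_def endo_le_def h_def[symmetric] HJ[OF c p sh]
        bilinear_lmul[OF metric_bilinear[OF D[OF c] R[OF c] x]] real_scaleR_def
      using bound[OF c x t] by simp
  qed
qed

end
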